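(* The dual Radon transform $S$ is a linear map of the right $\mathbb R_n$-module $\mathcal S_0$ onto $\mathcal M_0$. Moreover, $$\mathcal S_0=\ker(S)\oplus \mathcal{SM}_0 ,$$ and $S$ restricted to $\mathcal{SM}_0$ is an isomorphism of $\mathcal{SM}_0$ onto $\mathcal M_0$.
   Context: $\mathbb R_n$ is the real Clifford algebra generated by $e_1,\dots,e_n$ with $e_ie_j+e_je_i=-2\delta_{ij}$. A vector $\underline x=(x_1,\dots,x_n)\in\mathbb R^n$ is identified with $\underline x=\sum_j x_je_j$, and a point $x=(x_0,\underline x)\in\mathbb R^{n+1}$ with $x=x_0+\underline x$. Let $S^{n-1}=\{\underline\omega=\sum_j\omega_je_j:\sum_j\omega_j^2=1\}$. A real differentiable $f:U\to\mathbb R_n$, $U\subseteq\mathbb R^{n+1}$ open, is monogenic if $(\partial_{x_0}+\sum_{j=1}^n e_j\partial_{x_j})f=0$. $\mathcal M_0$ is the right $\mathbb R_n$-module of monogenic functions on all of $\mathbb R^{n+1}$; $\underline{\mathcal M}_0$ is the set of restrictions $f(0,\underline x)$ of functions $f\in\mathcal M_0$ to the hyperplane $x_0=0$. A smooth $f:U\times S^{n-1}\to\mathbb R_n$, $U\subseteq\mathbb R^2$ open, with variables $(x_0,p,\underline\omega)$, is slice monogenic if $\frac12(\partial_{x_0}+\underline\omega\,\partial_p)f(x_0,p,\underline\omega)=0$ for every $\underline\omega\in S^{n-1}$; it is even if $f(x_0,-p,-\underline\omega)=f(x_0,p,\underline\omega)$. $\mathcal S_0$ is the right $\mathbb R_n$-module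 of even slice monogenic functions on $\mathbb R^2\times S^{n-1}$. $\mathcal{SM}_0$ is the set of $f\in\mathcal S_0$ for which there is $f_0\in\underline{\mathcal M}_0$ with $f(0,p,\underline\omega)=f_0(p\underline\omega)$ for all $(p,\underline\omega)\in\mathbb R\times S^{n-1}$. The dual Radon transform of a smooth $f$ on $\mathbb R^2\times S^{n-1}$ is $S[f](x_0,\underline x)=\frac{1}{A_n}\int_{S^{n-1}} f(x_0,(\underline x,\underline\omega),\underline\omega)\,d\underline\omega$, where $(\cdot,\cdot)$ is the Euclidean scalar product on $\mathbb R^n$, $d\underline\omega$ the surface measure and $A_n$ the area of $S^{n-1}$. *)

theory Defs
  imports "HOL-Analysis.Analysis"
begin

text \<open>Real Clifford algebra R_n with generators e_j, j ranging over a finite linearly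
  ordered index type 'n (so n = CARD('n)).  An element is a real vector indexed by the
  subsets A of 'n (coefficient of the blade e_A = e_{i1} ... e_{ik}, i1 < ... < ik).\<close>

type_synonym 'n clif = "real ^ ('n set)"
type_synonym 'n slicefun = "real \<times> real \<times> (real ^ 'n) \<Rightarrow> 'n clif"
type_synonym 'n monofun = "real \<times> (real ^ 'n) \<Rightarrow> 'n clif"

definition clsign :: "'n::{finite,linorder} set \<Rightarrow> 'n set \<Rightarrow> real" where
  "clsign A B = (-1) ^ (card {(i, j). i \<in> A \<and> j \<in> B \<and> j < i} + card (A \<inter> B))"

text \<open>Clifford product: e_A e_B = clsign A B e_{A symmetric-difference B}, so e_i e_j + e_j e_i = -2 delta_ij.\<close>
definition clmul :: "'n::{finite,linorder} clif \<Rightarrow> 'n clif \<Rightarrow> 'n clif" (infixl "\<odot>" 70) where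
  "a \<odot> b = (\<chi> C. \<Sum>A\<in>UNIV. \<Sum>B\<in>UNIV.
      if (A - B) \<union> (B - A) = C then clsign A B * (a $ A) * (b $ B) else 0)"

definition gen :: "'n::{finite,linorder} \<Rightarrow> 'n clif" where
  "gen j = (\<chi> A. if A = {j} then 1 else 0)"

definition vec_cl :: "(real ^ ('n::{finite,linorder})) \<Rightarrow> 'n clif" where
  "vec_cl x = (\<Sum>j\<in>UNIV. (x $ j) *\<^sub>R gen j)"

fun Ck :: "nat \<Rightarrow> ('a::real_normed_vector \<Rightarrow> 'b::real_normed_vector) \<Rightarrow> bool" where
  "Ck 0 f = continuous_on UNIV f"
| "Ck (Suc k) f = ((\<forall>z. f differentiable (at z)) \<and>
      (\<forall>v. Ck k (\<lambda>z. frechet_derivative f (at z) v)))"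

definition smooth :: "('a::real_normed_vector \<Rightarrow> 'b::real_normed_vector) \<Rightarrow> bool" where
  "smooth f \<longleftrightarrow> (\<forall>k. Ck k f)"

definition monogenic :: "(real \<times> (real ^ ('n::{finite,linorder})) \<Rightarrow> 'n clif) \<Rightarrow> bool" where
  "monogenic f \<longleftrightarrow> (\<forall>z. f differentiable (at z)) \<and>
     (\<forall>x0 x. vector_derivative (\<lambda>t. f (t, x)) (at x0)
        + (\<Sum>j\<in>UNIV. gen j \<odot> vector_derivative (\<lambda>t. f (x0, x + t *\<^sub>R axis j 1)) (at 0)) = 0)"

definition M0 :: "(real \<times> (real ^ ('n::{finite,linorder})) \<Rightarrow> 'n clif) set" where
  "M0 = {f. monogenic f}"

definition M0_restr :: "((real ^ ('n::{finite,linorder})) \<Rightarrow> 'n clif) set" where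
  "M0_restr = {g. \<exists>f\<in>M0. \<forall>x. g x = f (0, x)}"

text \<open>Functions on R^2 x S^{n-1}, variables (x0, p, omega), are represented as functions on
  R x R x R^n that vanish for omega outside the unit sphere (so equality of such representatives
  is equality of functions on R^2 x S^{n-1}).  Smoothness on the submanifold R^2 x S^{n-1} means
  being the restriction of a smooth function on R x R x R^n.\<close>
definition smooth_slice :: "(real \<times> real \<times> (real ^ ('n::{finite,linorder})) \<Rightarrow> 'n clif) \<Rightarrow> bool" where
  "smooth_slice f \<longleftrightarrow>
     (\<forall>x0 p w. w \<notin> sphere 0 1 \<longrightarrow> f (x0, p, w) = 0) \<and>
     (\<exists>F. smooth F \<and> (\<forall>x0 p w. w \<in> sphere 0 1 \<longrightarrow> F (x0, p, w) = f (x0, p, w)))"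

definition slice_monogenic :: "(real \<times> real \<times> (real ^ ('n::{finite,linorder})) \<Rightarrow> 'n clif) \<Rightarrow> bool" where
  "slice_monogenic f \<longleftrightarrow> smooth_slice f \<and>
     (\<forall>w\<in>sphere 0 1. \<forall>x0 p.
        (1/2) *\<^sub>R (vector_derivative (\<lambda>t. f (t, p, w)) (at x0)
           + vec_cl w \<odot> vector_derivative (\<lambda>t. f (x0, t, w)) (at p)) = 0)"

definition even_slice :: "(real \<times> real \<times> (real ^ ('n::{finite,linorder})) \<Rightarrow> 'n clif) \<Rightarrow> bool" where
  "even_slice f \<longleftrightarrow> (\<forall>x0 p. \<forall>w\<in>sphere 0 1. f (x0, -p, -w) = f (x0, p, w))"

definition S0 :: "(real \<times> real \<times> (real ^ ('n::{finite,linorder})) \<Rightarrow> 'n clif) set" where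
  "S0 = {f. slice_monogenic f \<and> even_slice f}"

definition SM0 :: "(real \<times> real \<times> (real ^ ('n::{finite,linorder})) \<Rightarrow> 'n clif) set" where
  "SM0 = {f\<in>S0. \<exists>f0\<in>M0_restr. \<forall>p. \<forall>w\<in>sphere 0 1. f (0, p, w) = f0 (p *\<^sub>R w)}"

text \<open>Normalized surface integral (1/A_n) \<integral>_{S^{n-1}} g d omega, realised as the average over
  the unit ball of g(y/|y|) (the normalized surface measure is the image of normalized Lebesgue
  measure on the unit ball under radial projection).\<close>
definition sphere_avg :: "((real ^ 'n) \<Rightarrow> 'b::euclidean_space) \<Rightarrow> 'b" where
  "sphere_avg g = integral (ball 0 1) (\<lambda>y. g (y /\<^sub>R norm y)) /\<^sub>R measure lborel (ball (0::real^'n) 1)"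

definition dualRadon :: "(real \<times> real \<times> (real ^ ('n::{finite,linorder})) \<Rightarrow> 'n clif)
    \<Rightarrow> (real \<times> (real ^ ('n::{finite,linorder})) \<Rightarrow> 'n clif)" where
  "dualRadon f = (\<lambda>(x0, x). sphere_avg (\<lambda>w. f (x0, x \<bullet> w, w)))"

end

theory Submission
  imports Defs
begin

text \<open>
  A monogenic function is merely assumed differentiable. A Goursat argument, run on averages against a
  refinable spline (a kernel that is a convex combination of its own half-size translates), shows that
  these averages solve the Cauchy-Riemann system classically; the conjugate system factorises the
  Laplacian, so monogenic functions satisfy a mean value formula, hence Cauchy estimates on every ball.
  Thus a function in \<open>M\<^sub>0\<close> is determined by its restriction to \<open>x\<^sub>0 = 0\<close>, which is a sum of homogeneous
  polynomials \<open>P\<^sub>k\<close> with faster than exponential decay.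

  On restrictions to \<open>x\<^sub>0 = 0\<close> the dual Radon transform of \<open>\<Sum>\<^sub>k (p - \<omega> x\<^sub>0)^k P\<^sub>k(\<omega>)\<close> acts degree by degree as
  \<open>P\<^sub>k \<mapsto> avg (x \<bullet> \<omega>)^k P\<^sub>k(\<omega>)\<close>. On symmetric tensors this operator \<open>T\<^sub>k\<close> satisfies
  \<open>\<langle>T\<^sub>k a, a\<rangle> = avg |P\<^sub>a|\<^sup>2\<close>, which is at least \<open>C^(-k) |a|\<^sup>2\<close> by polarisation and a crude estimate of
  \<open>|P\<^sub>a|\<close> near its maximum on the sphere. So \<open>T\<^sub>k\<close> is invertible with exponentially bounded inverse and the
  series for the preimage converges again. That the preimage lies in \<open>SM\<^sub>0\<close> follows by inverting twice:
  its restriction to \<open>x\<^sub>0 = 0\<close> is that of the transform of another element of \<open>S\<^sub>0\<close>.\<close>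

section \<open>Clifford multiplication\<close>

text \<open>Convergence is the obstacle that shapes the proof. On degree \<open>k\<close> the
  inverse of the averaging operator costs a factor \<open>C^k\<close>; this is affordable because
  Cauchy estimates on balls of every radius make the coefficients of an entire monogenic function
  decay faster than any geometric sequence. So each estimate on tensors may lose an exponential
  factor, and neither spherical harmonics nor explicit eigenvalues enter.

  The lower bound is paired with the upper bound \<open>|T a|^2 \<le> <T a, a>\<close>: together
  they make \<open>1 - T\<close> a strict contraction on symmetric tensors, and the inverse is a
  Neumann series there.

  The equation on R^(n+1) and the equation on each plane with \<omega> fixed obey the same relation
  between an operator and its conjugate, so the analysis is done once, for constant coefficient
  systems with that relation. Averages against compactly supported kernels take the place of
  boundary integrals, and integration by parts becomes uniqueness of the derivative of such an
  average.\<close>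

definition geq_sign :: "'n::linorder \<Rightarrow> 'n \<Rightarrow> real" where
  "geq_sign i j = (if j \<le> i then -1 else 1)"

lemma geq_sign_sq [simp]: "geq_sign i j * geq_sign i j = 1" "geq_sign i j * (geq_sign i j * x) = x"
  by (auto simp: geq_sign_def)

text \<open>An inversion \<open>j < i\<close> and a repeated index \<open>j = i\<close> contribute
  one factor -1 each, and together they are the pairs with \<open>j \<le> i\<close>. In product form
  the sign is multiplicative in both arguments with respect to symmetric difference, which is what
  associativity rests on.\<close>

lemma clsign_eq_prod:
  fixes A B :: "'n::{finite,linorder} set"
  shows "clsign A B = (\<Prod>i\<in>A. \<Prod>j\<in>B. geq_sign i j)"
proof -
  have "{(i, j). i \<in> A \<and> j \<in> B \<and> j < i} \<union> (\<lambda>i. (i,i)) ` (A \<inter> B) = {x\<in>A \<times> B. snd x \<le> fst x}"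
    by (auto simp: order_le_less)
  moreover have "card ({(i, j). i \<in> A \<and> j \<in> B \<and> j < i} \<union> (\<lambda>i. (i,i)) ` (A \<inter> B))
     = card {(i, j). i \<in> A \<and> j \<in> B \<and> j < i} + card (A \<inter> B)"
    by (subst card_Un_disjoint) (auto simp: card_image inj_on_def)
  ultimately have "clsign A B = (-1) ^ card {x\<in>A \<times> B. snd x \<le> fst x}"
    by (simp add: clsign_def)
  also have "\<dots> = (\<Prod>x\<in>A \<times> B. geq_sign (fst x) (snd x))"
    unfolding geq_sign_def by (subst prod.If_cases) (auto simp: Int_def)
  finally show ?thesis
    by (simp add: prod.cartesian_product case_prod_beta)
qed

text \<open>Indices in \<open>A \<inter> B\<close> occur twice on the right and cancel, since each
  factor squares to 1.\<close>

lemma prod_symdiff_sign: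
  fixes f :: "'n::finite \<Rightarrow> real"
  assumes "\<And>i. f i * f i = 1"
  shows "(\<Prod>i\<in>A - B \<union> (B - A). f i) = (\<Prod>i\<in>A. f i) * (\<Prod>i\<in>B. f i)"
proof -
  have "(\<Prod>i\<in>A. f i) = (\<Prod>i\<in>A - B. f i) * (\<Prod>i\<in>A \<inter> B. f i)"
    by (subst prod.union_disjoint[symmetric]) (auto intro!: prod.cong)
  moreover have "(\<Prod>i\<in>B. f i) = (\<Prod>i\<in>B - A. f i) * (\<Prod>i\<in>A \<inter> B. f i)"
    by (subst prod.union_disjoint[symmetric]) (auto intro!: prod.cong)
  moreover have "(\<Prod>i\<in>A \<inter> B. f i) * (\<Prod>i\<in>A \<inter> B. f i) = 1"
    by (simp add: prod.distrib[symmetric] assms)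
  moreover have "(\<Prod>i\<in>A - B \<union> (B - A). f i) = (\<Prod>i\<in>A - B. f i) * (\<Prod>i\<in>B - A. f i)"
    by (subst prod.union_disjoint) auto
  ultimately show ?thesis by (simp add: mult.assoc mult.left_commute)
qed

lemma clsign_symdiff_left:
  "clsign (A - B \<union> (B - A)) C = clsign A C * clsign B C"
  unfolding clsign_eq_prod by (rule prod_symdiff_sign) (simp add: prod.distrib[symmetric])

lemma clsign_symdiff_right:
  "clsign C (A - B \<union> (B - A)) = clsign C A * clsign C B"
  unfolding clsign_eq_prod prod.distrib[symmetric]
  by (intro prod.cong prod_symdiff_sign refl) simp

abbreviation blade :: "'n::{finite,linorder} set \<Rightarrow> 'n clif" where "blade A \<equiv> axis A 1"

lemma bounded_bilinear_clmul: "bounded_bilinear (clmul :: 'n::{finite,linorder} clif \<Rightarrow> _)"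
proof -
  have "(a + b) \<odot> c = a \<odot> c + b \<odot> c" "c \<odot> (a + b) = c \<odot> a + c \<odot> b" for a b c :: "'n clif"
    unfolding vec_eq_iff clmul_def vector_add_component vec_lambda_beta sum.distrib[symmetric]
    by (intro allI sum.cong refl; simp add: algebra_simps)+
  moreover have "(r *\<^sub>R a) \<odot> c = r *\<^sub>R (a \<odot> c)" "c \<odot> (r *\<^sub>R a) = r *\<^sub>R (c \<odot> a)" for r and a c :: "'n clif"
    unfolding vec_eq_iff clmul_def vector_scaleR_component vec_lambda_beta sum_distrib_left real_scaleR_def
    by (intro allI sum.cong refl; simp add: algebra_simps)+
  ultimately have "bilinear (clmul :: 'n clif \<Rightarrow> 'n clif \<Rightarrow> 'n clif)"
    unfolding bilinear_def by (intro conjI allI linearI)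
  then show ?thesis by (simp add: bilinear_conv_bounded_bilinear)
qed

interpretation clmul: bounded_bilinear "clmul :: 'n::{finite,linorder} clif \<Rightarrow> 'n clif \<Rightarrow> 'n clif"
  by (rule bounded_bilinear_clmul)

lemma clmul_blade: "blade A \<odot> blade B = clsign A B *\<^sub>R blade (A - B \<union> (B - A))"
proof -
  have "(\<Sum>A'\<in>UNIV. \<Sum>B'\<in>UNIV. if A' - B' \<union> (B' - A') = C
          then clsign A' B' * blade A $ A' * blade B $ B' else 0)
      = (\<Sum>A'\<in>UNIV. \<Sum>B'\<in>UNIV. if B' = B then if A' = A then
          (if A - B \<union> (B - A) = C then clsign A B else 0) else 0 else 0)" for C
    by (intro sum.cong refl) (simp add: axis_def)
  then have "(blade A \<odot> blade B) $ C = (if A - B \<union> (B - A) = C then clsign A B else 0)" for C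
    by (simp add: clmul_def)
  moreover have "(clsign A B *\<^sub>R blade (A - B \<union> (B - A))) $ C
      = (if A - B \<union> (B - A) = C then clsign A B else 0)" for C
    by (simp add: axis_def)
  ultimately show ?thesis by (simp add: vec_eq_iff)
qed

lemma clif_blade_sum: "(a :: 'n::{finite,linorder} clif) = (\<Sum>A\<in>UNIV. (a $ A) *\<^sub>R blade A)"
  by (simp add: vec_eq_iff axis_def if_distrib[of "(*) _"] cong: if_cong)

text \<open>Both bracketings carry the sign \<open>clsign A B * clsign A C * clsign B C\<close>,
  because the sign is multiplicative in each argument.\<close>

lemma clmul_blade_assoc: "(blade A \<odot> blade B) \<odot> blade C = blade A \<odot> (blade B \<odot> blade C)"
proof -
  have "(A - B \<union> (B - A)) - C \<union> (C - (A - B \<union> (B - A))) = A - (B - C \<union> (C - B)) \<union> ((B - C \<union> (C - B)) - A)"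
    by blast
  then show ?thesis
    by (simp add: clmul_blade clmul.scaleR_left clmul.scaleR_right clsign_symdiff_left clsign_symdiff_right)
qed

lemma clmul_assoc: "(a \<odot> b) \<odot> c = a \<odot> (b \<odot> (c :: 'n::{finite,linorder} clif))"
proof -
  have "((\<Sum>A\<in>UNIV. f A *\<^sub>R blade A) \<odot> (\<Sum>A\<in>UNIV. g A *\<^sub>R blade A)) \<odot> (\<Sum>A\<in>UNIV. h A *\<^sub>R blade A)
    = (\<Sum>A\<in>UNIV. f A *\<^sub>R blade A) \<odot> ((\<Sum>A\<in>UNIV. g A *\<^sub>R blade A) \<odot> (\<Sum>A\<in>UNIV. h A *\<^sub>R blade A))"
    for f g h :: "'n set \<Rightarrow> real"
    by (simp only: clmul.sum_left clmul.sum_right clmul.scaleR_left clmul.scaleR_right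
      clmul_blade_assoc scaleR_sum_right)
  from this[of "($) a" "($) b" "($) c"] show ?thesis
    by (simp only: clif_blade_sum[symmetric])
qed

lemma gen_eq_blade: "gen j = blade {j}"
  by (simp add: gen_def axis_def vec_eq_iff)

lemma clmul_one_left: "blade {} \<odot> a = (a :: 'n::{finite,linorder} clif)"
proof -
  have "blade {} \<odot> (\<Sum>A\<in>UNIV. (a $ A) *\<^sub>R blade A) = (\<Sum>A\<in>UNIV. (a $ A) *\<^sub>R blade A)"
    by (simp add: clmul.sum_right clmul.scaleR_right clmul_blade clsign_def)
  then show ?thesis by (simp only: clif_blade_sum[symmetric])
qed

lemma gen_mult_gen: "gen i \<odot> gen j + gen j \<odot> gen i = (if i = j then - 2 else 0) *\<^sub>R blade ({} :: 'n::{finite,linorder} set)"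
proof -
  have *: "{i} - {j} \<union> ({j} - {i}) = {j} - {i} \<union> ({i} - {j})" by blast
  have "gen i \<odot> gen j + gen j \<odot> gen i = (geq_sign i j + geq_sign j i) *\<^sub>R blade ({j} - {i} \<union> ({i} - {j}))"
    by (simp only: gen_eq_blade clmul_blade clsign_eq_prod * scaleR_add_left) simp
  then show ?thesis by (cases i j rule: linorder_cases) (auto simp: geq_sign_def)
qed

lemma gen_anticommute:
  "gen i \<odot> (gen j \<odot> a) + gen j \<odot> (gen i \<odot> a) = (if i = j then - 2 *\<^sub>R a else (0 :: 'n::{finite,linorder} clif))"
  using arg_cong[OF gen_mult_gen[of i j], of "\<lambda>u. u \<odot> a"]
  by (simp add: clmul_assoc clmul.add_left clmul.scaleR_left clmul_one_left)

lemma vec_cl_clmul: "vec_cl x \<odot> a = (\<Sum>j\<in>UNIV. (x $ j) *\<^sub>R (gen j \<odot> a))"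
  by (simp add: vec_cl_def clmul.sum_left clmul.scaleR_left)

text \<open>Added to its own transpose, the double sum loses all off-diagonal terms. This identity
  is what makes the Cauchy-Riemann operator a factor of the Laplacian.\<close>

lemma vec_cl_twice: "vec_cl x \<odot> (vec_cl x \<odot> a) = - ((norm x)\<^sup>2 *\<^sub>R (a :: 'n::{finite,linorder} clif))"
proof -
  let ?f = "\<lambda>i j. (x $ i * x $ j) *\<^sub>R (gen i \<odot> (gen j \<odot> a))"
  have 1: "vec_cl x \<odot> (vec_cl x \<odot> a) = (\<Sum>i\<in>UNIV. \<Sum>j\<in>UNIV. ?f i j)"
    by (subst sum.swap) (simp only: vec_cl_clmul clmul.sum_right clmul.scaleR_right scaleR_sum_right
        scaleR_scaleR mult.commute)
  also have "\<dots> = (\<Sum>i\<in>UNIV. \<Sum>j\<in>UNIV. (x $ i * x $ j) *\<^sub>R (gen j \<odot> (gen i \<odot> a)))"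
    by (subst sum.swap) (simp only: mult.commute)
  finally have "vec_cl x \<odot> (vec_cl x \<odot> a) + vec_cl x \<odot> (vec_cl x \<odot> a)
      = (\<Sum>i\<in>UNIV. \<Sum>j\<in>UNIV. (x $ i * x $ j) *\<^sub>R (if i = j then - 2 *\<^sub>R a else 0))"
    by (subst 1) (simp only: gen_anticommute[symmetric] scaleR_add_right sum.distrib)
  also have "\<dots> = (\<Sum>i\<in>UNIV. (x $ i)\<^sup>2 *\<^sub>R (- 2 *\<^sub>R a))"
    by (simp add: if_distrib[of "(*\<^sub>R) _"] power2_eq_square cong: if_cong)
  also have "\<dots> = (\<Sum>i\<in>UNIV. (x $ i)\<^sup>2) *\<^sub>R (- 2 *\<^sub>R a)"
    by (rule scaleR_sum_left[symmetric])
  also have "(\<Sum>i\<in>UNIV. (x $ i)\<^sup>2) = (norm x)\<^sup>2"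
    unfolding power2_norm_eq_inner by (simp add: inner_vec_def power2_eq_square)
  finally have "2 *\<^sub>R (vec_cl x \<odot> (vec_cl x \<odot> a)) = 2 *\<^sub>R (- ((norm x)\<^sup>2 *\<^sub>R a))"
    by (simp only: scaleR_2[symmetric]) (simp only: scaleR_scaleR scaleR_minus_left scaleR_minus_right mult.commute mult_minus_left mult_minus_right)
  then show ?thesis by (simp only: scaleR_cancel_left) simp
qed

lemma vec_cl_uminus [simp]: "vec_cl (- x) = - vec_cl x"
  by (simp add: vec_cl_def sum_negf)

section \<open>Kernel averages\<close>

lemma integrable_compact_image:
  fixes g :: "'y::euclidean_space \<Rightarrow> 'b::euclidean_space"
  assumes "finite_measure M" and u: "u \<in> borel_measurable M" and uK: "\<And>y. y \<in> space M \<Longrightarrow> u y \<in> K"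
    and K: "compact K" and g: "continuous_on K g"
  shows "integrable M (\<lambda>y. g (u y))"
proof -
  interpret finite_measure M by fact
  have "(\<lambda>x. indicator K x *\<^sub>R g x) \<in> borel_measurable borel"
    using K g by (intro borel_measurable_continuous_on_indicator borel_compact)
  from measurable_compose[OF u this]
  have "(\<lambda>y. indicator K (u y) *\<^sub>R g (u y)) \<in> borel_measurable M" .
  then have m: "(\<lambda>y. g (u y)) \<in> borel_measurable M"
    by (rule measurable_cong[THEN iffD1, rotated]) (simp add: uK)
  have "bounded (g ` K)" using K g by (simp add: compact_continuous_image compact_imp_bounded)
  then obtain B where "\<And>y. y \<in> K \<Longrightarrow> norm (g y) \<le> B" by (auto simp: bounded_iff)
  then show ?thesis using m uK by (intro integrable_const_bound[of _ B]) auto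
qed

text \<open>The derivative is uniformly continuous on a compact set, so the error of linearisation
  in \<open>z\<close> is small uniformly in \<open>y\<close>. The map \<open>u\<close> lets one
  proof serve two situations: the identity on a compact support in Lebesgue measure, and the radial
  projection onto the sphere.\<close>

lemma has_derivative_integral_compact:
  fixes \<phi> :: "'z::euclidean_space \<Rightarrow> 'y::euclidean_space \<Rightarrow> 'b::euclidean_space"
  assumes M: "finite_measure M" and u: "u \<in> borel_measurable M" and uK: "\<And>y. y \<in> space M \<Longrightarrow> u y \<in> K"
    and K: "compact K"
    and cont: "continuous_on (cball z0 1 \<times> K) (\<lambda>(z, y). \<phi> z y)"
    and der: "\<And>z y. z \<in> cball z0 1 \<Longrightarrow> y \<in> K \<Longrightarrow> ((\<lambda>z. \<phi> z y) has_derivative \<phi>' z y) (at z)"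
    and contd: "\<And>v. continuous_on (cball z0 1 \<times> K) (\<lambda>(z, y). \<phi>' z y v)"
  shows "((\<lambda>z. \<integral>y. \<phi> z (u y) \<partial>M) has_derivative (\<lambda>v. \<integral>y. \<phi>' z0 (u y) v \<partial>M)) (at z0)"
proof -
  interpret finite_measure M by (rule M)
  have bint: "integrable M (\<lambda>y. g (u y))" if "continuous_on K g" for g :: "'y \<Rightarrow> 'b"
    by (rule integrable_compact_image[OF M u uK K that])
  have z0: "z0 \<in> cball z0 1" by simp
  have slice: "continuous_on K (g z)" if "continuous_on (cball z0 1 \<times> K) (\<lambda>(z, y). g z y)" "z \<in> cball z0 1"
    for g :: "'z \<Rightarrow> 'y \<Rightarrow> 'b" and z
    using continuous_on_compose2[OF that(1), of K "\<lambda>y. (z, y)"] that(2)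
    by (force intro: continuous_intros)
  note i\<phi> = bint[OF slice[OF cont]] and i\<phi>' = bint[OF slice[OF contd z0]]
  have lin: "linear (\<phi>' z y)" if "z \<in> cball z0 1" "y \<in> K" for z y
    using der[OF that] has_derivative_linear by blast
  have lin0: "linear (\<lambda>v. \<integral>y. \<phi>' z0 (u y) v \<partial>M)"
  proof (rule linearI)
    have *: "\<phi>' z0 (u y) (a + b) = \<phi>' z0 (u y) a + \<phi>' z0 (u y) b" "\<phi>' z0 (u y) (r *\<^sub>R a) = r *\<^sub>R \<phi>' z0 (u y) a"
      if "y \<in> space M" for y a b r
      using lin[OF z0 uK[OF that]] by (auto simp: linear_add linear_cmul)
    fix a b r
    show "(\<integral>y. \<phi>' z0 (u y) (a + b) \<partial>M) = (\<integral>y. \<phi>' z0 (u y) a \<partial>M) + (\<integral>y. \<phi>' z0 (u y) b \<partial>M)"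
      by (simp add: Bochner_Integration.integral_add[OF i\<phi>' i\<phi>', symmetric] * cong: Bochner_Integration.integral_cong)
    show "(\<integral>y. \<phi>' z0 (u y) (r *\<^sub>R a) \<partial>M) = r *\<^sub>R (\<integral>y. \<phi>' z0 (u y) a \<partial>M)"
      by (simp add: * cong: Bochner_Integration.integral_cong)
  qed
  show ?thesis
    unfolding has_derivative_at_alt
  proof (intro conjI allI impI)
    show "bounded_linear (\<lambda>v. \<integral>y. \<phi>' z0 (u y) v \<partial>M)" using lin0 by (simp add: linear_conv_bounded_linear)
    fix e :: real assume e: "0 < e"
    \<comment> \<open>The added 1 keeps \<open>m\<close> positive for a null measure.\<close>
    define m where "m = measure M (space M) + 1"
    have m: "m > 0" by (auto simp: m_def intro!: add_nonneg_pos)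
    define N where "N = real DIM('z)"
    have N: "N > 0" by (simp add: N_def)
    have "\<exists>d>0. \<forall>z\<in>cball z0 1. \<forall>y\<in>K. dist z z0 < d \<longrightarrow> norm (\<phi>' z y b - \<phi>' z0 y b) < e / (m * N)" for b
    proof -
      have "uniformly_continuous_on (cball z0 1 \<times> K) (\<lambda>(z, y). \<phi>' z y b)"
        using contd K by (intro compact_uniformly_continuous compact_Times) auto
      then obtain d where "d > 0" and d: "\<And>x x'. x\<in>cball z0 1 \<times> K \<Longrightarrow> x'\<in>cball z0 1 \<times> K \<Longrightarrow> dist x' x < d \<Longrightarrow>
        dist ((\<lambda>(z, y). \<phi>' z y b) x') ((\<lambda>(z, y). \<phi>' z y b) x) < e / (m * N)"
        unfolding uniformly_continuous_on_def using e m N by (metis divide_pos_pos mult_pos_pos)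
      show ?thesis
      proof (intro exI conjI ballI impI)
        fix z y assume "z \<in> cball z0 1" "y \<in> K" "dist z z0 < d"
        then show "norm (\<phi>' z y b - \<phi>' z0 y b) < e / (m * N)"
          using d[of "(z0, y)" "(z, y)"] by (auto simp: dist_Pair_Pair dist_norm)
      qed fact
    qed
    then obtain d where dpos: "\<And>b. d b > 0" and
      d: "\<And>b z y. z\<in>cball z0 1 \<Longrightarrow> y\<in>K \<Longrightarrow> dist z z0 < d b \<Longrightarrow> norm (\<phi>' z y b - \<phi>' z0 y b) < e / (m * N)"
      by metis
    define \<delta> where "\<delta> = min 1 (Min (d ` Basis))"
    have \<delta>: "\<delta> > 0" "\<delta> \<le> 1" and \<delta>d: "\<And>b. b \<in> Basis \<Longrightarrow> \<delta> \<le> d b"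
      using dpos by (auto simp: \<delta>_def min.coboundedI2)
    \<comment> \<open>Continuity of the derivative is given direction by direction; expanding
      \<open>v\<close> in the basis turns it into a bound for the operator norm, \<open>e\<close>
      having been divided by the dimension beforehand.\<close>
    have on: "norm (\<phi>' z y v - \<phi>' z0 y v) \<le> (e / m) * norm v" if z: "z \<in> ball z0 \<delta>" and y: "y \<in> K" for z y v
    proof -
      have z1: "z \<in> cball z0 1" using z \<delta> by auto
      have l: "linear (\<lambda>v. \<phi>' z y v - \<phi>' z0 y v)"
        using lin[OF z1 y] lin[OF z0 y] by (simp add: linear_compose_sub)
      have "\<phi>' z y v - \<phi>' z0 y v = (\<Sum>b\<in>Basis. (v \<bullet> b) *\<^sub>R (\<phi>' z y b - \<phi>' z0 y b))"
        by (simp only: linear_sum[OF l, symmetric] linear_cmul[OF l, symmetric] euclidean_representation)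
      also have "norm \<dots> \<le> (\<Sum>b\<in>(Basis::'z set). norm v * (e / (m * N)))"
      proof (rule sum_norm_le)
        fix b :: 'z assume b: "b \<in> Basis"
        have "dist z z0 < d b" using z \<delta>d[OF b] by (simp add: dist_commute)
        then have "norm (\<phi>' z y b - \<phi>' z0 y b) \<le> e / (m * N)" using d[OF z1 y] less_imp_le by blast
        then show "norm ((v \<bullet> b) *\<^sub>R (\<phi>' z y b - \<phi>' z0 y b)) \<le> norm v * (e / (m * N))"
          unfolding norm_scaleR real_norm_def using Basis_le_norm[OF b, of v] by (intro mult_mono) auto
      qed
      also have "\<dots> = (e / m) * norm v" using N by (simp add: N_def field_simps)
      finally show ?thesis .
    qed
    show "\<exists>d>0. \<forall>z. norm (z - z0) < d \<longrightarrow>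
        norm ((\<integral>y. \<phi> z (u y) \<partial>M) - (\<integral>y. \<phi> z0 (u y) \<partial>M) - (\<integral>y. \<phi>' z0 (u y) (z - z0) \<partial>M)) \<le> e * norm (z - z0)"
    proof (intro exI conjI allI impI)
      fix z assume "norm (z - z0) < \<delta>"
      then have z: "z \<in> ball z0 \<delta>" and z1: "z \<in> cball z0 1" using \<delta> by (auto simp: dist_norm norm_minus_commute)
      have pt: "norm (\<phi> z y - \<phi> z0 y - \<phi>' z0 y (z - z0)) \<le> norm (z - z0) * (e / m)" if y: "y \<in> K" for y
      proof (rule differentiable_bound_linearization[where S="ball z0 \<delta>"])
        fix t :: real assume "t \<in> {0..1}"
        then show "z0 + t *\<^sub>R (z - z0) \<in> ball z0 \<delta>"
          using convexD_alt[OF convex_ball, of z0 z0 \<delta> z t] z \<delta> by (simp add: algebra_simps)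
      next
        fix x assume x: "x \<in> ball z0 \<delta>"
        then have x1: "x \<in> cball z0 1" using \<delta> by auto
        show "((\<lambda>z. \<phi> z y) has_derivative \<phi>' x y) (at x within ball z0 \<delta>)"
          using der[OF x1 y] by (rule has_derivative_at_withinI)
        show "onorm (\<phi>' x y - \<phi>' z0 y) \<le> e / m"
          using on[OF x y] e m by (intro onorm_bound) (auto simp: mult.commute)
      qed (use \<delta> in auto)
      have "(\<integral>y. \<phi> z (u y) \<partial>M) - (\<integral>y. \<phi> z0 (u y) \<partial>M) - (\<integral>y. \<phi>' z0 (u y) (z - z0) \<partial>M)
          = (\<integral>y. \<phi> z (u y) - \<phi> z0 (u y) - \<phi>' z0 (u y) (z - z0) \<partial>M)"
        using i\<phi>[OF z1] i\<phi>[OF z0] i\<phi>' by simp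
      also have "norm \<dots> \<le> (\<integral>y. norm (\<phi> z (u y) - \<phi> z0 (u y) - \<phi>' z0 (u y) (z - z0)) \<partial>M)"
        by (rule integral_norm_bound)
      also have "\<dots> \<le> (\<integral>y. norm (z - z0) * (e / m) \<partial>M)"
        by (intro integral_mono integrable_norm Bochner_Integration.integrable_diff i\<phi> z1 z0 i\<phi>' pt uK) auto
      also have "\<dots> = measure M (space M) * (norm (z - z0) * (e / m))" by simp
      also have "\<dots> \<le> m * (norm (z - z0) * (e / m))"
        using e m by (intro mult_right_mono) (auto simp: m_def)
      also have "\<dots> = e * norm (z - z0)" using m by simp
      finally show "norm ((\<integral>y. \<phi> z (u y) \<partial>M) - (\<integral>y. \<phi> z0 (u y) \<partial>M) - (\<integral>y. \<phi>' z0 (u y) (z - z0) \<partial>M)) \<le> e * norm (z - z0)" .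
    qed fact
  qed
qed


text \<open>Evaluating at \<open>x + y\<close> makes this a weighted average of \<open>F\<close>
  around \<open>x\<close>, a correlation rather than a convolution; derivatives that fall on the
  kernel therefore come with a minus sign.\<close>

definition conv :: "('a::euclidean_space \<Rightarrow> real) \<Rightarrow> ('a \<Rightarrow> 'b::euclidean_space) \<Rightarrow> 'a \<Rightarrow> 'b" where
  "conv k F x = (\<integral>y. k y *\<^sub>R F (x + y) \<partial>lborel)"

lemma integral_lborel_translate:
  fixes f :: "'a::euclidean_space \<Rightarrow> 'b::euclidean_space"
  assumes "f \<in> borel_measurable borel"
  shows "(\<integral>y. f (t + y) \<partial>lborel) = (\<integral>y. f y \<partial>lborel)"
proof -
  have "(\<integral>y. f (t + y) \<partial>lborel) = (\<integral>y. f y \<partial>distr lborel borel ((+) t))"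
    using assms by (subst integral_distr) auto
  then show ?thesis by (simp add: lborel_distr_plus)
qed

lemma integral_restrict_support:
  fixes f :: "'a::euclidean_space \<Rightarrow> 'b::euclidean_space"
  assumes "compact K" "\<And>y. y \<notin> K \<Longrightarrow> f y = 0"
  shows "(\<integral>y. f y \<partial>lborel) = (\<integral>y. f y \<partial>restrict_space lborel K)"
  using assms by (subst integral_restrict_space)
    (auto simp: compact_imp_closed indicator_def intro!: Bochner_Integration.integral_cong)

lemma finite_measure_restrict_compact:
  "compact K \<Longrightarrow> finite_measure (restrict_space lborel (K :: 'a::euclidean_space set))"
  by (intro finite_measureI)
    (auto simp: emeasure_restrict_space compact_imp_closed space_restrict_space emeasure_compact_finite less_top[symmetric] dest: emeasure_compact_finite)

text \<open>The set \<open>K\<close> has to contain the supports for parameters near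
  \<open>z0\<close> only, so kernels whose support moves with the parameter are covered.\<close>

lemma has_derivative_integral_lborel:
  fixes \<phi> :: "'z::euclidean_space \<Rightarrow> 'y::euclidean_space \<Rightarrow> 'b::euclidean_space"
  assumes K: "compact K"
    and cont: "continuous_on (cball z0 1 \<times> K) (\<lambda>p. \<phi> (fst p) (snd p))"
    and der: "\<And>z y. ((\<lambda>z. \<phi> z y) has_derivative \<phi>' z y) (at z)"
    and contd: "\<And>v. continuous_on (cball z0 1 \<times> K) (\<lambda>p. \<phi>' (fst p) (snd p) v)"
    and zero: "\<And>z y. z \<in> ball z0 1 \<Longrightarrow> y \<notin> K \<Longrightarrow> \<phi> z y = 0"
  shows "((\<lambda>z. \<integral>y. \<phi> z y \<partial>lborel) has_derivative (\<lambda>v. \<integral>y. \<phi>' z0 y v \<partial>lborel)) (at z0)"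
proof -
  have "((\<lambda>z. \<integral>y. \<phi> z (id y) \<partial>restrict_space lborel K) has_derivative
      (\<lambda>v. \<integral>y. \<phi>' z0 (id y) v \<partial>restrict_space lborel K)) (at z0)"
  proof (rule has_derivative_integral_compact[where K=K, OF finite_measure_restrict_compact[OF K]])
    show "id \<in> borel_measurable (restrict_space lborel K)" by (rule measurable_restrict_space1) simp
    show "id y \<in> K" if "y \<in> space (restrict_space lborel K)" for y
      using that by (simp add: space_restrict_space)
    show "continuous_on (cball z0 1 \<times> K) (\<lambda>(z, y). \<phi> z y)" using cont by (simp only: case_prod_unfold)
    show "continuous_on (cball z0 1 \<times> K) (\<lambda>(z, y). \<phi>' z y v)" for v using contd by (simp only: case_prod_unfold)
  qed (rule K der)+
  note D = this
  \<comment> \<open>Off \<open>K\<close> the integrand vanishes for all parameters near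
    \<open>z0\<close>, hence so does its derivative at \<open>z0\<close>.\<close>
  have "\<phi>' z0 y v = 0" if y: "y \<notin> K" for y v
  proof -
    have "((\<lambda>z. 0) has_derivative \<phi>' z0 y) (at z0)"
      by (rule has_derivative_transform_within_open[OF der[of y z0] open_ball[of z0 1]]) (simp_all add: zero y)
    then have "\<phi>' z0 y = (\<lambda>_. 0)" using has_derivative_unique has_derivative_const by blast
    then show ?thesis by simp
  qed
  then have R': "(\<integral>y. \<phi>' z0 y v \<partial>restrict_space lborel K) = (\<integral>y. \<phi>' z0 y v \<partial>lborel)" for v
    by (intro integral_restrict_support[symmetric] K)
  have R: "(\<integral>y. \<phi> z y \<partial>restrict_space lborel K) = (\<integral>y. \<phi> z y \<partial>lborel)" if "z \<in> ball z0 1" for z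
    using zero that by (intro integral_restrict_support[symmetric] K)
  have "((\<lambda>z. \<integral>y. \<phi> z y \<partial>restrict_space lborel K) has_derivative (\<lambda>v. \<integral>y. \<phi>' z0 y v \<partial>lborel)) (at z0)"
    using D by (simp only: id_apply R')
  then show ?thesis
    by (rule has_derivative_transform_within_open[OF _ open_ball[of z0 1]]) (simp, rule R)
qed

lemma integrable_compact_support:
  fixes f :: "'a::euclidean_space \<Rightarrow> 'b::euclidean_space"
  assumes "compact K" "continuous_on K f" "\<And>y. y \<notin> K \<Longrightarrow> f y = 0"
  shows "integrable lborel f"
proof -
  have "(\<lambda>y. indicator K y *\<^sub>R f y) = f" using assms(3) by (auto simp: indicator_def)
  then show ?thesis using borel_integrable_compact[OF assms(1,2)] by simp
qed

lemma integrable_kernel: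
  fixes F :: "'a::euclidean_space \<Rightarrow> 'b::euclidean_space"
  assumes "continuous_on UNIV k" "\<And>y. \<rho> < norm y \<Longrightarrow> k y = 0" "continuous_on UNIV F"
  shows "integrable lborel (\<lambda>y. k y *\<^sub>R F y)"
proof (rule integrable_compact_support[of "cball 0 \<rho>"])
  show "continuous_on (cball 0 \<rho>) (\<lambda>y. k y *\<^sub>R F y)"
    using assms by (auto intro!: continuous_intros intro: continuous_on_subset)
qed (use assms in auto)

lemma integrable_conv:
  fixes F :: "'a::euclidean_space \<Rightarrow> 'b::euclidean_space"
  assumes "continuous_on UNIV k" "\<And>y. \<rho> < norm y \<Longrightarrow> k y = 0" "continuous_on UNIV F"
  shows "integrable lborel (\<lambda>y. k y *\<^sub>R F (x + y))"
  by (rule integrable_kernel[OF assms(1,2)])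
    (auto intro!: continuous_on_compose2[OF assms(3)] continuous_intros)

lemma conv_translate:
  fixes F :: "'a::euclidean_space \<Rightarrow> 'b::euclidean_space"
  assumes "continuous_on UNIV k" "continuous_on UNIV F"
  shows "conv (\<lambda>y. k (y - t)) F x = conv k F (x + t)"
proof -
  have "(\<lambda>y. k (y - t) *\<^sub>R F (x + y)) \<in> borel_measurable borel"
    using assms by (intro borel_measurable_continuous_onI)
      (auto intro!: continuous_intros intro: continuous_on_compose2)
  from integral_lborel_translate[OF this, of t] show ?thesis by (simp add: conv_def add.assoc)
qed

lemma conv_eq:
  fixes F :: "'a::euclidean_space \<Rightarrow> 'b::euclidean_space"
  assumes "continuous_on UNIV k" "continuous_on UNIV F"
  shows "conv k F x = (\<integral>z. k (z - x) *\<^sub>R F z \<partial>lborel)"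
  using conv_translate[OF assms, of x 0] by (simp add: conv_def)

lemma conv_has_derivative_right:
  fixes F :: "'a::euclidean_space \<Rightarrow> 'b::euclidean_space"
  assumes k: "continuous_on UNIV k" "\<And>y. \<rho> < norm y \<Longrightarrow> k y = 0"
    and F: "\<And>x. (F has_derivative F' x) (at x)" and F': "\<And>v. continuous_on UNIV (\<lambda>x. F' x v)"
  shows "(conv k F has_derivative (\<lambda>v. conv k (\<lambda>x. F' x v) x)) (at x)"
proof -
  have cF: "continuous_on UNIV F" using F by (intro has_derivative_continuous_on)
  show ?thesis
    unfolding conv_def
  proof (rule has_derivative_integral_lborel[of "cball 0 \<rho>"])
    fix z y
    have "((\<lambda>z. F (z + y)) has_derivative F' (z + y)) (at z)"
      by (rule has_derivative_compose[OF _ F]) (auto intro!: derivative_eq_intros)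
    then show "((\<lambda>z. k y *\<^sub>R F (z + y)) has_derivative (\<lambda>v. k y *\<^sub>R F' (z + y) v)) (at z)"
      by (rule has_derivative_scaleR_right)
  qed (use k(2) in \<open>auto intro!: continuous_on_scaleR continuous_on_compose2[OF cF _ subset_UNIV]
      continuous_on_compose2[OF k(1) _ subset_UNIV] continuous_on_compose2[OF F' _ subset_UNIV]
      continuous_on_add continuous_on_fst continuous_on_snd continuous_on_id\<close>)
qed

lemma derivative_zero_outside:
  assumes "\<And>y::'a::real_normed_vector. \<rho> < norm y \<Longrightarrow> k y = 0" "(k has_derivative k') (at y)" "\<rho> < norm y"
  shows "k' v = (0 :: 'b::real_normed_vector)"
proof -
  have "open {y::'a. \<rho> < norm y}" by (intro open_Collect_less continuous_intros)
  then have "((\<lambda>y. 0) has_derivative k') (at y)"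
    using has_derivative_transform_within_open[OF assms(2), of "{y. \<rho> < norm y}" "\<lambda>y. 0"] assms by auto
  then have "k' = (\<lambda>_. 0)" using has_derivative_unique has_derivative_const by blast
  then show ?thesis by simp
qed

text \<open>Once the average is rewritten with \<open>k (z - x)\<close>, the parameter sits in the
  kernel alone, so continuity of \<open>F\<close> suffices. Comparison with
  \<open>conv_has_derivative_right\<close>, by uniqueness of the derivative, is the form in which
  integration by parts is used below.\<close>

lemma conv_has_derivative_left:
  fixes F :: "'a::euclidean_space \<Rightarrow> 'b::euclidean_space"
  assumes k: "\<And>y. (k has_derivative k' y) (at y)" "\<And>v. continuous_on UNIV (\<lambda>y. k' y v)" "\<And>y. \<rho> < norm y \<Longrightarrow> k y = 0"
    and F: "continuous_on UNIV F"
  shows "(conv k F has_derivative (\<lambda>v. - conv (\<lambda>y. k' y v) F x)) (at x)"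
proof -
  have ck: "continuous_on UNIV k" using k(1) by (intro has_derivative_continuous_on)
  have lin: "linear (k' y)" for y using k(1) has_derivative_linear by blast
  have "((\<lambda>z. \<integral>y. k (y - z) *\<^sub>R F y \<partial>lborel) has_derivative
     (\<lambda>v. \<integral>y. (- k' (y - x) v) *\<^sub>R F y \<partial>lborel)) (at x)"
  \<comment> \<open>The radius grows by 1 to contain the supports of all kernels centred within
    distance 1 of \<open>x\<close>.\<close>
  proof (rule has_derivative_integral_lborel[of "cball x (\<rho>+1)"])
    fix z y
    have "((\<lambda>z. k (y - z)) has_derivative (\<lambda>v. k' (y - z) (- v))) (at z)"
      by (rule has_derivative_compose[OF _ k(1)]) (auto intro!: derivative_eq_intros)
    then show "((\<lambda>z. k (y - z) *\<^sub>R F y) has_derivative (\<lambda>v. (- k' (y - z) v) *\<^sub>R F y)) (at z)"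
      by (auto intro!: derivative_eq_intros simp: linear_neg[OF lin])
  next
    fix z y assume *: "z \<in> ball x 1" "y \<notin> cball x (\<rho>+1)"
    have "dist x y \<le> dist x z + dist z y" by (rule dist_triangle)
    then show "k (y - z) *\<^sub>R F y = 0"
      using * by (intro scaleR_eq_0_iff[THEN iffD2] disjI1 k(3)) (auto simp: dist_norm norm_minus_commute)
  qed (auto intro!: continuous_on_scaleR continuous_on_compose2[OF F _ subset_UNIV] continuous_on_minus
      continuous_on_compose2[OF ck _ subset_UNIV] continuous_on_compose2[OF k(2) _ subset_UNIV]
      continuous_on_diff continuous_on_fst continuous_on_snd continuous_on_id)
  then show ?thesis by (simp add: conv_eq[OF ck F, abs_def] conv_eq[OF k(2) F])
qed

text \<open>The derivative in the radius is the trace of the matrix of first moments of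
  \<open>F'\<close>; the mean value property rests on its vanishing.\<close>

lemma scaled_kernel_has_derivative:
  fixes F :: "'a::euclidean_space \<Rightarrow> 'b::euclidean_space"
  assumes k: "continuous_on UNIV k" "\<And>y. \<rho> < norm y \<Longrightarrow> k y = 0"
    and F: "\<And>x. (F has_derivative F' x) (at x)" and F': "\<And>v. continuous_on UNIV (\<lambda>x. F' x v)"
  shows "((\<lambda>r. \<integral>y. k y *\<^sub>R F (x + r *\<^sub>R y) \<partial>lborel) has_vector_derivative
     (\<Sum>b\<in>Basis. \<integral>y. (k y * (y \<bullet> b)) *\<^sub>R F' (x + r *\<^sub>R y) b \<partial>lborel)) (at r)"
proof -
  have cF: "continuous_on UNIV F" using F by (intro has_derivative_continuous_on)
  have lin: "linear (F' y)" for y using F has_derivative_linear by blast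
  have ex: "F' p y = (\<Sum>b\<in>Basis. (y \<bullet> b) *\<^sub>R F' p b)" for p y
    by (simp only: linear_sum[OF lin, symmetric] linear_cmul[OF lin, symmetric] euclidean_representation)
  note cI = continuous_on_scaleR continuous_on_compose2[OF cF _ subset_UNIV]
      continuous_on_compose2[OF k(1) _ subset_UNIV] continuous_on_compose2[OF F' _ subset_UNIV]
      continuous_on_add continuous_on_fst continuous_on_snd continuous_on_id continuous_on_const
      continuous_on_sum continuous_on_inner continuous_on_mult
  have "((\<lambda>r. \<integral>y. k y *\<^sub>R F (x + r *\<^sub>R y) \<partial>lborel) has_derivative
     (\<lambda>s. \<integral>y. s *\<^sub>R k y *\<^sub>R (\<Sum>b\<in>Basis. (y \<bullet> b) *\<^sub>R F' (x + r *\<^sub>R y) b) \<partial>lborel)) (at r)"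
  proof (rule has_derivative_integral_lborel[of "cball 0 \<rho>"])
    fix z y
    have "((\<lambda>z. F (x + z *\<^sub>R y)) has_derivative (\<lambda>s. F' (x + z *\<^sub>R y) (s *\<^sub>R y))) (at z)"
      by (rule has_derivative_compose[OF _ F]) (auto intro!: derivative_eq_intros)
    then show "((\<lambda>z. k y *\<^sub>R F (x + z *\<^sub>R y)) has_derivative (\<lambda>s. s *\<^sub>R k y *\<^sub>R (\<Sum>b\<in>Basis. (y \<bullet> b) *\<^sub>R F' (x + z *\<^sub>R y) b))) (at z)"
      unfolding ex[symmetric] by (auto intro!: derivative_eq_intros simp: linear_cmul[OF lin] mult.commute)
  qed (use k(2) in \<open>auto intro!: cI\<close>)
  moreover have "(\<integral>y. k y *\<^sub>R (\<Sum>b\<in>Basis. (y \<bullet> b) *\<^sub>R F' (x + r *\<^sub>R y) b) \<partial>lborel)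
      = (\<Sum>b\<in>Basis. \<integral>y. (k y * (y \<bullet> b)) *\<^sub>R F' (x + r *\<^sub>R y) b \<partial>lborel)"
  proof (subst Bochner_Integration.integral_sum[symmetric])
    fix b :: 'a
    show "integrable lborel (\<lambda>y. (k y * (y \<bullet> b)) *\<^sub>R F' (x + r *\<^sub>R y) b)"
      by (rule integrable_compact_support[of "cball 0 \<rho>"]) (use k(2) in \<open>auto intro!: cI\<close>)
  qed (simp add: scaleR_sum_right)
  ultimately show ?thesis
    by (simp only: has_vector_derivative_def Bochner_Integration.integral_scaleR_right)
qed

lemma conv_norm_le:
  fixes F :: "'a::euclidean_space \<Rightarrow> 'b::euclidean_space"
  assumes k: "continuous_on UNIV k" "\<And>y. \<rho> < norm y \<Longrightarrow> k y = 0" "\<And>y. \<bar>k y\<bar> \<le> C" and F: "continuous_on UNIV F"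
    and B: "\<And>y. norm y \<le> \<rho> \<Longrightarrow> norm (F (x + y)) \<le> B" and "0 \<le> B"
  shows "norm (conv k F x) \<le> C * B * measure lborel (cball (0::'a) \<rho>)"
proof -
  have "norm (conv k F x) \<le> (\<integral>y. norm (k y *\<^sub>R F (x + y)) \<partial>lborel)"
    unfolding conv_def by (rule integral_norm_bound)
  also have "\<dots> \<le> (\<integral>y. (C * B) * indicator (cball (0::'a) \<rho>) y \<partial>lborel)"
  proof (rule integral_mono)
    show "integrable lborel (\<lambda>y. norm (k y *\<^sub>R F (x + y)))"
      by (intro integrable_norm integrable_conv[OF k(1,2) F])
    have "emeasure lborel (cball (0::'a) \<rho>) < \<infinity>" by (rule emeasure_lborel_cball_finite)
    then show "integrable lborel (\<lambda>y. (C * B) * indicator (cball (0::'a) \<rho>) y)"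
      by (intro integrable_mult_right integrable_real_indicator) simp_all
    show "norm (k y *\<^sub>R F (x + y)) \<le> (C * B) * indicator (cball (0::'a) \<rho>) y" for y
    proof (cases "norm y \<le> \<rho>")
      case True
      then show ?thesis using k(3)[of y] B[of y] order_trans[OF abs_ge_zero k(3)]
        by (auto intro!: mult_mono)
    qed (use k(2) in simp)
  qed
  also have "\<dots> = C * B * measure lborel (cball (0::'a) \<rho>)" by simp
  finally show ?thesis .
qed

lemma conv_add:
  fixes F :: "'a::euclidean_space \<Rightarrow> 'b::euclidean_space"
  assumes "continuous_on UNIV k" "\<And>y. \<rho> < norm y \<Longrightarrow> k y = 0" "continuous_on UNIV F" "continuous_on UNIV G"
  shows "conv k (\<lambda>x. F x + G x) x = conv k F x + conv k G x"
  unfolding conv_def scaleR_add_right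
  by (intro Bochner_Integration.integral_add integrable_conv[OF assms(1,2)] assms(3,4))

lemma conv_bounded_linear:
  fixes F :: "'a::euclidean_space \<Rightarrow> 'b::euclidean_space" and A :: "'b \<Rightarrow> 'c::euclidean_space"
  assumes "bounded_linear A" "continuous_on UNIV k" "\<And>y. \<rho> < norm y \<Longrightarrow> k y = 0" "continuous_on UNIV F"
  shows "conv k (\<lambda>x. A (F x)) x = A (conv k F x)"
  unfolding conv_def
  by (subst integral_bounded_linear[OF assms(1) integrable_conv[OF assms(2-4)], symmetric])
    (simp_all add: linear_simps[OF assms(1)])

section \<open>A Goursat theorem for first order systems\<close>

definition ppow :: "nat \<Rightarrow> real \<Rightarrow> real" where
  "ppow n t = (max 0 t) ^ n"

lemma ppow_nonpos: "t \<le> 0 \<Longrightarrow> ppow (Suc n) t = 0"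
  and ppow_nonneg_eq: "0 \<le> t \<Longrightarrow> ppow n t = t ^ n"
  by (auto simp: ppow_def max_def)

lemma ppow_nonneg: "0 \<le> ppow n t"
  by (simp add: ppow_def)

lemma continuous_on_ppow: "continuous_on S (ppow n)"
  unfolding ppow_def[abs_def] by (intro continuous_intros)

lemma has_real_derivative_ppow:
  "(ppow (Suc (Suc n)) has_real_derivative (real (Suc (Suc n)) * ppow (Suc n) t)) (at t)"
proof (cases t "0::real" rule: linorder_cases)
  case less
  have "((\<lambda>t::real. 0) has_real_derivative (real (Suc (Suc n)) * ppow (Suc n) t)) (at t)"
    using less by (simp add: ppow_nonpos)
  then show ?thesis
    by (rule has_field_derivative_transform_within_open[of _ _ _ "{..<0}"]) (use less in \<open>auto simp: ppow_nonpos\<close>)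
next
  case greater
  have "((\<lambda>t. t ^ Suc (Suc n)) has_real_derivative (real (Suc (Suc n)) * ppow (Suc n) t)) (at t)"
    using greater DERIV_pow[of "Suc (Suc n)" t UNIV] by (simp add: ppow_nonneg_eq)
  then show ?thesis
    by (rule has_field_derivative_transform_within_open[of _ _ _ "{0<..}"]) (use greater in \<open>auto simp: ppow_nonneg_eq\<close>)
next
  case equal
  \<comment> \<open>At 0 the difference quotient of a truncated power is the truncated power of one
    degree less, which is continuous.\<close>
  have "((\<lambda>h. ppow (Suc n) h) \<longlongrightarrow> ppow (Suc n) 0) (at 0)"
    using continuous_on_ppow[of UNIV] by (simp add: continuous_on_def)
  moreover have "eventually (\<lambda>h. ppow (Suc n) h = ppow (Suc (Suc n)) h / h) (at 0)"
    by (auto simp: eventually_at ppow_def max_def intro!: exI[of _ 1])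
  ultimately have "((\<lambda>h. ppow (Suc (Suc n)) h / h) \<longlongrightarrow> ppow (Suc n) 0) (at 0)"
    by (rule Lim_transform_eventually)
  then show ?thesis using equal by (simp add: DERIV_def ppow_nonpos)
qed

text \<open>Third backward difference of the truncated square: twice the quadratic cardinal B-spline
  with knots 0, 1, 2, 3. Degree two is the lowest that gives a continuous derivative.\<close>

definition spline :: "real \<Rightarrow> real" where
  "spline t = ppow 2 t - 3 * ppow 2 (t - 1) + 3 * ppow 2 (t - 2) - ppow 2 (t - 3)"

definition spline' :: "real \<Rightarrow> real" where
  "spline' t = 2 * (ppow 1 t - 3 * ppow 1 (t - 1) + 3 * ppow 1 (t - 2) - ppow 1 (t - 3))"

lemma spline_derivative: "(spline has_real_derivative spline' t) (at t)"
proof -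
  have d: "((\<lambda>t. ppow 2 (t - c)) has_real_derivative 2 * ppow 1 (t - c)) (at t)" for c :: real
    using DERIV_shift[of "ppow 2" "2 * ppow 1 (t - c)" t "- c"] has_real_derivative_ppow[of 0 "t - c"]
    by (simp add: numeral_2_eq_2)
  have "(spline has_real_derivative
      (2 * ppow 1 (t - 0) - 3 * (2 * ppow 1 (t - 1)) + 3 * (2 * ppow 1 (t - 2)) - 2 * ppow 1 (t - 3))) (at t)"
    unfolding spline_def[abs_def] using d[of 0] by (intro DERIV_add DERIV_diff DERIV_cmult d) simp
  then show ?thesis by (simp add: spline'_def)
qed

text \<open>With \<open>z\<close> the shift by one half, the third difference with unit step is
  \<open>(1 - z^2)^3 = (1 + z)^3 (1 - z)^3\<close>. Expanding the first factor gives the binomial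
  weights, and homogeneity of the square gives the factor 1/4.\<close>

lemma spline_refine: "spline t = (\<Sum>s<4. (real (3 choose s) / 4) * spline (2 * t - real s))"
proof -
  have m: "ppow 2 (2 * u) = 4 * ppow 2 u" for u :: real by (auto simp: ppow_def max_def power2_eq_square)
  have e: "ppow 2 (2 * t - j) = 4 * ppow 2 (t - j / 2)" for j
    using m[of "t - j / 2"] by (simp add: algebra_simps)
  have sp: "spline (2 * t - j) = 4 * ppow 2 (t - j / 2) - 12 * ppow 2 (t - (j + 1) / 2)
      + 12 * ppow 2 (t - (j + 2) / 2) - 4 * ppow 2 (t - (j + 3) / 2)" for j
    using e[of j] e[of "j + 1"] e[of "j + 2"] e[of "j + 3"] by (simp add: spline_def algebra_simps)
  have "(\<Sum>s<4. f s) = f 0 + f 1 + f 2 + f 3" for f :: "nat \<Rightarrow> real" by (simp add: eval_nat_numeral)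
  moreover have "(3 choose 0) = (1::nat)" "(3 choose 1) = (3::nat)" "(3 choose 2) = (3::nat)" "(3 choose 3) = (1::nat)"
    by (simp_all add: eval_nat_numeral)
  ultimately show ?thesis
    using sp[of 0] sp[of 1] sp[of 2] sp[of 3] by (simp add: spline_def[of t] field_simps)
qed

lemma spline_zero: assumes "t \<le> 0 \<or> 3 \<le> t" shows "spline t = 0"
proof (cases "t \<le> 0")
  case True
  then show ?thesis by (simp add: spline_def ppow_nonpos numeral_2_eq_2)
next
  case False
  then have "3 \<le> t" using assms by simp
  then show ?thesis by (simp add: spline_def ppow_nonneg_eq) (simp add: power2_eq_square algebra_simps)
qed

lemma spline_nonneg: "0 \<le> spline t"
proof -
  consider "t \<le> 0 \<or> 3 \<le> t" | "0 < t" "t \<le> 1" | "1 < t" "t \<le> 2" | "2 < t" "t < 3" by linarith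
  then show ?thesis
  proof cases
    case 2
    then show ?thesis by (simp add: spline_def ppow_nonneg_eq ppow_nonpos numeral_2_eq_2)
  next
    case 3
    have "t\<^sup>2 - 3 * (t - 1)\<^sup>2 = 3/2 - 2 * (t - 3/2)\<^sup>2" by (simp add: power2_eq_square algebra_simps)
    moreover have "(t - 3/2)\<^sup>2 \<le> (1/2)\<^sup>2" using 3 by (intro abs_le_square_iff[THEN iffD1]) (simp add: abs_if)
    ultimately show ?thesis using 3 ppow_nonpos[of "t - 3" 1] ppow_nonpos[of "t - 2" 1]
      by (simp add: spline_def ppow_nonneg_eq power2_eq_square[of "1/2"] numeral_2_eq_2[symmetric])
  next
    case 4
    have "t\<^sup>2 - 3 * (t - 1)\<^sup>2 + 3 * (t - 2)\<^sup>2 = (3 - t)\<^sup>2" by (simp add: power2_eq_square algebra_simps)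
    then show ?thesis using 4 ppow_nonpos[of "t - 3" 1] by (simp add: spline_def ppow_nonneg_eq numeral_2_eq_2[symmetric])
  qed (simp add: spline_zero)
qed

definition spline_kernel :: "'a::euclidean_space \<Rightarrow> real" where
  "spline_kernel y = (\<Prod>b\<in>Basis. spline (y \<bullet> b))"

definition spline_kernel' :: "'a::euclidean_space \<Rightarrow> 'a \<Rightarrow> real" where
  "spline_kernel' y v = (\<Sum>b\<in>Basis. (v \<bullet> b) * spline' (y \<bullet> b) * (\<Prod>c\<in>Basis - {b}. spline (y \<bullet> c)))"

lemma spline_kernel_derivative: "(spline_kernel has_derivative spline_kernel' y) (at y)"
proof -
  have "((\<lambda>y. spline (y \<bullet> b)) has_derivative (\<lambda>v. (v \<bullet> b) * spline' (y \<bullet> b))) (at y)" for b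
    using has_derivative_compose[OF has_derivative_inner_left[OF has_derivative_ident]
        spline_derivative[unfolded has_field_derivative_def], of b y UNIV]
    by (simp add: mult.commute)
  then show ?thesis
    unfolding spline_kernel_def[abs_def] spline_kernel'_def[abs_def] by (intro has_derivative_prod)
qed

lemma continuous_on_spline: "continuous_on S spline" "continuous_on S spline'"
  unfolding spline_def[abs_def] spline'_def[abs_def]
  by (intro continuous_intros continuous_on_compose2[OF continuous_on_ppow _ subset_UNIV])+

lemma continuous_on_spline_kernel': "continuous_on S (\<lambda>y. spline_kernel' y v)"
  unfolding spline_kernel'_def
  by (intro continuous_intros continuous_on_compose2[OF continuous_on_spline(1) _ subset_UNIV]
    continuous_on_compose2[OF continuous_on_spline(2) _ subset_UNIV])

lemma spline_kernel_nonneg: "0 \<le> spline_kernel y"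
  unfolding spline_kernel_def by (intro prod_nonneg) (auto simp: spline_nonneg)

lemma spline_kernel_zero:
  assumes "3 * real DIM('a) < norm (y::'a::euclidean_space)"
  shows "spline_kernel y = 0"
proof (rule ccontr)
  assume "spline_kernel y \<noteq> 0"
  then have "\<bar>y \<bullet> b\<bar> \<le> 3" if "b \<in> Basis" for b
    using that spline_zero[of "y \<bullet> b"] by (force simp: spline_kernel_def)
  then have "(\<Sum>b\<in>Basis. \<bar>y \<bullet> b\<bar>) \<le> (\<Sum>b\<in>(Basis::'a set). 3)" by (intro sum_mono)
  then show False using norm_le_l1[of y] assms by simp
qed

definition spline_shift :: "('a::euclidean_space \<Rightarrow> nat) \<Rightarrow> 'a" where
  "spline_shift s = (\<Sum>b\<in>Basis. real (s b) *\<^sub>R b)"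

definition spline_weight :: "('a::euclidean_space \<Rightarrow> nat) \<Rightarrow> real" where
  "spline_weight s = (\<Prod>b\<in>Basis. real (3 choose s b) / 4)"

abbreviation spline_shifts :: "('a::euclidean_space \<Rightarrow> nat) set" where
  "spline_shifts \<equiv> PiE Basis (\<lambda>_. {..<4})"

lemma spline_kernel_refine:
  "spline_kernel (y::'a::euclidean_space) = (\<Sum>s\<in>spline_shifts. spline_weight s * spline_kernel (2 *\<^sub>R y - spline_shift s))"
proof -
  have "spline_kernel y = (\<Prod>b\<in>Basis. \<Sum>s<4. (real (3 choose s) / 4) * spline (2 * (y \<bullet> b) - real s))"
    unfolding spline_kernel_def by (intro prod.cong refl spline_refine)
  also have "\<dots> = (\<Sum>s\<in>spline_shifts. \<Prod>b\<in>Basis. (real (3 choose s b) / 4) * spline (2 * (y \<bullet> b) - real (s b)))"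
    by (rule prod_sum_PiE) auto
  also have "\<dots> = (\<Sum>s\<in>spline_shifts. spline_weight s * spline_kernel (2 *\<^sub>R y - spline_shift s))"
    unfolding spline_weight_def spline_kernel_def prod.distrib[symmetric]
    by (intro sum.cong prod.cong refl) (simp add: spline_shift_def inner_diff_left inner_sum_left inner_Basis if_distrib cong: if_cong)
  finally show ?thesis .
qed

text \<open>The total weight is the ratio between the volume of a kernel and that of a half-size
  copy. Hence the fraction of the defect that is lost per subdivision in \<open>goursat\<close>
  matches the shrinking of the volume.\<close>

lemma sum_spline_weight: "(\<Sum>s\<in>(spline_shifts :: ('a::euclidean_space \<Rightarrow> nat) set). spline_weight s) = 2 ^ DIM('a)"
proof -
  have "(\<Sum>s<4. real (3 choose s) / 4) = 2" by (simp add: eval_nat_numeral)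
  moreover have "(\<Sum>s\<in>(spline_shifts :: ('a \<Rightarrow> nat) set). spline_weight s) = (\<Prod>b\<in>(Basis::'a set). \<Sum>s<4. real (3 choose s) / 4)"
    unfolding spline_weight_def by (subst prod_sum_PiE) auto
  ultimately show ?thesis by simp
qed

lemma norm_spline_shift:
  fixes s :: "'a::euclidean_space \<Rightarrow> nat"
  assumes s: "s \<in> spline_shifts"
  shows "norm (spline_shift s) \<le> 3 * real DIM('a)"
proof -
  have "norm (spline_shift s) \<le> (\<Sum>b\<in>(Basis::'a set). 3)"
    unfolding spline_shift_def
  proof (rule sum_norm_le)
    fix b :: 'a assume b: "b \<in> Basis"
    then have "s b < 4" using s by auto
    then show "norm (real (s b) *\<^sub>R b) \<le> 3" using b by simp
  qed
  then show ?thesis by simp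
qed

lemma spline_weight_nonneg: "0 \<le> spline_weight s"
  by (simp add: spline_weight_def prod_nonneg)

lemma spline_kernel'_bounded: obtains C where "C > 0" "\<And>y (b::'a::euclidean_space). b \<in> Basis \<Longrightarrow> \<bar>spline_kernel' y b\<bar> \<le> C"
proof -
  let ?K = "cball (0::'a) (3 * real DIM('a))"
  have "\<exists>C. \<forall>y. \<bar>spline_kernel' y b\<bar> \<le> C" for b :: 'a
  proof -
    have "bounded ((\<lambda>y. spline_kernel' y b) ` ?K)"
      by (intro compact_imp_bounded compact_continuous_image continuous_on_spline_kernel' compact_cball)
    then obtain C where C: "\<And>y. y \<in> ?K \<Longrightarrow> \<bar>spline_kernel' y b\<bar> \<le> C" unfolding bounded_iff by fastforce
    have "\<bar>spline_kernel' y b\<bar> \<le> max C 0" for y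
    proof (cases "y \<in> ?K")
      case False
      then have "3 * real DIM('a) < norm y" by simp
      then have "spline_kernel' y b = 0"
        using derivative_zero_outside[OF spline_kernel_zero spline_kernel_derivative] by blast
      then show ?thesis by simp
    qed (use C in \<open>auto simp: le_max_iff_disj\<close>)
    then show ?thesis by blast
  qed
  then obtain C where C: "\<And>y b. \<bar>spline_kernel' y b\<bar> \<le> C (b::'a)" by metis
  show thesis
  proof (rule that[of "1 + (\<Sum>b\<in>(Basis::'a set). \<bar>C b\<bar>)"])
    fix y b :: 'a assume "b \<in> Basis"
    then have "\<bar>C b\<bar> \<le> (\<Sum>b\<in>(Basis::'a set). \<bar>C b\<bar>)" by (intro member_le_sum) auto
    then show "\<bar>spline_kernel' y b\<bar> \<le> 1 + (\<Sum>b\<in>(Basis::'a set). \<bar>C b\<bar>)" using C[of y b] by linarith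
  qed (auto intro!: add_pos_nonneg sum_nonneg)
qed


section \<open>Goursat's argument with subdivision of the kernel\<close>

lemma geometric_Cauchy:
  fixes X :: "nat \<Rightarrow> 'a::banach"
  assumes "\<And>n. norm (X (Suc n) - X n) \<le> C / 2 ^ Suc n"
  obtains l where "\<And>n. norm (X n - l) \<le> C / 2 ^ n"
proof -
  have *: "norm (X (n + m) - X n) \<le> C / 2 ^ n - C / 2 ^ (n + m)" for n m
  proof (induction m)
    case (Suc m)
    have "norm (X (n + Suc m) - X n) \<le> norm (X (Suc (n + m)) - X (n + m)) + norm (X (n + m) - X n)"
      using norm_triangle_ineq[of "X (Suc (n + m)) - X (n + m)" "X (n + m) - X n"] by simp
    also have "\<dots> \<le> C / 2 ^ Suc (n + m) + (C / 2 ^ n - C / 2 ^ (n + m))"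
      by (intro add_mono assms Suc.IH)
    also have "\<dots> = C / 2 ^ n - C / 2 ^ (n + Suc m)" by (simp add: field_simps)
    finally show ?case .
  qed simp
  have C: "0 \<le> C" using order_trans[OF norm_ge_zero assms[of 0]] by simp
  have **: "norm (X (n + m) - X n) \<le> C / 2 ^ n" for n m
    using *[of n m] C by (smt (verit) divide_nonneg_nonneg zero_le_power)
  have lim: "(\<lambda>n. C / 2 ^ n) \<longlonglongrightarrow> 0"
    using tendsto_mult_right_zero[OF LIMSEQ_power_zero[of "1/2::real"], of C] by (simp add: power_divide)
  have "Cauchy X"
    unfolding Cauchy_altdef2
  proof (intro allI impI)
    fix e :: real assume "0 < e"
    then obtain N where "C / 2 ^ N < e"
      using order_tendstoD(2)[OF lim] by (auto simp: eventually_sequentially)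
    then have "dist (X n) (X N) < e" if "n \<ge> N" for n
      using **[of N "n - N"] that by (simp add: dist_norm)
    then show "\<exists>N. \<forall>n\<ge>N. dist (X n) (X N) < e" by blast
  qed
  then obtain l where l: "X \<longlonglongrightarrow> l" using Cauchy_convergent_iff convergentD by blast
  have "norm (X n - l) \<le> C / 2 ^ n" for n
  proof -
    have "(\<lambda>m. norm (X (n + m) - X n)) \<longlonglongrightarrow> norm (l - X n)"
      using LIMSEQ_ignore_initial_segment[OF l, of n] by (intro tendsto_intros) (simp add: add.commute)
    then have "norm (l - X n) \<le> C / 2 ^ n" by (rule LIMSEQ_le_const2) (use ** in blast)
    then show ?thesis by (simp add: norm_minus_commute)
  qed
  then show thesis by (rule that)
qed

text \<open>For positive \<open>r\<close> the kernel is rescaled but not normalised: its mass is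
  proportional to \<open>r ^ DIM('a)\<close>, like the volume of a domain of integration that is
  being subdivided.\<close>

definition spl :: "real \<Rightarrow> 'a::euclidean_space \<Rightarrow> real" where
  "spl r y = spline_kernel (y /\<^sub>R r)"

definition spl' :: "real \<Rightarrow> 'a::euclidean_space \<Rightarrow> 'a \<Rightarrow> real" where
  "spl' r y v = spline_kernel' (y /\<^sub>R r) v / r"

lemma spl_derivative: "(spl r has_derivative spl' r y) (at y)"
proof -
  have "((\<lambda>y. y /\<^sub>R r) has_derivative (\<lambda>v. v /\<^sub>R r)) (at y)" by (auto intro!: derivative_eq_intros)
  from has_derivative_compose[OF this spline_kernel_derivative]
  have "(spl r has_derivative (\<lambda>v. spline_kernel' (y /\<^sub>R r) (v /\<^sub>R r))) (at y)" by (simp add: spl_def[abs_def])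
  moreover have "linear (spline_kernel' (y /\<^sub>R r))" using spline_kernel_derivative has_derivative_linear by blast
  ultimately show ?thesis by (simp add: spl'_def[abs_def] linear_cmul divide_inverse_commute)
qed

lemma continuous_on_spl': "continuous_on S (\<lambda>y. spl' r y v)"
  unfolding spl'_def divide_inverse
  by (intro continuous_intros continuous_on_compose2[OF continuous_on_spline_kernel' _ subset_UNIV])

lemma continuous_on_spl: "continuous_on S (spl r)"
  using spl_derivative by (meson has_derivative_at_withinI has_derivative_continuous_on)

lemma spl_zero:
  assumes "r > 0" "3 * real DIM('a) * r < norm (y::'a::euclidean_space)"
  shows "spl r y = 0"
  unfolding spl_def using assms by (intro spline_kernel_zero) (simp add: field_simps)

lemma spl_nonneg: "0 \<le> spl r y"
  by (simp add: spl_def spline_kernel_nonneg)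

lemma spl_refine: "r > 0 \<Longrightarrow> spl r (y::'a::euclidean_space)
   = (\<Sum>s\<in>spline_shifts. spline_weight s * spl (r / 2) (y - (r / 2) *\<^sub>R spline_shift s))"
  unfolding spl_def by (subst spline_kernel_refine) (simp add: scaleR_diff_right field_simps)

text \<open>If the averaged system failed by \<open>\<eta>\<close>, refinement would pass the
  failure on to kernels of half the size, at least the fraction \<open>1 / 2 ^ N\<close> of it at
  each stage, with centres converging to a point \<open>l\<close>. Near \<open>l\<close> the
  function is affine up to \<open>\<epsilon>\<close> times the distance. The affine part solves the
  system, and the rest contributes at most a multiple of \<open>\<epsilon>\<close> times the volume
  at scale \<open>\<rho>\<close>: the derivative of the kernel costs \<open>1 / \<rho>\<close>, the
  remainder gains \<open>\<rho>\<close>. Since \<open>2 ^ (N * n)\<close> times this volume is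
  constant, \<open>\<eta>\<close> is at most a fixed multiple of every
  \<open>\<epsilon>\<close>.\<close>

theorem goursat:
  fixes F :: "'a::euclidean_space \<Rightarrow> 'b::euclidean_space" and A :: "'a \<Rightarrow> 'b \<Rightarrow> 'c::euclidean_space"
  assumes A: "\<And>b. b \<in> Basis \<Longrightarrow> bounded_linear (A b)"
    and F: "\<And>x. (F has_derivative F' x) (at x)"
    and eq: "\<And>x. (\<Sum>b\<in>Basis. A b (F' x b)) = 0" and r: "0 < r"
  shows "(\<Sum>b\<in>Basis. A b (conv (\<lambda>y. spl' r y b) F x)) = 0"
proof (rule ccontr)
  define N where "N = DIM('a)"
  define D where "D = 3 * real DIM('a)"
  have D: "D > 0" by (simp add: D_def)
  define E where "E r x = (\<Sum>b\<in>Basis. A b (conv (\<lambda>y. spl' r y b) F x))" for r x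
  assume "(\<Sum>b\<in>Basis. A b (conv (\<lambda>y. spl' r y b) F x)) \<noteq> 0"
  then have "E r x \<noteq> 0" by (simp add: E_def)
  define \<eta> where "\<eta> = norm (E r x)"
  have \<eta>: "\<eta> > 0" using \<open>E r x \<noteq> 0\<close> by (simp add: \<eta>_def)
  have cF: "continuous_on UNIV F" using F by (intro has_derivative_continuous_on)
  have z': "spl' r y v = 0" if "r > 0" "D * r < norm y" for r and y v :: 'a
    using derivative_zero_outside[OF spl_zero[OF that(1)] spl_derivative] that(2) by (simp add: D_def)
  \<comment> \<open>The refinement identity for \<open>conv (spl r) F\<close> is differentiated on
    both sides; uniqueness of the derivative turns it into an identity for the averages against
    \<open>spl'\<close>.\<close>
  have step: "E r x = (\<Sum>s\<in>spline_shifts. spline_weight s *\<^sub>R E (r / 2) (x + (r / 2) *\<^sub>R spline_shift s))" if r: "r > 0" for r x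
  proof -
    have eq: "conv (spl r) F x = (\<Sum>s\<in>spline_shifts. spline_weight s *\<^sub>R conv (spl (r / 2)) F (x + (r / 2) *\<^sub>R spline_shift s))" for x
    proof -
      have "conv (spl r) F x = (\<integral>y. (\<Sum>s\<in>spline_shifts. spline_weight s *\<^sub>R spl (r / 2) (y - (r / 2) *\<^sub>R spline_shift s) *\<^sub>R F (x + y)) \<partial>lborel)"
        unfolding conv_def by (subst spl_refine[OF r]) (simp add: scaleR_sum_left)
      also have "\<dots> = (\<Sum>s\<in>spline_shifts. spline_weight s *\<^sub>R conv (\<lambda>y. spl (r / 2) (y - (r / 2) *\<^sub>R spline_shift s)) F x)"
      proof (subst Bochner_Integration.integral_sum)
        fix s :: "'a \<Rightarrow> nat"
        have "spl (r / 2) (y - (r / 2) *\<^sub>R spline_shift s) = 0" if "D * (r / 2) + norm ((r / 2) *\<^sub>R spline_shift s) < norm y" for y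
          using that norm_triangle_ineq2[of y "(r / 2) *\<^sub>R spline_shift s"] r by (intro spl_zero) (auto simp: D_def)
        then show "integrable lborel (\<lambda>y. spline_weight s *\<^sub>R spl (r / 2) (y - (r / 2) *\<^sub>R spline_shift s) *\<^sub>R F (x + y))"
          by (intro integrable_scaleR_right integrable_conv[OF _ _ cF] continuous_on_compose2[OF continuous_on_spl _ subset_UNIV] continuous_intros)
      qed (simp only: conv_def Bochner_Integration.integral_scaleR_right)
      finally show ?thesis by (simp add: conv_translate[OF continuous_on_spl cF])
    qed
    have d: "(conv (spl r) F has_derivative (\<lambda>v. - conv (\<lambda>y. spl' r y v) F x)) (at x)" if r: "r > 0" for r x
      by (rule conv_has_derivative_left[OF spl_derivative continuous_on_spl' spl_zero[OF r] cF])
    have "(conv (spl r) F has_derivative (\<lambda>v. \<Sum>s\<in>spline_shifts. spline_weight s *\<^sub>R - conv (\<lambda>y. spl' (r/2) y v) F (x + (r / 2) *\<^sub>R spline_shift s))) (at x)"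
      unfolding eq[abs_def]
    proof (intro has_derivative_sum has_derivative_scaleR_right)
      fix s :: "'a \<Rightarrow> nat"
      have "((\<lambda>x. x + (r / 2) *\<^sub>R spline_shift s) has_derivative (\<lambda>v. v)) (at x)" by (auto intro!: derivative_eq_intros)
      from has_derivative_compose[OF this d] r
      show "((\<lambda>x. conv (spl (r / 2)) F (x + (r / 2) *\<^sub>R spline_shift s)) has_derivative
           (\<lambda>v. - conv (\<lambda>y. spl' (r / 2) y v) F (x + (r / 2) *\<^sub>R spline_shift s))) (at x)" by simp
    qed
    from has_derivative_unique[OF this d[OF r]]
    have *: "conv (\<lambda>y. spl' r y v) F x = (\<Sum>s\<in>spline_shifts. spline_weight s *\<^sub>R conv (\<lambda>y. spl' (r/2) y v) F (x + (r / 2) *\<^sub>R spline_shift s))" for v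
      by (auto dest!: fun_cong[of _ _ v] simp: sum_negf)
    show ?thesis
      unfolding E_def * using A
      by (simp add: linear_sum[OF bounded_linear.linear] linear_cmul[OF bounded_linear.linear] scaleR_sum_right cong: sum.cong)
        (rule sum.swap)
  qed
  have ex: "\<exists>s\<in>spline_shifts. norm (E r x) / 2 ^ N \<le> norm (E (r / 2) (x + (r / 2) *\<^sub>R spline_shift s))" if "r > 0" for r x
  proof (rule ccontr)
    assume "\<not> ?thesis"
    then have less: "norm (E (r / 2) (x + (r / 2) *\<^sub>R spline_shift s)) < norm (E r x) / 2 ^ N" if "s \<in> spline_shifts" for s
      using that by force
    \<comment> \<open>A positive weight makes the comparison of the two weighted sums
      strict.\<close>
    have "\<exists>s\<in>(spline_shifts::('a\<Rightarrow>nat) set). 0 < spline_weight s"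
    proof (rule ccontr)
      assume "\<not> ?thesis"
      then have "(\<Sum>s\<in>(spline_shifts::('a\<Rightarrow>nat) set). spline_weight s) \<le> 0" by (intro sum_nonpos) (auto simp: not_less)
      then show False by (simp add: sum_spline_weight) (simp flip: not_less)
    qed
    then obtain s0 :: "'a \<Rightarrow> nat" where s0: "s0 \<in> spline_shifts" "0 < spline_weight s0" by blast
    have "norm (E r x) \<le> (\<Sum>s\<in>spline_shifts. spline_weight s * norm (E (r / 2) (x + (r / 2) *\<^sub>R spline_shift s)))"
      by (subst step[OF that]) (auto intro!: sum_norm_le simp: spline_weight_nonneg)
    also have "\<dots> < (\<Sum>s\<in>(spline_shifts::('a\<Rightarrow>nat) set). spline_weight s * (norm (E r x) / 2 ^ N))"
    proof (rule sum_strict_mono_ex1)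
      show "finite (spline_shifts :: ('a \<Rightarrow> nat) set)" by (intro finite_PiE) auto
      show "\<forall>s\<in>spline_shifts. spline_weight s * norm (E (r / 2) (x + (r / 2) *\<^sub>R spline_shift s)) \<le> spline_weight s * (norm (E r x) / 2 ^ N)"
        by (intro ballI mult_left_mono less_imp_le less spline_weight_nonneg)
      show "\<exists>s\<in>spline_shifts. spline_weight s * norm (E (r / 2) (x + (r / 2) *\<^sub>R spline_shift s)) < spline_weight s * (norm (E r x) / 2 ^ N)"
        using s0 by (intro bexI[of _ s0] mult_strict_left_mono less)
    qed
    also have "\<dots> = norm (E r x)" by (simp only: sum_distrib_right[symmetric] sum_spline_weight N_def) simp
    finally show False by simp
  qed
  have "\<exists>X. \<forall>n. \<eta> / 2 ^ (N * n) \<le> norm (E (r / 2 ^ n) (X n)) \<and> norm (X (Suc n) - X n) \<le> D * r / 2 ^ Suc n"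
  proof (rule dependent_nat_choice[where P="\<lambda>n z. \<eta> / 2 ^ (N * n) \<le> norm (E (r / 2 ^ n) z)"
      and Q="\<lambda>n z y. norm (y - z) \<le> D * r / 2 ^ Suc n"])
    show "\<exists>z. \<eta> / 2 ^ (N * 0) \<le> norm (E (r / 2 ^ 0) z)" by (auto simp: \<eta>_def)
    fix z n assume z: "\<eta> / 2 ^ (N * n) \<le> norm (E (r / 2 ^ n) z)"
    obtain s where s: "s \<in> spline_shifts" "norm (E (r / 2 ^ n) z) / 2 ^ N \<le> norm (E (r / 2 ^ n / 2) (z + (r / 2 ^ n / 2) *\<^sub>R spline_shift s))"
      using ex[of "r / 2 ^ n" z] r by auto
    have "\<eta> / 2 ^ (N * Suc n) = (\<eta> / 2 ^ (N * n)) / 2 ^ N" by (simp add: power_add)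
    also have "\<dots> \<le> norm (E (r / 2 ^ n) z) / 2 ^ N" using z by (rule divide_right_mono) simp
    also note s(2)
    finally have "\<eta> / 2 ^ (N * Suc n) \<le> norm (E (r / 2 ^ Suc n) (z + (r / 2 ^ Suc n) *\<^sub>R spline_shift s))" by (simp add: mult.commute)
    moreover have "norm ((r / 2 ^ Suc n) *\<^sub>R spline_shift s) \<le> D * r / 2 ^ Suc n"
      using mult_left_mono[OF norm_spline_shift[OF s(1)], of "r / 2 ^ Suc n"] r by (simp add: D_def mult.commute)
    ultimately show "\<exists>y. \<eta> / 2 ^ (N * Suc n) \<le> norm (E (r / 2 ^ Suc n) y) \<and> norm (y - z) \<le> D * r / 2 ^ Suc n"
      by (intro exI[of _ "z + (r / 2 ^ Suc n) *\<^sub>R spline_shift s"]) simp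
  qed
  then obtain X where X: "\<And>n. \<eta> / 2 ^ (N * n) \<le> norm (E (r / 2 ^ n) (X n))" "\<And>n. norm (X (Suc n) - X n) \<le> D * r / 2 ^ Suc n"
    by blast
  \<comment> \<open>The rate keeps \<open>l\<close> within \<open>D * r / 2 ^ n\<close> of the n-th
    centre, which is also the range of the n-th kernel, so the expansion at \<open>l\<close> is
    accurate on the whole support of that kernel.\<close>
  obtain l where l: "\<And>n. norm (X n - l) \<le> D * r / 2 ^ n" using geometric_Cauchy[OF X(2)] by blast
  obtain C where C: "C > 0" "\<And>y (b::'a). b \<in> Basis \<Longrightarrow> \<bar>spline_kernel' y b\<bar> \<le> C" using spline_kernel'_bounded by blast
  define a where "a = (\<Sum>b\<in>Basis. onorm (A b))"
  have a0: "a \<ge> 0" unfolding a_def by (intro sum_nonneg onorm_pos_le A)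
  define c where "c = a * C * 2 * D * (unit_ball_vol (real N) * D ^ N) * r ^ N"
  have c0: "c \<ge> 0" using a0 C D r by (simp add: c_def unit_ball_vol_nonneg)
  define L where "L y = F l + F' l (y - l)" for y
  define R where "R y = F y - L y" for y
  have lin: "bounded_linear (F' l)" using F has_derivative_bounded_linear by blast
  have dL: "(L has_derivative F' l) (at y)" for y
    unfolding L_def[abs_def] by (auto intro!: derivative_eq_intros bounded_linear.has_derivative[OF lin] simp: linear_simps[OF lin])
  have cL: "continuous_on UNIV L" using dL by (intro has_derivative_continuous_on)
  have cR: "continuous_on UNIV R" unfolding R_def[abs_def] by (intro continuous_intros cF cL)
  have "\<eta> \<le> c * \<epsilon>" if \<epsilon>: "\<epsilon> > 0" for \<epsilon>
  proof -
    obtain d where d: "d > 0" "\<And>y. norm (y - l) < d \<Longrightarrow> norm (F y - F l - F' l (y - l)) \<le> \<epsilon> * norm (y - l)"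
      using F[of l] \<epsilon> unfolding has_derivative_at_alt by blast
    have "(\<lambda>n. 2 * D * r / 2 ^ n) \<longlonglongrightarrow> 0"
      using tendsto_mult_right_zero[OF LIMSEQ_power_zero[of "1/2::real"], of "2 * D * r"] by (simp add: power_divide)
    then obtain n where n: "2 * D * r / 2 ^ n < d"
      using order_tendstoD(2) d(1) by (metis eventually_sequentially order_refl)
    define \<rho> where "\<rho> = r / 2 ^ n"
    have \<rho>: "\<rho> > 0" using r by (simp add: \<rho>_def)
    have nl: "norm (X n + y - l) \<le> 2 * D * \<rho>" if "norm y \<le> D * \<rho>" for y
    proof -
      have "norm (X n + y - l) \<le> norm (X n - l) + norm y" using norm_triangle_ineq[of "X n - l" y] by (simp add: algebra_simps)
      also have "\<dots> \<le> D * \<rho> + D * \<rho>" using l[of n] that by (intro add_mono) (simp_all add: \<rho>_def)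
      finally show ?thesis by simp
    qed
    have small: "norm (R (X n + y)) \<le> \<epsilon> * (2 * D * \<rho>)" if "norm y \<le> D * \<rho>" for y
    proof -
      have "norm (X n + y - l) < d" using nl[OF that] n by (simp add: \<rho>_def)
      then have "norm (R (X n + y)) \<le> \<epsilon> * norm (X n + y - l)"
        using d(2)[of "X n + y"] by (simp add: R_def L_def algebra_simps)
      also have "\<dots> \<le> \<epsilon> * (2 * D * \<rho>)" using nl[OF that] \<epsilon> by (intro mult_left_mono) auto
      finally show ?thesis .
    qed
    \<comment> \<open>Integration by parts moves the derivative from the kernel to the affine
      function, whose derivative is the constant \<open>F' l\<close>; the sum becomes a multiple of
      the system at \<open>l\<close>.\<close>
    have "(\<Sum>b\<in>Basis. A b (conv (\<lambda>y. spl' \<rho> y b) L (X n))) = 0"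
    proof -
      have "- conv (\<lambda>y. spl' \<rho> y v) L (X n) = conv (spl \<rho>) (\<lambda>_. F' l v) (X n)" for v
        using has_derivative_unique[OF conv_has_derivative_left[where x="X n", OF spl_derivative continuous_on_spl' spl_zero[OF \<rho>] cL]
           conv_has_derivative_right[where x="X n", OF continuous_on_spl spl_zero[OF \<rho>] dL continuous_on_const]]
        by (rule fun_cong)
      moreover have "conv (spl \<rho>) (\<lambda>_. F' l v) (X n) = (\<integral>y. spl \<rho> y \<partial>(lborel :: 'a measure)) *\<^sub>R F' l v" for v
      proof -
        have "spl \<rho> y = 0" if "D * \<rho> < norm y" for y :: 'a using that by (intro spl_zero \<rho>) (simp add: D_def)
        then have "integrable lborel (\<lambda>y::'a. spl \<rho> y *\<^sub>R (1::real))"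
          by (intro integrable_kernel[of _ "D * \<rho>"] continuous_on_spl continuous_on_const)
        then
        show ?thesis unfolding conv_def by (intro integral_scaleR_left) auto
      qed
      ultimately have *: "conv (\<lambda>y. spl' \<rho> y v) L (X n) = - (\<integral>y. spl \<rho> y \<partial>(lborel :: 'a measure)) *\<^sub>R F' l v" for v
        by (metis minus_minus scaleR_minus_left)
      have "(\<Sum>b\<in>Basis. A b (conv (\<lambda>y. spl' \<rho> y b) L (X n))) = - (\<integral>y. spl \<rho> y \<partial>(lborel :: 'a measure)) *\<^sub>R (\<Sum>b\<in>Basis. A b (F' l b))"
      proof (unfold scaleR_sum_right, intro sum.cong refl)
        fix b :: 'a assume b: "b \<in> Basis"
        show "A b (conv (\<lambda>y. spl' \<rho> y b) L (X n)) = - (\<integral>y. spl \<rho> y \<partial>(lborel :: 'a measure)) *\<^sub>R A b (F' l b)"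
          by (simp only: * linear_cmul[OF bounded_linear.linear[OF A[OF b]]])
      qed
      then show ?thesis by (simp add: eq)
    qed
    moreover have "conv (\<lambda>y. spl' \<rho> y b) F (X n) = conv (\<lambda>y. spl' \<rho> y b) L (X n) + conv (\<lambda>y. spl' \<rho> y b) R (X n)" for b
      using conv_add[where x="X n", OF continuous_on_spl' z'[OF \<rho>] cL cR] by (simp add: R_def)
    ultimately have "E \<rho> (X n) = (\<Sum>b\<in>Basis. A b (conv (\<lambda>y. spl' \<rho> y b) R (X n)))"
      unfolding E_def using A by (simp add: linear_add[OF bounded_linear.linear] sum.distrib)
    also have "norm \<dots> \<le> (\<Sum>b\<in>Basis. onorm (A b) * (C / \<rho> * (\<epsilon> * (2 * D * \<rho>)) * measure lborel (cball (0::'a) (D * \<rho>))))"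
    proof (rule sum_norm_le)
      fix b :: 'a assume b: "b \<in> Basis"
      have "norm (conv (\<lambda>y. spl' \<rho> y b) R (X n)) \<le> C / \<rho> * (\<epsilon> * (2 * D * \<rho>)) * measure lborel (cball (0::'a) (D * \<rho>))"
      proof (rule conv_norm_le[OF continuous_on_spl' z'[OF \<rho>] _ cR small])
        show "\<bar>spl' \<rho> y b\<bar> \<le> C / \<rho>" for y using C(2)[OF b] \<rho> by (simp add: spl'_def divide_right_mono)
      qed (use \<epsilon> D \<rho> in auto)
      then show "norm (A b (conv (\<lambda>y. spl' \<rho> y b) R (X n))) \<le> onorm (A b) * (C / \<rho> * (\<epsilon> * (2 * D * \<rho>)) * measure lborel (cball (0::'a) (D * \<rho>)))"
        using onorm[OF A[OF b]] onorm_pos_le[OF A[OF b]] by (meson mult_left_mono order_trans)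
    qed
    also have "\<dots> = a * (C / \<rho> * (\<epsilon> * (2 * D * \<rho>)) * (unit_ball_vol (real N) * (D * \<rho>) ^ N))"
      using D \<rho> by (simp add: content_cball a_def sum_distrib_right N_def)
    also have "\<dots> = (c * \<epsilon>) / 2 ^ (N * n)"
      using \<rho> by (simp add: c_def power_mult_distrib) (simp add: \<rho>_def power_divide power_mult[symmetric] mult.commute)
    finally have "norm (E \<rho> (X n)) \<le> (c * \<epsilon>) / 2 ^ (N * n)" .
    with X(1)[of n] have "\<eta> / 2 ^ (N * n) \<le> (c * \<epsilon>) / 2 ^ (N * n)" by (simp add: \<rho>_def)
    then show ?thesis by (simp add: divide_le_cancel)
  qed
  \<comment> \<open>This choice of \<open>\<epsilon>\<close> pushes the bound below
    \<open>\<eta>\<close>; the added 1 covers \<open>c = 0\<close>.\<close>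
  from this[of "\<eta> / (2 * (c + 1))"] have "\<eta> \<le> c * (\<eta> / (2 * (c + 1)))" using \<eta> c0 by simp
  also have "\<dots> < \<eta>" using \<eta> c0 by (simp add: field_simps) (smt (verit) mult_nonneg_nonneg)
  finally show False by simp
qed

section \<open>Mean values and Cauchy estimates\<close>

text \<open>Used for the derivative of a smoothed solution, an average against \<open>spl'\<close>.
  That kernel is continuous but not differentiable, so continuity of the average has to come from
  uniform continuity of \<open>F\<close>.\<close>

lemma continuous_on_conv:
  fixes F :: "'a::euclidean_space \<Rightarrow> 'b::euclidean_space"
  assumes k: "continuous_on UNIV k" "\<And>y. \<rho> < norm y \<Longrightarrow> k y = 0" and F: "continuous_on UNIV F"
  shows "continuous_on UNIV (conv k F)"
proof (rule continuous_at_imp_continuous_on, rule ballI)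
  fix x
  have "bounded (k ` cball 0 \<rho>)"
    using k(1) by (intro compact_imp_bounded compact_continuous_image) (auto intro: continuous_on_subset)
  then obtain C0 where C0: "\<And>y. norm y \<le> \<rho> \<Longrightarrow> \<bar>k y\<bar> \<le> C0" unfolding bounded_iff by fastforce
  define C where "C = max C0 1"
  have C: "\<bar>k y\<bar> \<le> C" "C > 0" for y
    using C0[of y] k(2)[of y] by (cases "norm y \<le> \<rho>"; force simp: C_def)+
  define V where "V = measure lborel (cball (0::'a) \<rho>) + 1"
  have V: "V > 0" by (auto simp: V_def intro!: add_nonneg_pos)
  show "isCont (conv k F) x"
    unfolding continuous_at_eps_delta
  proof (intro allI impI)
    fix e :: real assume e: "e > 0"
    have "uniformly_continuous_on (cball x (\<bar>\<rho>\<bar> + 1)) F"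
      using F by (intro compact_uniformly_continuous continuous_on_subset[OF F]) auto
    then obtain d where d: "d > 0" "\<And>z z'. z \<in> cball x (\<bar>\<rho>\<bar> + 1) \<Longrightarrow> z' \<in> cball x (\<bar>\<rho>\<bar> + 1) \<Longrightarrow> dist z' z < d \<Longrightarrow> dist (F z') (F z) < e / (2 * C * V)"
      unfolding uniformly_continuous_on_def using e C(2) V by (metis divide_pos_pos mult_pos_pos zero_less_numeral)
    show "\<exists>d>0. \<forall>x'. dist x' x < d \<longrightarrow> dist (conv k F x') (conv k F x) < e"
    proof (intro exI conjI allI impI)
      show "min d 1 > 0" using d by simp
      fix x' assume x': "dist x' x < min d 1"
      let ?G = "\<lambda>z. F (z + (x' - x)) - F z"
      have cG: "continuous_on UNIV (\<lambda>z. F (z + (x' - x)))"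
        by (intro continuous_on_compose2[OF F _ subset_UNIV] continuous_intros)
      have "conv k F x' = conv k (\<lambda>z. F (z + (x' - x))) x" by (simp add: conv_def algebra_simps)
      then have "conv k F x' - conv k F x = conv k ?G x"
        using conv_add[where x=x and G="\<lambda>z. - F z", OF k cG] F conv_bounded_linear[where x=x, OF bounded_linear_minus[OF bounded_linear_ident] k F]
        by (simp add: continuous_on_minus)
      moreover have "norm (conv k ?G x) \<le> C * (e / (2 * C * V)) * measure lborel (cball (0::'a) \<rho>)"
      proof (rule conv_norm_le[OF k C(1)])
        fix y :: 'a assume y: "norm y \<le> \<rho>"
        have "dist x (x' + y) \<le> norm (x' - x) + norm y"
          using norm_triangle_ineq[of "x' - x" y] by (simp add: dist_norm norm_minus_commute algebra_simps)
        then have "x' + y \<in> cball x (\<bar>\<rho>\<bar> + 1)" using x' y by (auto simp: dist_norm)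
        moreover have "x + y \<in> cball x (\<bar>\<rho>\<bar> + 1)" using y by (simp add: dist_norm)
        moreover have "dist (x' + y) (x + y) < d" using x' by (simp add: dist_norm)
        ultimately show "norm (?G (x + y)) \<le> e / (2 * C * V)"
          using d(2)[of "x + y" "x' + y"] by (simp add: dist_norm algebra_simps)
      qed (use cG F e C(2) V in \<open>auto intro!: continuous_intros\<close>)
      moreover have "C * (e / (2 * C * V)) * measure lborel (cball (0::'a) \<rho>) < e"
      proof -
        have "C * (e / (2 * C * V)) * measure lborel (cball (0::'a) \<rho>) \<le> C * (e / (2 * C * V)) * V"
          using e C(2) V by (intro mult_left_mono) (auto simp: V_def)
        also have "\<dots> = e / 2" using C(2) V by simp
        finally show ?thesis using e by simp
      qed
      ultimately show "dist (conv k F x') (conv k F x) < e" by (simp add: dist_norm)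
    qed
  qed
qed

lemma integral_pos_continuous:
  fixes f :: "'a::euclidean_space \<Rightarrow> real"
  assumes "continuous_on UNIV f" "integrable lborel f" "\<And>x. 0 \<le> f x" "0 < f x0"
  shows "0 < (\<integral>x. f x \<partial>lborel)"
proof -
  have "isCont f x0" using assms(1) by (simp add: continuous_on_eq_continuous_at)
  then obtain d where d: "d > 0" "\<And>x. dist x x0 < d \<Longrightarrow> dist (f x) (f x0) < f x0 / 2"
    unfolding continuous_at_eps_delta using assms(4) by (metis half_gt_zero)
  have fin: "emeasure lborel (ball x0 d) < \<infinity>" by (rule emeasure_lborel_ball_finite)
  have "0 < f x0 / 2 * measure lborel (ball x0 d)"
    using assms(4) d by (simp add: content_ball_pos)
  also have "\<dots> = (\<integral>x. f x0 / 2 * indicator (ball x0 d) x \<partial>lborel)" by simp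
  also have "\<dots> \<le> (\<integral>x. f x \<partial>lborel)"
  proof (rule integral_mono)
    show "integrable lborel (\<lambda>x. f x0 / 2 * indicator (ball x0 d) x)"
      using fin by (intro integrable_mult_right integrable_real_indicator) simp_all
    show "f x0 / 2 * indicator (ball x0 d) x \<le> f x" for x
      using d(2)[of x] assms(3)[of x] by (cases "x \<in> ball x0 d") (auto simp: dist_real_def dist_commute abs_if split: if_splits)
  qed fact
  finally show ?thesis .
qed

text \<open>The factor \<open>\<kappa>\<close> is the mass of the unnormalised kernel. Uniformity on
  the unit ball around \<open>x\<close> is what allows the approximation to be inserted into an
  average against \<open>bump 3\<close>.\<close>

lemma spl_approx:
  fixes F :: "'a::euclidean_space \<Rightarrow> 'b::euclidean_space"
  assumes F: "continuous_on UNIV F" and "\<epsilon> > 0"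
  obtains r \<kappa> where "r > 0" "\<kappa> > 0" "\<And>z. z \<in> cball x 1 \<Longrightarrow> norm (conv (spl r) F z - \<kappa> *\<^sub>R F z) \<le> \<epsilon> * \<kappa>"
proof -
  have "uniformly_continuous_on (cball x 2) F"
    using F by (intro compact_uniformly_continuous continuous_on_subset[OF F]) auto
  then obtain d where d: "d > 0" "\<And>z z'. z \<in> cball x 2 \<Longrightarrow> z' \<in> cball x 2 \<Longrightarrow> dist z' z < d \<Longrightarrow> dist (F z') (F z) < \<epsilon>"
    unfolding uniformly_continuous_on_def using assms(2) by metis
  define N where "N = 3 * real DIM('a)"
  have N: "N > 0" by (simp add: N_def)
  define r where "r = min d 1 / (2 * N)"
  have r: "r > 0" "N * r < d" "N * r < 1" using d N by (auto simp: r_def min_def field_simps)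
  define \<kappa> where "\<kappa> = (\<integral>y. spl r y \<partial>(lborel :: 'a measure))"
  have z: "spl r y = 0" if "N * r < norm y" for y :: 'a using that r by (intro spl_zero) (auto simp: N_def)
  have int: "integrable lborel (spl r :: 'a \<Rightarrow> real)"
    using integrable_kernel[OF continuous_on_spl z continuous_on_const[of UNIV "1::real"]] by simp
  \<comment> \<open>A point where the kernel is positive, all rescaled coordinates being at the knot
    1; it makes the mass positive.\<close>
  have "spl r (r *\<^sub>R One :: 'a) = 1"
    using r by (simp add: spl_def spline_kernel_def spline_def ppow_def)
  then have \<kappa>: "\<kappa> > 0" unfolding \<kappa>_def
    by (intro integral_pos_continuous[of _ "r *\<^sub>R One"] continuous_on_spl int spl_nonneg) simp
  have "norm (conv (spl r) F w - \<kappa> *\<^sub>R F w) \<le> \<epsilon> * \<kappa>" if w: "w \<in> cball x 1" for w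
  proof -
    have i1: "integrable lborel (\<lambda>y. spl r y *\<^sub>R F (w + y))" by (rule integrable_conv[OF continuous_on_spl z F])
    have i2: "integrable lborel (\<lambda>y::'a. spl r y *\<^sub>R F w)" by (rule integrable_kernel[OF continuous_on_spl _ continuous_on_const, of "N * r"]) (rule z)
    have "conv (spl r) F w - \<kappa> *\<^sub>R F w = (\<integral>y. spl r y *\<^sub>R F (w + y) - spl r y *\<^sub>R F w \<partial>lborel)"
      unfolding conv_def \<kappa>_def using i1 i2 int by simp
    also have "norm \<dots> \<le> (\<integral>y. norm (spl r y *\<^sub>R F (w + y) - spl r y *\<^sub>R F w) \<partial>lborel)" by (rule integral_norm_bound)
    also have "\<dots> \<le> (\<integral>y. \<epsilon> * spl r y \<partial>(lborel :: 'a measure))"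
    proof (rule integral_mono)
      show "integrable lborel (\<lambda>y. norm (spl r y *\<^sub>R F (w + y) - spl r y *\<^sub>R F w))" using i1 i2 by auto
      show "integrable lborel (\<lambda>y::'a. \<epsilon> * spl r y)" using int by simp
      fix y :: 'a
      show "norm (spl r y *\<^sub>R F (w + y) - spl r y *\<^sub>R F w) \<le> \<epsilon> * spl r y"
      proof (cases "N * r < norm y")
        case False
        then have y: "norm y < 1" "norm y < d" using r by auto
        have "dist x (w + y) \<le> dist x w + norm y" using dist_triangle[of x "w + y" w] by (simp add: dist_norm)
        then have "dist (F (w + y)) (F w) < \<epsilon>" using w y by (intro d) (auto simp: dist_norm)
        then have "norm (F (w + y) - F w) \<le> \<epsilon>" by (simp add: dist_norm)
        then show ?thesis using spl_nonneg[of r y]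
          by (simp add: scaleR_diff_right[symmetric] mult.commute[of \<epsilon>] mult_left_mono)
      qed (simp add: z)
    qed
    also have "\<dots> = \<epsilon> * \<kappa>" by (simp add: \<kappa>_def)
    finally show ?thesis .
  qed
  then show thesis using r \<kappa> that by blast
qed

text \<open>A power of the truncated \<open>1 - |y|^2\<close>. As a radial function it has a
  gradient parallel to \<open>y\<close>; exponent 3 makes it twice continuously differentiable,
  enough to differentiate the mean value formula twice.\<close>

definition bump :: "nat \<Rightarrow> 'a::real_inner \<Rightarrow> real" where
  "bump n y = ppow n (1 - y \<bullet> y)"

lemma bump_zero: "1 < norm y \<Longrightarrow> bump (Suc n) y = 0"
  unfolding bump_def using one_less_power[of "norm y" 2] by (intro ppow_nonpos) (simp add: dot_square_norm)

lemma continuous_on_bump: "continuous_on S (bump n)"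
  unfolding bump_def[abs_def] by (intro continuous_on_compose2[OF continuous_on_ppow _ subset_UNIV] continuous_intros)

lemma bump_nonneg: "0 \<le> bump n y"
  by (simp add: bump_def ppow_nonneg)

lemma bump_le_1: "bump n y \<le> 1"
  unfolding bump_def ppow_def by (intro power_le_one) auto

lemma bump_derivative:
  "(bump (Suc (Suc n)) has_derivative (\<lambda>v. - 2 * real (Suc (Suc n)) * bump (Suc n) y * (y \<bullet> v))) (at y)"
proof -
  have "((\<lambda>y. 1 - y \<bullet> y) has_derivative (\<lambda>v. - 2 * (y \<bullet> v))) (at y)"
    by (auto intro!: derivative_eq_intros simp: inner_commute)
  from has_derivative_compose[OF this has_real_derivative_ppow[unfolded has_field_derivative_def]]
  show ?thesis by (simp add: bump_def[abs_def] algebra_simps)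
qed

text \<open>\<open>A\<close> holds the coefficients of a first order operator and \<open>B\<close>
  those of its conjugate; \<open>BA\<close> says that the composite of the two is the Laplacian. The
  locale is used on \<open>real \<times> (real ^ 'n)\<close> for monogenic functions and on the
  plane for each slice.\<close>

locale elliptic_system =
  fixes A B :: "'a::euclidean_space \<Rightarrow> 'c::euclidean_space \<Rightarrow> 'c"
  assumes A: "b \<in> Basis \<Longrightarrow> bounded_linear (A b)"
    and B: "b \<in> Basis \<Longrightarrow> bounded_linear (B b)"
    and BA: "b \<in> Basis \<Longrightarrow> c \<in> Basis \<Longrightarrow> B b (A c u) + B c (A b u) = (if b = c then 2 *\<^sub>R u else 0)"
begin

text \<open>With \<open>I\<close> the Hessian of a solution this is harmonicity. Stated for an
  arbitrary symmetric matrix it also applies to the first moments in \<open>mean_value_C1\<close>,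
  where only first derivatives exist. Applying \<open>B\<close> to the rows and adding the
  transposed sum leaves twice the trace.\<close>

lemma contraction_zero:
  assumes sym: "\<And>b c. b \<in> Basis \<Longrightarrow> c \<in> Basis \<Longrightarrow> I b c = I c b"
    and zero: "\<And>b. b \<in> Basis \<Longrightarrow> (\<Sum>c\<in>Basis. A c (I b c)) = 0"
  shows "(\<Sum>b\<in>Basis. I b b) = 0"
proof -
  have "(\<Sum>b\<in>Basis. \<Sum>c\<in>Basis. B b (A c (I b c))) = (\<Sum>b\<in>Basis. B b (\<Sum>c\<in>Basis. A c (I b c)))"
    by (intro sum.cong refl linear_sum[symmetric] bounded_linear.linear B)
  also have "\<dots> = (\<Sum>b\<in>Basis. B b 0)" by (simp add: zero)
  also have "\<dots> = 0" using linear_0[OF bounded_linear.linear[OF B]] by simp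
  finally have 1: "(\<Sum>b\<in>Basis. \<Sum>c\<in>Basis. B b (A c (I b c))) = 0" .
  then have 2: "(\<Sum>b\<in>Basis. \<Sum>c\<in>Basis. B c (A b (I b c))) = 0"
    by (subst sum.swap) (simp add: sym)
  have "2 *\<^sub>R (\<Sum>b\<in>Basis. I b b) = (\<Sum>b\<in>Basis. \<Sum>c\<in>Basis. if b = c then 2 *\<^sub>R I b c else 0)"
    by (simp add: scaleR_sum_right)
  also have "\<dots> = (\<Sum>b\<in>Basis. \<Sum>c\<in>Basis. B b (A c (I b c)) + B c (A b (I b c)))"
    by (intro sum.cong refl BA[symmetric])
  also have "\<dots> = 0" by (simp only: sum.distrib 1 2 add_0)
  finally show ?thesis by simp
qed

text \<open>The average over a ball of radius \<open>r\<close> has as derivative in \<open>r\<close>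
  the trace of the moments \<open>I r b c\<close> of \<open>V'\<close>. As the kernel is radial,
  integration by parts shows this matrix to be symmetric, and the system annihilates its rows; so
  the trace vanishes and the average keeps its value at \<open>r = 0\<close>.\<close>

lemma mean_value_C1:
  fixes V :: "'a \<Rightarrow> 'c"
  assumes V: "\<And>x. (V has_derivative V' x) (at x)" and V': "\<And>v. continuous_on UNIV (\<lambda>x. V' x v)"
    and eq: "\<And>x. (\<Sum>b\<in>Basis. A b (V' x b)) = 0"
  shows "conv (bump 3) V x = (\<integral>y. bump 3 y \<partial>(lborel::'a measure)) *\<^sub>R V x"
proof -
  have cV: "continuous_on UNIV V" using V by (intro has_derivative_continuous_on)
  have b0: "bump 3 y = 0" "bump 2 y = 0" if "1 < norm y" for y :: 'a
    using bump_zero[OF that, of 2] bump_zero[OF that, of 1] by (simp_all add: eval_nat_numeral)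
  define m where "m r = (\<integral>y. bump 3 y *\<^sub>R V (x + r *\<^sub>R y) \<partial>lborel)" for r
  define I where "I r b c = (\<integral>y. (bump 3 y * (y \<bullet> b)) *\<^sub>R V' (x + r *\<^sub>R y) c \<partial>lborel)" for r b c
  have dm: "(m has_vector_derivative (\<Sum>b\<in>Basis. I r b b)) (at r)" for r
    unfolding m_def[abs_def] I_def by (rule scaled_kernel_has_derivative[OF continuous_on_bump b0(1) V V'])
  \<comment> \<open>Integration by parts divides by \<open>r\<close>. The value at 0 is still
    reached, since the mean value theorem on the unit interval has a positive intermediate
    point.\<close>
  have sumI: "(\<Sum>b\<in>Basis. I r b b) = 0" if r: "r \<noteq> 0" for r
  proof (rule contraction_zero[of "I r"])
    define k' where "k' b y c = -6 * bump 2 y * (y \<bullet> c) * (y \<bullet> b) + bump 3 y * (c \<bullet> b)" for b y c :: 'a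
    define W where "W y = V (x + r *\<^sub>R y)" for y
    define W' where "W' y v = r *\<^sub>R V' (x + r *\<^sub>R y) v" for y v
    have lin: "linear (V' y)" for y using V has_derivative_linear by blast
    have dW: "(W has_derivative W' y) (at y)" for y
    proof -
      have "((\<lambda>y. x + r *\<^sub>R y) has_derivative (\<lambda>v. r *\<^sub>R v)) (at y)" by (auto intro!: derivative_eq_intros)
      from has_derivative_compose[OF this V] show ?thesis
        by (simp add: W_def[abs_def] W'_def[abs_def] linear_cmul[OF lin])
    qed
    have cW': "continuous_on UNIV (\<lambda>y. W' y v)" for v
      unfolding W'_def by (intro continuous_intros continuous_on_compose2[OF V' _ subset_UNIV])
    have cW: "continuous_on UNIV W" using dW by (intro has_derivative_continuous_on)
    have dk: "((\<lambda>y. bump 3 y * (y \<bullet> b)) has_derivative k' b y) (at y)" for b y :: 'a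
    proof -
      have "((\<lambda>y. y \<bullet> b) has_derivative (\<lambda>v. v \<bullet> b)) (at y)" by (auto intro!: derivative_eq_intros)
      moreover have "(bump 3 has_derivative (\<lambda>v. -6 * bump 2 y * (y \<bullet> v))) (at y)"
        using bump_derivative[of 1 y] by (simp add: eval_nat_numeral)
      ultimately have "((\<lambda>y. bump 3 y * (y \<bullet> b)) has_derivative (\<lambda>h. bump 3 y * (h \<bullet> b) + -6 * bump 2 y * (y \<bullet> h) * (y \<bullet> b))) (at y)"
        by (intro has_derivative_mult)
      then show ?thesis by (simp add: k'_def[abs_def] algebra_simps)
    qed
    have ck': "continuous_on UNIV (\<lambda>y. k' b y v)" for b v
      unfolding k'_def by (intro continuous_intros continuous_on_bump)
    have k0: "bump 3 y * (y \<bullet> b) = 0" if "1 < norm y" for y b :: 'a using b0[OF that] by simp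
    have ck: "continuous_on UNIV (\<lambda>y. bump 3 y * (y \<bullet> b))" for b :: 'a by (intro continuous_intros continuous_on_bump)
    have parts: "r *\<^sub>R I r b c = - conv (\<lambda>y. k' b y c) W 0" for b c
    proof -
      have "- conv (\<lambda>y. k' b y c) W 0 = conv (\<lambda>y. bump 3 y * (y \<bullet> b)) (\<lambda>x. W' x c) 0"
        using has_derivative_unique[OF conv_has_derivative_left[where x=0, OF dk ck' k0 cW]
           conv_has_derivative_right[where x=0, OF ck k0 dW cW']] by (rule fun_cong)
      also have "\<dots> = r *\<^sub>R I r b c"
        unfolding conv_def W'_def I_def by (subst Bochner_Integration.integral_scaleR_right[symmetric]) (simp add: mult.commute)
      finally show ?thesis by simp
    qed
    fix b c :: 'a assume "b \<in> Basis" "c \<in> Basis"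
    \<comment> \<open>The gradient of the kernel is parallel to \<open>y\<close>, which makes the
      derivative of \<open>bump 3 y * (y \<bullet> b)\<close> in direction \<open>c\<close>
      symmetric in \<open>b\<close> and \<open>c\<close>.\<close>
    have "k' b y c = k' c y b" for y by (simp add: k'_def inner_commute)
    then have "r *\<^sub>R I r b c = r *\<^sub>R I r c b" unfolding parts by simp
    then show "I r b c = I r c b" using r by simp
  next
    fix b :: 'a assume b: "b \<in> Basis"
    have int: "integrable lborel (\<lambda>y. (bump 3 y * (y \<bullet> b)) *\<^sub>R V' (x + r *\<^sub>R y) c)" for c
      using b0(1) by (intro integrable_kernel[of _ 1] continuous_intros continuous_on_bump continuous_on_compose2[OF V' _ subset_UNIV]) auto
    have "(\<Sum>c\<in>Basis. A c (I r b c)) = (\<Sum>c\<in>Basis. \<integral>y. A c ((bump 3 y * (y \<bullet> b)) *\<^sub>R V' (x + r *\<^sub>R y) c) \<partial>lborel)"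
      unfolding I_def by (intro sum.cong refl integral_bounded_linear[symmetric] A int)
    also have "\<dots> = (\<integral>y. (\<Sum>c\<in>Basis. A c ((bump 3 y * (y \<bullet> b)) *\<^sub>R V' (x + r *\<^sub>R y) c)) \<partial>lborel)"
      by (intro Bochner_Integration.integral_sum[symmetric] integrable_bounded_linear[OF A] int)
    also have "\<dots> = (\<integral>y. (bump 3 y * (y \<bullet> b)) *\<^sub>R (\<Sum>c\<in>Basis. A c (V' (x + r *\<^sub>R y) c)) \<partial>lborel)"
      by (simp only: scaleR_sum_right linear_cmul[OF bounded_linear.linear[OF A]] cong: sum.cong)
    also have "\<dots> = 0" by (simp only: eq) simp
    finally show "(\<Sum>c\<in>Basis. A c (I r b c)) = 0" .
  qed
  have "\<exists>t\<in>{0<..<1}. norm (m 1 - m 0) \<le> norm ((1 - 0) *\<^sub>R (\<Sum>b\<in>Basis. I t b b))"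
  proof (rule mvt_general)
    show "continuous_on {0..1} m"
      by (intro continuous_at_imp_continuous_on ballI has_vector_derivative_continuous[OF dm])
    show "(m has_derivative (\<lambda>h. h *\<^sub>R (\<Sum>b\<in>Basis. I t b b))) (at t)" for t
      using dm[of t] by (simp add: has_vector_derivative_def)
  qed simp
  then obtain t :: real where "0 < t" "norm (m 1 - m 0) \<le> norm (\<Sum>b\<in>Basis. I t b b)" by auto
  then have "m 1 = m 0" using sumI[of t] by simp
  moreover have "m 0 = (\<integral>y. bump 3 y \<partial>(lborel::'a measure)) *\<^sub>R V x"
    using integrable_kernel[where F="\<lambda>_. 1::real" and k="bump 3 :: 'a \<Rightarrow> real", OF continuous_on_bump b0(1) continuous_on_const]
    by (simp add: m_def)
  ultimately show ?thesis by (simp add: m_def conv_def)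
qed


definition sol :: "('a \<Rightarrow> 'c) \<Rightarrow> bool" where
  "sol F \<longleftrightarrow> (\<forall>x. F differentiable (at x)) \<and> (\<forall>x. (\<Sum>b\<in>Basis. A b (frechet_derivative F (at x) b)) = 0)"

lemma sol_derivative: "sol F \<Longrightarrow> (F has_derivative frechet_derivative F (at x)) (at x)"
  by (simp add: sol_def frechet_derivative_works[symmetric])

lemma sol_eq: "sol F \<Longrightarrow> (\<Sum>b\<in>Basis. A b (frechet_derivative F (at x) b)) = 0"
  by (simp add: sol_def)

lemma solI:
  assumes "\<And>x. (F has_derivative F' x) (at x)" "\<And>x. (\<Sum>b\<in>Basis. A b (F' x b)) = 0"
  shows "sol F"
  unfolding sol_def using assms by (auto simp: differentiable_def frechet_derivative_at[OF assms(1), symmetric])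

lemma sol_continuous: "sol F \<Longrightarrow> continuous_on UNIV F"
  using sol_derivative by (intro has_derivative_continuous_on) auto

definition bump_mass :: real where
  "bump_mass = (\<integral>y. bump 3 y \<partial>(lborel :: 'a measure))"

lemma bump3_zero: "1 < norm y \<Longrightarrow> bump 3 y = 0"
  using bump_zero[of y 2] by (simp add: eval_nat_numeral)

lemma bump_mass_pos: "0 < bump_mass"
proof -
  have "integrable lborel (bump 3 :: 'a \<Rightarrow> real)"
    using integrable_kernel[where k="bump 3 :: 'a \<Rightarrow> real" and F="\<lambda>_. 1::real", OF continuous_on_bump bump3_zero continuous_on_const] by simp
  moreover have "bump 3 (0::'a) = 1" by (simp add: bump_def ppow_def)
  ultimately show ?thesis unfolding bump_mass_def
    by (intro integral_pos_continuous[of _ 0] continuous_on_bump bump_nonneg) simp_all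
qed

text \<open>A solution is only known to be differentiable. By \<open>goursat\<close> its average
  against \<open>spl r\<close> is a continuously differentiable solution, to which
  \<open>mean_value_C1\<close> applies; divided by \<open>\<kappa>\<close> these averages approach
  \<open>F\<close> uniformly on the unit ball around \<open>x\<close>.\<close>

theorem mean_value:
  assumes F: "sol F"
  shows "conv (bump 3) F x = bump_mass *\<^sub>R F x"
proof -
  note cF = sol_continuous[OF F]
  define V where "V = measure lborel (cball (0::'a) 1)"
  have "norm (conv (bump 3) F x - bump_mass *\<^sub>R F x) \<le> \<epsilon> * (V + bump_mass)" if \<epsilon>: "\<epsilon> > 0" for \<epsilon>
  proof -
    obtain r \<kappa> where r: "r > 0" "\<kappa> > 0" and app: "\<And>z. z \<in> cball x 1 \<Longrightarrow> norm (conv (spl r) F z - \<kappa> *\<^sub>R F z) \<le> \<epsilon> * \<kappa>"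
      using spl_approx[OF cF \<epsilon>] by blast
    have z': "spl' r y v = 0" if "3 * real DIM('a) * r < norm y" for y v :: 'a
      using derivative_zero_outside[of _ "spl r", OF spl_zero[OF r(1)] spl_derivative that] by blast
    have dV: "(conv (spl r) F has_derivative (\<lambda>v. - conv (\<lambda>y. spl' r y v) F z)) (at z)" for z
      by (rule conv_has_derivative_left[OF spl_derivative continuous_on_spl' spl_zero[OF r(1)] cF])
    have cV: "continuous_on UNIV (conv (spl r) F)" using dV by (intro has_derivative_continuous_on)
    have mv: "conv (bump 3) (conv (spl r) F) x = bump_mass *\<^sub>R conv (spl r) F x"
      unfolding bump_mass_def
    proof (rule mean_value_C1[OF dV])
      show "continuous_on UNIV (\<lambda>x. - conv (\<lambda>y. spl' r y v) F x)" for v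
        by (intro continuous_intros continuous_on_conv[OF continuous_on_spl' z' cF])
      show "(\<Sum>b\<in>Basis. A b (- conv (\<lambda>y. spl' r y b) F z)) = 0" for z
      proof -
        have "(\<Sum>b\<in>Basis. A b (- conv (\<lambda>y. spl' r y b) F z)) = - (\<Sum>b\<in>Basis. A b (conv (\<lambda>y. spl' r y b) F z))"
          using linear_neg[OF bounded_linear.linear[OF A]] by (simp add: sum_negf)
        then show ?thesis using goursat[OF A sol_derivative[OF F] sol_eq[OF F] r(1)] by simp
      qed
    qed
    let ?G = "\<lambda>z. conv (spl r) F z - \<kappa> *\<^sub>R F z"
    have cG: "continuous_on UNIV ?G" by (intro continuous_intros cV cF)
    have "conv (bump 3) (conv (spl r) F) x = conv (bump 3) ?G x + \<kappa> *\<^sub>R conv (bump 3) F x"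
      using conv_add[where x=x, OF continuous_on_bump bump3_zero cG continuous_on_scaleR[OF continuous_on_const[of _ \<kappa>] cF]]
        conv_bounded_linear[where x=x, OF bounded_linear_scaleR_right[of \<kappa>] continuous_on_bump bump3_zero cF] by simp
    then have e: "\<kappa> *\<^sub>R (conv (bump 3) F x - bump_mass *\<^sub>R F x) = bump_mass *\<^sub>R ?G x - conv (bump 3) ?G x"
      using mv by (simp add: algebra_simps)
    have "norm (conv (bump 3) ?G x) \<le> 1 * (\<epsilon> * \<kappa>) * V"
      unfolding V_def
    proof (rule conv_norm_le[OF continuous_on_bump bump3_zero _ cG])
      show "norm (conv (spl r) F (x + y) - \<kappa> *\<^sub>R F (x + y)) \<le> \<epsilon> * \<kappa>" if "norm y \<le> 1" for y
        using that by (intro app) (simp add: dist_norm)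
    qed (use \<epsilon> r in \<open>auto simp: abs_of_nonneg bump_nonneg bump_le_1\<close>)
    moreover have "norm (bump_mass *\<^sub>R ?G x) \<le> bump_mass * (\<epsilon> * \<kappa>)"
      using app[of x] bump_mass_pos by simp
    ultimately have "norm (\<kappa> *\<^sub>R (conv (bump 3) F x - bump_mass *\<^sub>R F x)) \<le> bump_mass * (\<epsilon> * \<kappa>) + 1 * (\<epsilon> * \<kappa>) * V"
      unfolding e by (meson add_mono norm_triangle_ineq4 order_trans)
    then have "\<kappa> * norm (conv (bump 3) F x - bump_mass *\<^sub>R F x) \<le> \<kappa> * (\<epsilon> * (V + bump_mass))"
      unfolding norm_scaleR using r by (simp add: algebra_simps)
    then show ?thesis using r by (simp add: mult_le_cancel_left)
  qed
  note * = this
  have V: "V + bump_mass > 0" using bump_mass_pos by (simp add: V_def add_nonneg_pos)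
  have "norm (conv (bump 3) F x - bump_mass *\<^sub>R F x) \<le> 0 + \<epsilon>" if "\<epsilon> > 0" for \<epsilon>
    using *[of "\<epsilon> / (V + bump_mass)"] that V by simp
  then have "norm (conv (bump 3) F x - bump_mass *\<^sub>R F x) \<le> 0" by (rule field_le_epsilon)
  then show ?thesis by simp
qed

section \<open>Derivatives of solutions and Cauchy estimates\<close>

definition D :: "'a \<Rightarrow> ('a \<Rightarrow> 'c) \<Rightarrow> 'a \<Rightarrow> 'c" where
  "D v F x = frechet_derivative F (at x) v"

lemma sol_has_derivative_D: "sol F \<Longrightarrow> (F has_derivative (\<lambda>v. D v F x)) (at x)"
  unfolding D_def by (rule sol_derivative)

lemma sol_sum_D: "sol F \<Longrightarrow> (\<Sum>b\<in>Basis. A b (D b F x)) = 0"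
  unfolding D_def by (rule sol_eq)

lemma linear_D: "sol F \<Longrightarrow> linear (\<lambda>v. D v F x)"
  using has_derivative_linear[OF sol_has_derivative_D] .

lemma D_eqI: "(F has_derivative F') (at x) \<Longrightarrow> D v F x = F' v"
  unfolding D_def by (simp add: frechet_derivative_at[symmetric])

abbreviation bump3' :: "'a \<Rightarrow> 'a \<Rightarrow> real" where
  "bump3' v y \<equiv> -6 * bump 2 y * (y \<bullet> v)"

lemma bump3_derivative: "(bump 3 has_derivative (\<lambda>v. bump3' v y)) (at y)"
  using bump_derivative[of 1 y] by (simp add: eval_nat_numeral)

text \<open>The mean value formula writes \<open>F\<close> as its own average, so the derivative may
  be moved to the kernel and is controlled by the values of \<open>F\<close>.\<close>

lemma D_eq_conv:
  assumes F: "sol F"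
  shows "D v F x = - conv (bump3' v) F x /\<^sub>R bump_mass"
proof -
  have eq: "conv (bump 3) F x /\<^sub>R bump_mass = F x" for x
    using mean_value[OF F, of x] bump_mass_pos by simp
  have "((\<lambda>x. conv (bump 3) F x /\<^sub>R bump_mass) has_derivative (\<lambda>v. - conv (bump3' v) F x /\<^sub>R bump_mass)) (at x)"
    by (intro has_derivative_scaleR_right conv_has_derivative_left[OF bump3_derivative _ bump3_zero sol_continuous[OF F]]
       continuous_intros continuous_on_bump)
  then have "(F has_derivative (\<lambda>v. - conv (bump3' v) F x /\<^sub>R bump_mass)) (at x)"
    by (simp only: eq)
  then show ?thesis by (rule D_eqI)
qed

definition bump3'' :: "'a \<Rightarrow> 'a \<Rightarrow> 'a \<Rightarrow> real" where
  "bump3'' v y u = 24 * bump 1 y * (y \<bullet> u) * (y \<bullet> v) - 6 * bump 2 y * (u \<bullet> v)"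

lemma D_has_derivative:
  assumes F: "sol F"
  shows "(D v F has_derivative (\<lambda>u. conv (\<lambda>y. bump3'' v y u) F x /\<^sub>R bump_mass)) (at x)"
proof -
  have d: "(bump3' v has_derivative bump3'' v y) (at y)" for y
  proof -
    have "(bump 2 has_derivative (\<lambda>u. - 4 * bump 1 y * (y \<bullet> u))) (at y)"
      using bump_derivative[of 0 y] by (simp add: numeral_2_eq_2)
    then have "(bump3' v has_derivative (\<lambda>u. (-6 * bump 2 y) * (u \<bullet> v) + (-6 * (- 4 * bump 1 y * (y \<bullet> u))) * (y \<bullet> v))) (at y)"
      by (intro has_derivative_mult has_derivative_mult_right has_derivative_inner_left has_derivative_ident)
    then show ?thesis by (simp add: bump3''_def[abs_def] algebra_simps)
  qed
  have z: "bump3' v y = 0" if "1 < norm y" for y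
    using bump_zero[OF that, of 1] by (simp add: numeral_2_eq_2)
  have "D v F = (\<lambda>x. - conv (bump3' v) F x /\<^sub>R bump_mass)" using D_eq_conv[OF F] by blast
  moreover have "((\<lambda>x. - conv (bump3' v) F x /\<^sub>R bump_mass) has_derivative (\<lambda>u. - (- conv (\<lambda>y. bump3'' v y u) F x) /\<^sub>R bump_mass)) (at x)"
    by (intro has_derivative_scaleR_right has_derivative_minus conv_has_derivative_left[OF d _ z sol_continuous[OF F]])
      (auto simp: bump3''_def intro!: continuous_intros continuous_on_bump)
  ultimately show ?thesis by simp
qed

lemma D_commute:
  assumes F: "sol F"
  shows "D u (D v F) = D v (D u F)"
proof
  fix x
  have "D u (D v F) x = conv (\<lambda>y. bump3'' v y u) F x /\<^sub>R bump_mass" for u v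
    by (rule D_eqI[OF D_has_derivative[OF F]])
  moreover have "bump3'' v y u = bump3'' u y v" for y by (simp add: bump3''_def inner_commute)
  ultimately show "D u (D v F) x = D v (D u F) x" by simp
qed

text \<open>Derivatives of solutions are differentiable solutions again. Iterated, this gives
  derivatives of all orders although the kernel is only twice differentiable.\<close>

lemma sol_D:
  assumes F: "sol F"
  shows "sol (D v F)"
proof (rule solI)
  show d: "(D v F has_derivative (\<lambda>u. D u (D v F) x)) (at x)" for v x
    using D_has_derivative[OF F] D_eqI[OF D_has_derivative[OF F]] by simp
  fix x
  have "((\<lambda>x. \<Sum>b\<in>Basis. A b (D b F x)) has_derivative (\<lambda>u. \<Sum>b\<in>Basis. A b (D u (D b F) x))) (at x)"
    by (intro has_derivative_sum bounded_linear.has_derivative[OF A] d)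
  then have "((\<lambda>x. 0) has_derivative (\<lambda>u. \<Sum>b\<in>Basis. A b (D u (D b F) x))) (at x)"
    using sol_sum_D[OF F] by simp
  then have "(\<lambda>u. \<Sum>b\<in>Basis. A b (D u (D b F) x)) = (\<lambda>_. 0)"
    using has_derivative_unique has_derivative_const by blast
  then have "(\<Sum>b\<in>Basis. A b (D v (D b F) x)) = 0" by (rule fun_cong)
  then show "(\<Sum>b\<in>Basis. A b (D b (D v F) x)) = 0" using D_commute[OF F, of v] by simp
qed

text \<open>The 6 bounds the kernel \<open>bump3'\<close> and comes from differentiating the third
  power of \<open>1 - |y|^2\<close>.\<close>

definition K :: real where
  "K = 6 * measure lborel (cball (0::'a) 1) / bump_mass"

lemma K_pos: "0 < K"
  using bump_mass_pos by (simp add: K_def content_cball_pos)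

lemma D_bound_unit:
  assumes F: "sol F" and C: "\<And>y. norm y \<le> 1 \<Longrightarrow> norm (F (x + y)) \<le> C"
  shows "norm (D v F x) \<le> K * norm v * C"
proof -
  have "C \<ge> 0" using order_trans[OF norm_ge_zero C[of 0]] by simp
  have z: "bump3' v y = 0" if "1 < norm y" for y
    using bump_zero[OF that, of 1] by (simp add: numeral_2_eq_2)
  have "norm (conv (bump3' v) F x) \<le> (6 * norm v) * C * measure lborel (cball (0::'a) 1)"
  proof (rule conv_norm_le[OF _ z _ sol_continuous[OF F] C])
    show "\<bar>bump3' v y\<bar> \<le> 6 * norm v" for y
    proof (cases "1 < norm y")
      case False
      have "\<bar>y \<bullet> v\<bar> \<le> norm y * norm v" by (rule Cauchy_Schwarz_ineq2)
      also have "\<dots> \<le> 1 * norm v" using False by (intro mult_right_mono) auto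
      finally have "bump 2 y * \<bar>y \<bullet> v\<bar> \<le> 1 * norm v"
        using bump_le_1[of 2 y] bump_nonneg[of 2 y] by (intro mult_mono) auto
      then show ?thesis using bump_nonneg[of 2 y] by (simp add: abs_mult)
    next
      case True
      show ?thesis by (simp only: z[OF True]) simp
    qed
  qed (auto intro!: continuous_intros continuous_on_bump \<open>C \<ge> 0\<close>)
  then have "norm (conv (bump3' v) F x) / bump_mass \<le> (6 * norm v) * C * measure lborel (cball (0::'a) 1) / bump_mass"
    using bump_mass_pos by (intro divide_right_mono) auto
  then show ?thesis
    using bump_mass_pos by (simp add: D_eq_conv[OF F] K_def divide_inverse_commute algebra_simps)
qed

lemma sol_scale:
  assumes F: "sol F"
  shows "sol (\<lambda>z. F (r *\<^sub>R z))" "D v (\<lambda>z. F (r *\<^sub>R z)) x = r *\<^sub>R D v F (r *\<^sub>R x)"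
proof -
  have d: "((\<lambda>z. F (r *\<^sub>R z)) has_derivative (\<lambda>v. r *\<^sub>R D v F (r *\<^sub>R x))) (at x)" for x
  proof -
    have "((\<lambda>z. r *\<^sub>R z) has_derivative (\<lambda>v. r *\<^sub>R v)) (at x)" by (auto intro!: derivative_eq_intros)
    from has_derivative_compose[OF this sol_has_derivative_D[OF F]] show ?thesis
      by (simp add: linear_cmul[OF linear_D[OF F]])
  qed
  show "D v (\<lambda>z. F (r *\<^sub>R z)) x = r *\<^sub>R D v F (r *\<^sub>R x)" by (rule D_eqI[OF d])
  show "sol (\<lambda>z. F (r *\<^sub>R z))"
  proof (rule solI[OF d])
    fix x
    have "(\<Sum>b\<in>Basis. A b (r *\<^sub>R D b F (r *\<^sub>R x))) = r *\<^sub>R (\<Sum>b\<in>Basis. A b (D b F (r *\<^sub>R x)))"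
      unfolding scaleR_sum_right by (intro sum.cong refl linear_cmul bounded_linear.linear A)
    then show "(\<Sum>b\<in>Basis. A b (r *\<^sub>R D b F (r *\<^sub>R x))) = 0" using sol_sum_D[OF F] by simp
  qed
qed

lemma D_bound:
  assumes F: "sol F" and r: "0 < r" and C: "\<And>y. norm y \<le> r \<Longrightarrow> norm (F (x + y)) \<le> C"
  shows "norm (D v F x) \<le> K / r * norm v * C"
proof -
  have "norm (D v (\<lambda>z. F (r *\<^sub>R z)) (x /\<^sub>R r)) \<le> K * norm v * C"
  proof (rule D_bound_unit[OF sol_scale(1)[OF F]])
    fix y :: 'a assume "norm y \<le> 1"
    then have "norm (r *\<^sub>R y) \<le> r" using r by (simp add: mult_left_le)
    from C[OF this] show "norm (F (r *\<^sub>R (x /\<^sub>R r + y))) \<le> C" using r by (simp add: scaleR_add_right)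
  qed
  then have "r * norm (D v F x) \<le> K * norm v * C" using r by (simp add: sol_scale(2)[OF F])
  then show ?thesis using r by (simp add: field_simps)
qed

lemma sol_foldr_D: "sol F \<Longrightarrow> sol (foldr D vs F)"
  by (induction vs) (auto simp: sol_D)

text \<open>Each derivative spends a radius \<open>r\<close>, so \<open>k\<close> of them use the
  values of \<open>F\<close> on a ball of radius \<open>k * r\<close>. Later \<open>r\<close> is a
  fixed radius divided by \<open>k\<close>, which produces a factor \<open>k ^ k\<close>.\<close>

lemma foldr_D_bound:
  assumes F: "sol F" and r: "0 < r" and vs: "\<And>v. v \<in> set vs \<Longrightarrow> norm v \<le> m"
    and C: "\<And>y. norm y \<le> real (length vs) * r \<Longrightarrow> norm (F (x + y)) \<le> C"
  shows "norm (foldr D vs F x) \<le> (K * m / r) ^ length vs * C"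
  using vs C
proof (induction vs arbitrary: x)
  case Nil
  then show ?case using Nil(2)[of 0] by simp
next
  case (Cons v vs)
  have C0: "0 \<le> C" using order_trans[OF norm_ge_zero Cons.prems(2)[of 0]] r by simp
  have m: "norm v \<le> m" using Cons.prems(1) by simp
  then have m0: "0 \<le> m" by (rule order_trans[OF norm_ge_zero])
  have "norm (D v (foldr D vs F) x) \<le> K / r * norm v * ((K * m / r) ^ length vs * C)"
  proof (rule D_bound[OF sol_foldr_D[OF F] r])
    fix y :: 'a assume y: "norm y \<le> r"
    show "norm (foldr D vs F (x + y)) \<le> (K * m / r) ^ length vs * C"
    proof (rule Cons.IH)
      fix z :: 'a assume "norm z \<le> real (length vs) * r"
      then have "norm (y + z) \<le> real (length (v # vs)) * r"
        using y norm_triangle_ineq[of y z] by (simp add: algebra_simps)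
      from Cons.prems(2)[OF this] show "norm (F (x + y + z)) \<le> C" by (simp add: add.assoc)
    qed (use Cons.prems(1) in simp)
  qed
  also have "\<dots> \<le> K / r * m * ((K * m / r) ^ length vs * C)"
    using m m0 K_pos r C0 by (intro mult_right_mono mult_left_mono) auto
  finally show ?case by (simp add: mult.assoc)
qed

end

text \<open>A single term of the series for \<open>exp n\<close>. It converts the
  \<open>k ^ k\<close> of iterated Cauchy estimates, and that of finite differences, into
  \<open>fact k\<close> at an exponential cost.\<close>

lemma power_self_le_fact: "real n ^ n \<le> fact n * exp 1 ^ n"
proof -
  have s: "summable (\<lambda>k. real n ^ k / fact k)" using summable_exp[of "real n"] by (simp add: field_simps)
  have "real n ^ n / fact n \<le> (\<Sum>k. real n ^ k / fact k)"
    using sum_le_suminf[OF s, of "{n}"] by simp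
  also have "\<dots> = exp (real n)" by (simp add: exp_def field_simps)
  also have "\<dots> = exp 1 ^ n" by (simp add: exp_of_nat_mult[symmetric])
  finally show ?thesis by (simp add: field_simps)
qed

lemma has_derivative_line: "((\<lambda>t::real. x + t *\<^sub>R v) has_derivative (\<lambda>s. s *\<^sub>R v)) (at t)"
  by (auto intro!: derivative_eq_intros)

context elliptic_system
begin

lemma funpow_D_eq_foldr: "(D v ^^ k) F = foldr D (replicate k v) F"
  by (simp only: foldr_replicate)

lemma sol_funpow_D: "sol F \<Longrightarrow> sol ((D v ^^ k) F)"
  using sol_foldr_D[of F "replicate k v"] by (simp only: foldr_replicate)

text \<open>A solution lives on the whole space, so Cauchy estimates may use any radius. One that is
  large compared with \<open>|v|\<close> makes the Taylor terms decay geometrically, and the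
  expansion reaches \<open>x + v\<close> in a single step.\<close>

lemma sol_taylor:
  assumes F: "sol F"
  shows "(\<lambda>k. (D v ^^ k) F x /\<^sub>R fact k) sums F (x + v)"
proof -
  \<comment> \<open>Chosen so that \<open>K * exp 1 * norm v / R \<le> 1 / 2\<close>; the 1 keeps it
    positive for \<open>v = 0\<close>.\<close>
  define R where "R = 2 * K * exp 1 * norm v + 1"
  have R: "R > 0" using K_pos by (auto simp: R_def intro!: add_nonneg_pos)
  have "bounded (F ` cball x (R + norm v))"
    by (intro compact_imp_bounded compact_continuous_image continuous_on_subset[OF sol_continuous[OF F]]) auto
  then obtain C where "\<forall>u\<in>F ` cball x (R + norm v). norm u \<le> C" unfolding bounded_iff by blast
  then have C: "norm (F z) \<le> C" if "z \<in> cball x (R + norm v)" for z using that by blast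
  have C0: "0 \<le> C" using order_trans[OF norm_ge_zero C[of x]] R by simp
  have bnd: "norm ((D v ^^ n) F (x + t *\<^sub>R v)) / fact n \<le> C * (1/2) ^ n" if t: "\<bar>t\<bar> \<le> 1" for n and t :: real
  proof (cases "n = 0")
    case True
    have "norm (t *\<^sub>R v) \<le> norm v" using t by (simp add: mult_left_le_one_le)
    moreover have "dist x (x + t *\<^sub>R v) = norm (t *\<^sub>R v)" by (simp only: dist_norm norm_minus_commute[of x] add_diff_cancel_left')
    ultimately have "norm (F (x + t *\<^sub>R v)) \<le> C" using R by (intro C) simp
    then show ?thesis by (simp only: True) simp
  next
    case False
    define r where "r = R / real n"
    have r: "r > 0" "real n * r = R" using R False by (auto simp: r_def)
    have "norm (foldr D (replicate n v) F (x + t *\<^sub>R v)) \<le> (K * norm v / r) ^ length (replicate n v) * C"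
    proof (rule foldr_D_bound[OF F r(1)])
      fix y :: 'a assume "norm y \<le> real (length (replicate n v)) * r"
      then have y: "norm y \<le> R" using r by simp
      have "norm (t *\<^sub>R v) \<le> norm v" using t by (simp add: mult_left_le_one_le)
      then have "norm (t *\<^sub>R v + y) \<le> R + norm v" using y norm_triangle_ineq[of "t *\<^sub>R v" y] by linarith
      moreover have "dist x (x + t *\<^sub>R v + y) = norm (t *\<^sub>R v + y)" by (simp only: dist_norm add.assoc norm_minus_commute[of x] add_diff_cancel_left')
      ultimately show "norm (F (x + t *\<^sub>R v + y)) \<le> C" by (intro C) simp
    next
      show "norm u \<le> norm v" if "u \<in> set (replicate n v)" for u using that in_set_replicate[of u n v] by blast
    qed
    then have "norm ((D v ^^ n) F (x + t *\<^sub>R v)) / fact n \<le> (K * norm v / r) ^ n * C / fact n"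
      unfolding funpow_D_eq_foldr by (simp add: divide_right_mono)
    also have "(K * norm v / r) ^ n * C / fact n = (K * norm v / R) ^ n * C * (real n ^ n / fact n)"
      using False by (simp add: r_def power_divide power_mult_distrib)
    also have "\<dots> \<le> (K * norm v / R) ^ n * C * exp 1 ^ n"
    proof (rule mult_left_mono)
      show "real n ^ n / fact n \<le> exp 1 ^ n" using power_self_le_fact[of n] by (simp add: pos_divide_le_eq mult.commute)
      show "0 \<le> (K * norm v / R) ^ n * C" using C0 R K_pos by simp
    qed
    also have "\<dots> = (K * exp 1 * norm v / R) ^ n * C"
      by (simp add: power_divide power_mult_distrib)
    also have "\<dots> \<le> (1/2) ^ n * C"
    proof (intro mult_right_mono power_mono C0)
      have "2 * (K * exp 1 * norm v) \<le> R" by (simp add: R_def)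
      then show "K * exp 1 * norm v / R \<le> 1 / 2" using R by (simp add: pos_divide_le_eq)
      show "0 \<le> K * exp 1 * norm v / R" using R K_pos by simp
    qed
    finally show ?thesis by (simp add: mult.commute)
  qed
  have rem: "norm (F (x + v) - (\<Sum>k<n. (D v ^^ k) F x /\<^sub>R fact k)) \<le> real DIM('c) * (C * (1/2) ^ n)" for n
  proof -
    \<comment> \<open>The Lagrange form of the remainder holds for real functions only, hence the
      argument by components and the factor \<open>DIM('c)\<close>.\<close>
    have "\<bar>(F (x + v) - (\<Sum>k<n. (D v ^^ k) F x /\<^sub>R fact k)) \<bullet> e\<bar> \<le> C * (1/2) ^ n" if e: "e \<in> Basis" for e
    proof -
      define diff where "diff k t = (D v ^^ k) F (x + t *\<^sub>R v) \<bullet> e" for k t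
      have "DERIV (diff m) t :> diff (Suc m) t" for m t
      proof -
        from has_derivative_compose[OF has_derivative_line[of x v t] sol_has_derivative_D[OF sol_funpow_D[OF F, of m v]]]
        have "((\<lambda>t. (D v ^^ m) F (x + t *\<^sub>R v)) has_derivative (\<lambda>s. s *\<^sub>R D v ((D v ^^ m) F) (x + t *\<^sub>R v))) (at t)"
          by (simp only: linear_cmul[OF linear_D[OF sol_funpow_D[OF F]]])
        from has_derivative_inner_left[OF this, of e] show ?thesis
          unfolding diff_def[abs_def] has_field_derivative_def inner_scaleR_left by (simp only: mult_commute_abs funpow.simps o_apply)
      qed
      then have "\<exists>t. \<bar>t\<bar> \<le> \<bar>1\<bar> \<and> diff 0 1 = (\<Sum>m<n. diff m 0 / fact m * 1 ^ m) + diff n t / fact n * 1 ^ n"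
        by (intro Maclaurin_all_le allI refl)
      then obtain t where t: "\<bar>t\<bar> \<le> 1" "diff 0 1 = (\<Sum>m<n. diff m 0 / fact m) + diff n t / fact n"
        by (auto simp only: abs_one power_one mult_1_right)
      have d1: "diff 0 1 = F (x + v) \<bullet> e" by (simp only: diff_def funpow_0 scaleR_one)
      have d2: "diff m 0 / fact m = ((D v ^^ m) F x /\<^sub>R fact m) \<bullet> e" for m
        by (simp only: diff_def scaleR_zero_left add_0_right inner_scaleR_left divide_inverse_commute)
      have "(F (x + v) - (\<Sum>k<n. (D v ^^ k) F x /\<^sub>R fact k)) \<bullet> e = diff n t / fact n"
        using t(2) unfolding d1 d2 inner_diff_left inner_sum_left by linarith
      also have "\<bar>\<dots>\<bar> \<le> norm ((D v ^^ n) F (x + t *\<^sub>R v)) / fact n"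
        unfolding abs_divide abs_of_pos[OF fact_gt_zero] diff_def by (intro divide_right_mono Basis_le_norm[OF e]) simp
      also have "\<dots> \<le> C * (1/2) ^ n" by (rule bnd[OF t(1)])
      finally show ?thesis .
    qed
    then have "(\<Sum>e\<in>Basis. \<bar>(F (x + v) - (\<Sum>k<n. (D v ^^ k) F x /\<^sub>R fact k)) \<bullet> e\<bar>) \<le> real DIM('c) * (C * (1/2) ^ n)"
      by (intro sum_bounded_above)
    with norm_le_l1 show ?thesis by (rule order_trans)
  qed
  have "(\<lambda>n. (1/2::real) ^ n) \<longlonglongrightarrow> 0" by (rule LIMSEQ_power_zero) simp
  then have lim: "(\<lambda>n. real DIM('c) * (C * (1/2) ^ n)) \<longlonglongrightarrow> 0"
    by (intro tendsto_mult_right_zero)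
  show ?thesis
    unfolding sums_def
  proof (rule Lim_null[THEN iffD2], rule Lim_null_comparison[OF always_eventually lim], rule allI)
    fix n
    show "norm ((\<Sum>k<n. (D v ^^ k) F x /\<^sub>R fact k) - F (x + v)) \<le> real DIM('c) * (C * (1/2) ^ n)"
      using rem[of n] by (simp only: norm_minus_commute)
  qed
qed

text \<open>The system expresses the derivative along \<open>e\<close> by the tangential ones. By
  induction all iterated derivatives along \<open>e\<close> vanish on the hyperplane, so the Taylor
  series along the normal through \<open>z\<close> is zero.\<close>

theorem sol_zero_on_hyperplane:
  assumes F: "sol F" and e: "e \<in> Basis" "\<And>u. A e u = u" and H: "\<And>x. x \<bullet> e = 0 \<Longrightarrow> F x = 0"
  shows "F z = 0"
proof -
  define v where "v = (z \<bullet> e) *\<^sub>R e"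
  have "(D v ^^ k) F x = 0" if "x \<bullet> e = 0" for k x
    using that
  proof (induction k arbitrary: x)
    case (Suc k)
    let ?G = "(D v ^^ k) F"
    note G = sol_funpow_D[OF F, of k v]
    have "D b ?G x = 0" if b: "b \<in> Basis" "b \<noteq> e" for b
    proof -
      define G where "G = ?G"
      have "(G has_derivative (\<lambda>u. D u G x)) (at (x + 0 *\<^sub>R b))"
        unfolding G_def scaleR_zero_left add_0_right by (rule sol_has_derivative_D[OF G])
      then have "((\<lambda>t. G (x + t *\<^sub>R b)) has_derivative (\<lambda>s. D (s *\<^sub>R b) G x)) (at 0)"
        by (rule has_derivative_compose[OF has_derivative_line[of x b 0]])
      then have "((\<lambda>t. ?G (x + t *\<^sub>R b)) has_derivative (\<lambda>s. D (s *\<^sub>R b) ?G x)) (at 0)"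
        by (simp only: G_def)
      moreover have "?G (x + t *\<^sub>R b) = 0" for t
        using b e(1) Suc.prems by (intro Suc.IH) (simp add: inner_add_left inner_Basis)
      ultimately have "((\<lambda>t::real. 0) has_derivative (\<lambda>s. D (s *\<^sub>R b) ?G x)) (at 0)" by simp
      then have "(\<lambda>s::real. D (s *\<^sub>R b) ?G x) = (\<lambda>_. 0)" using has_derivative_unique has_derivative_const by blast
      from fun_cong[OF this, of 1] show ?thesis by simp
    qed
    then have "(\<Sum>b\<in>Basis. A b (D b ?G x)) = A e (D e ?G x)"
      using e(1) linear_0[OF bounded_linear.linear[OF A]] by (subst sum.remove[OF finite_Basis e(1)]) simp
    then have "D e ?G x = 0" using sol_sum_D[OF G, of x] e(2) by simp
    moreover have "D ((z \<bullet> e) *\<^sub>R e) ?G x = (z \<bullet> e) *\<^sub>R D e ?G x" by (rule linear_cmul[OF linear_D[OF G]])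
    ultimately show ?case by (simp flip: v_def)
  next
    case 0
    show ?case unfolding funpow_0 by (rule H[OF 0])
  qed
  moreover have "(z - v) \<bullet> e = 0" using e(1) by (simp add: v_def inner_diff_left)
  ultimately have "(\<lambda>k. (D v ^^ k) F (z - v) /\<^sub>R fact k) = (\<lambda>k. 0)" by simp
  then have "(\<lambda>k. (D v ^^ k) F (z - v) /\<^sub>R fact k) sums 0" using sums_zero by metis
  with sol_taylor[OF F, of v "z - v"] have "F (z - v + v) = 0" by (rule sums_unique2)
  then show ?thesis by simp
qed

end

section \<open>Monomials indexed by lists of coordinates\<close>

lemma sum_lists_Suc:
  fixes f :: "'n::finite list \<Rightarrow> 'b::comm_monoid_add"
  shows "(\<Sum>J | length J = Suc k. f J) = (\<Sum>j\<in>UNIV. \<Sum>J | length J = k. f (j # J))"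
proof -
  have "bij_betw (\<lambda>(j, J). j # J) (UNIV \<times> {J. length J = k}) {J::'n list. length J = Suc k}"
    by (rule bij_betwI[where g="\<lambda>J. (hd J, tl J)"]) (auto simp: length_Suc_conv)
  from sum.reindex_bij_betw[OF this, of f] show ?thesis
    by (simp add: sum.cartesian_product case_prod_unfold)
qed

lemma finite_lists_length [simp]: "finite {J::'n::finite list. length J = k}"
  using finite_lists_length_eq[of "UNIV :: 'n set" k] by simp

lemma card_lists_length: "card {J::'n::finite list. length J = k} = CARD('n) ^ k"
  using card_lists_length_eq[of "UNIV :: 'n set" k] by simp

text \<open>Lists index monomials by ordered tuples, so a homogeneous polynomial is the contraction
  of a tensor with copies of \<open>x\<close>, and multinomial coefficients do not appear.\<close>

definition mon :: "real ^ 'n \<Rightarrow> 'n list \<Rightarrow> real" where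
  "mon x J = prod_list (map (($) x) J)"

lemma mon_simps [simp]: "mon x [] = 1" "mon x (j # J) = x $ j * mon x J"
  by (simp_all add: mon_def)

lemma (in elliptic_system) funpow_D_expand:
  fixes e :: "'n::finite \<Rightarrow> 'a"
  assumes F: "sol F"
  shows "(D (\<Sum>j\<in>UNIV. x $ j *\<^sub>R e j) ^^ k) F = (\<lambda>z. \<Sum>J | length J = k. mon x J *\<^sub>R foldr D (map e J) F z)"
proof (induction k)
  case 0
  have "{J::'n list. length J = 0} = {[]}" by auto
  then show ?case by (simp only: funpow_0) simp
next
  case (Suc k)
  define v where "v = (\<Sum>j\<in>UNIV. x $ j *\<^sub>R e j)"
  have d: "((\<lambda>z. \<Sum>J | length J = k. mon x J *\<^sub>R foldr D (map e J) F z) has_derivative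
      (\<lambda>u. \<Sum>J | length J = k. mon x J *\<^sub>R D u (foldr D (map e J) F) z)) (at z)" for z
    by (intro has_derivative_sum has_derivative_scaleR_right sol_has_derivative_D sol_foldr_D F)
  have lv: "D v (foldr D (map e J) F) z = (\<Sum>j\<in>UNIV. x $ j *\<^sub>R foldr D (map e (j # J)) F z)" for J z
    unfolding v_def linear_sum[OF linear_D[OF sol_foldr_D[OF F]]] linear_cmul[OF linear_D[OF sol_foldr_D[OF F]]] by simp
  show ?case
  proof
    fix z
    have "(D v ^^ Suc k) F z = D v ((D v ^^ k) F) z" by simp
    also have "\<dots> = (\<Sum>J | length J = k. mon x J *\<^sub>R D v (foldr D (map e J) F) z)"
      unfolding Suc.IH[folded v_def] by (rule D_eqI[OF d])
    also have "\<dots> = (\<Sum>J | length J = k. \<Sum>j\<in>UNIV. mon x (j # J) *\<^sub>R foldr D (map e (j # J)) F z)"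
      unfolding lv scaleR_sum_right by (simp add: mult.commute)
    also have "\<dots> = (\<Sum>J | length J = Suc k. mon x J *\<^sub>R foldr D (map e J) F z)"
      unfolding sum_lists_Suc by (rule sum.swap)
    finally show "(D (\<Sum>j\<in>UNIV. x $ j *\<^sub>R e j) ^^ Suc k) F z = (\<Sum>J | length J = Suc k. mon x J *\<^sub>R foldr D (map e J) F z)"
      unfolding v_def .
  qed
qed

section \<open>Spherical averages\<close>

text \<open>The value at 0, some unit vector, makes the projection take values in the compact sphere
  everywhere; the change on a null set leaves \<open>sphere_avg\<close> as it is.\<close>

definition radial :: "real ^ 'n \<Rightarrow> real ^ 'n" where
  "radial y = (if y = 0 then axis undefined 1 else y /\<^sub>R norm y)"

lemma norm_radial [simp]: "norm (radial y) = 1"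
  by (simp add: radial_def)

lemma radial_measurable [measurable]: "radial \<in> borel_measurable borel"
proof -
  have "(\<lambda>y::real^'n. y /\<^sub>R norm y) \<in> borel_measurable borel" by measurable
  then show ?thesis unfolding radial_def[abs_def] by measurable
qed

abbreviation unit_ball_measure :: "(real ^ 'n) measure" where
  "unit_ball_measure \<equiv> restrict_space lborel (ball 0 1)"

lemma finite_unit_ball_measure: "finite_measure (unit_ball_measure :: (real ^ 'n) measure)"
  by (intro finite_measureI)
    (use emeasure_lborel_ball_finite[of "0::real^'n" 1] in \<open>simp add: emeasure_restrict_space space_restrict_space less_top\<close>)

lemma radial_measurable' [measurable]: "radial \<in> borel_measurable unit_ball_measure"
  by (intro measurable_restrict_space1) simp

lemma integrable_radial:
  fixes g :: "real ^ 'n \<Rightarrow> 'b::euclidean_space"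
  assumes "continuous_on (sphere 0 1) g"
  shows "integrable unit_ball_measure (\<lambda>y. g (radial y))"
  by (rule integrable_compact_image[OF finite_unit_ball_measure radial_measurable' _ compact_sphere assms]) simp

lemma unit_ball_volume_pos: "0 < measure lborel (ball (0::real^'n) 1)"
  by (simp add: content_ball_pos)

lemma sphere_avg_eq:
  fixes g :: "real ^ 'n \<Rightarrow> 'b::euclidean_space"
  assumes "continuous_on (sphere 0 1) g"
  shows "sphere_avg g = (\<integral>y. g (radial y) \<partial>unit_ball_measure) /\<^sub>R measure lborel (ball (0::real^'n) 1)"
proof -
  have b: "ball (0::real^'n) 1 \<inter> space lborel \<in> sets lborel" by simp
  have "set_integrable lborel (ball 0 1) (\<lambda>y. g (radial y))"
    using integrable_radial[OF assms] unfolding set_integrable_def integrable_restrict_space[OF b] .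
  from set_borel_integral_eq_integral(2)[OF this]
  have "integral (ball 0 1) (\<lambda>y. g (radial y)) = (\<integral>y. g (radial y) \<partial>unit_ball_measure)"
    unfolding set_lebesgue_integral_def integral_restrict_space[OF b] by simp
  moreover have "integral (ball 0 1) (\<lambda>y. g (y /\<^sub>R norm y)) = integral (ball 0 1) (\<lambda>y. g (radial y))"
    by (rule integral_spike[of "{0}"]) (auto simp: radial_def)
  ultimately show ?thesis by (simp add: sphere_avg_def)
qed

lemma sphere_avg_cong:
  assumes "\<And>w. w \<in> sphere 0 1 \<Longrightarrow> f w = g w"
  shows "sphere_avg f = sphere_avg g"
proof -
  have "integral (ball 0 1) (\<lambda>y. f (y /\<^sub>R norm y)) = integral (ball 0 1) (\<lambda>y. g (y /\<^sub>R norm y))"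
    by (rule integral_spike[of "{0}"]) (auto simp: assms)
  then show ?thesis by (simp add: sphere_avg_def)
qed

lemma sphere_avg_add:
  fixes f g :: "real ^ 'n \<Rightarrow> 'b::euclidean_space"
  assumes "continuous_on (sphere 0 1) f" "continuous_on (sphere 0 1) g"
  shows "sphere_avg (\<lambda>w. f w + g w) = sphere_avg f + sphere_avg g"
  using assms integrable_radial[OF assms(1)] integrable_radial[OF assms(2)]
  by (simp add: sphere_avg_eq continuous_on_add scaleR_add_right)

lemma sphere_avg_bounded_linear:
  fixes f :: "real ^ 'n \<Rightarrow> 'b::euclidean_space" and L :: "'b \<Rightarrow> 'c::euclidean_space"
  assumes L: "bounded_linear L" and f: "continuous_on (sphere 0 1) f"
  shows "sphere_avg (\<lambda>w. L (f w)) = L (sphere_avg f)"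
  using integral_bounded_linear[OF L integrable_radial[OF f]]
  by (simp add: sphere_avg_eq f bounded_linear.continuous_on[OF L f] linear_cmul[OF bounded_linear.linear[OF L]])

lemma sphere_avg_sum:
  fixes f :: "'i \<Rightarrow> real ^ 'n \<Rightarrow> 'b::euclidean_space"
  assumes "\<And>i. i \<in> I \<Longrightarrow> continuous_on (sphere 0 1) (f i)"
  shows "sphere_avg (\<lambda>w. \<Sum>i\<in>I. f i w) = (\<Sum>i\<in>I. sphere_avg (f i))"
proof -
  have "(\<integral>y. (\<Sum>i\<in>I. f i (radial y)) \<partial>unit_ball_measure) = (\<Sum>i\<in>I. \<integral>y. f i (radial y) \<partial>unit_ball_measure)"
    by (intro Bochner_Integration.integral_sum integrable_radial assms)
  then show ?thesis
    by (simp add: sphere_avg_eq assms continuous_on_sum scaleR_sum_right)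
qed

lemma sphere_avg_const [simp]: "sphere_avg (\<lambda>w::real^'n. c) = (c :: 'b::euclidean_space)"
proof -
  have "measure (unit_ball_measure :: (real^'n) measure) (ball 0 1) = measure lborel (ball (0::real^'n) 1)"
    by (subst measure_restrict_space) auto
  then show ?thesis
    using unit_ball_volume_pos[where 'n='n] by (simp add: sphere_avg_eq space_restrict_space)
qed

lemma sphere_avg_mono:
  fixes f g :: "real ^ 'n \<Rightarrow> real"
  assumes "continuous_on (sphere 0 1) f" "continuous_on (sphere 0 1) g" "\<And>w. w \<in> sphere 0 1 \<Longrightarrow> f w \<le> g w"
  shows "sphere_avg f \<le> sphere_avg g"
  unfolding sphere_avg_eq[OF assms(1)] sphere_avg_eq[OF assms(2)] real_scaleR_def
  by (intro mult_left_mono integral_mono integrable_radial assms) auto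

text \<open>The ball of radius \<open>\<delta> / 8\<close> around \<open>w0 / 2\<close> is projected
  into the cap of radius \<open>\<delta>\<close>, and its share of the unit ball is
  \<open>(\<delta> / 8) ^ CARD('n)\<close>. The constants are generous; only a power of
  \<open>\<delta>\<close> with fixed exponent matters later.\<close>

lemma sphere_avg_cap:
  fixes g :: "real ^ 'n \<Rightarrow> real"
  assumes g: "continuous_on (sphere 0 1) g" "\<And>w. w \<in> sphere 0 1 \<Longrightarrow> 0 \<le> g w" and "w0 \<in> sphere 0 1" "0 < \<delta>" "\<delta> \<le> 1" "0 \<le> c"
    and c: "\<And>w. w \<in> sphere 0 1 \<Longrightarrow> dist w w0 < \<delta> \<Longrightarrow> c \<le> g w"
  shows "c * (\<delta> / 8) ^ CARD('n) \<le> sphere_avg g"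
proof -
  let ?B = "ball (w0 /\<^sub>R 2) (\<delta> / 8)"
  have w0: "norm w0 = 1" using assms by simp
  have sub: "?B \<subseteq> ball 0 1"
  proof
    fix y assume "y \<in> ?B"
    then have "norm (y - w0 /\<^sub>R 2) < \<delta> / 8" by (simp add: dist_norm norm_minus_commute)
    moreover have "norm y \<le> norm (y - w0 /\<^sub>R 2) + norm (w0 /\<^sub>R 2)" using norm_triangle_ineq[of "y - w0 /\<^sub>R 2" "w0 /\<^sub>R 2"] by simp
    ultimately show "y \<in> ball 0 1" using w0 assms by simp
  qed
  have cap: "c \<le> g (radial y)" if y: "y \<in> ?B" for y
  proof (rule c)
    have d: "norm (y - w0 /\<^sub>R 2) < \<delta> / 8" using y by (simp add: dist_norm norm_minus_commute)
    have n1: "\<bar>norm y - 1/2\<bar> \<le> norm (y - w0 /\<^sub>R 2)" using norm_triangle_ineq3[of y "w0 /\<^sub>R 2"] w0 by simp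
    then have ny: "3/8 \<le> norm y" using d assms by linarith
    then have y0: "y \<noteq> 0" by auto
    \<comment> \<open>Splits the deviation from \<open>w0\<close> into the distance of
      \<open>y\<close> from \<open>w0 / 2\<close> and the error of its norm. Both are below
      \<open>\<delta> / 8\<close>, and dividing by \<open>norm y \<ge> 3/8\<close> leaves less than
      \<open>\<delta>\<close>.\<close>
    have "norm y *\<^sub>R (radial y - w0) = (y - w0 /\<^sub>R 2) + (1/2 - norm y) *\<^sub>R w0"
      using y0 by (simp add: radial_def algebra_simps)
    from arg_cong[OF this, of norm]
    have "norm y * norm (radial y - w0) = norm ((y - w0 /\<^sub>R 2) + (1/2 - norm y) *\<^sub>R w0)"
      by (simp only: norm_scaleR abs_norm_cancel)
    also have "\<dots> \<le> norm (y - w0 /\<^sub>R 2) + norm ((1/2 - norm y) *\<^sub>R w0)" by (rule norm_triangle_ineq)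
    also have "\<dots> = norm (y - w0 /\<^sub>R 2) + \<bar>1/2 - norm y\<bar>" by (simp add: w0)
    also have "\<dots> < \<delta> / 4" using d n1 by linarith
    finally have "norm y * norm (radial y - w0) < \<delta> / 4" .
    moreover have "3/8 * norm (radial y - w0) \<le> norm y * norm (radial y - w0)" using ny by (intro mult_right_mono) auto
    ultimately show "dist (radial y) w0 < \<delta>" using assms by (simp add: dist_norm)
  qed simp
  have b: "ball (0::real^'n) 1 \<inter> space lborel \<in> sets lborel" by simp
  have "c * measure lborel ?B = (\<integral>y. c * indicator ?B y \<partial>lborel)" by simp
  also have "\<dots> \<le> (\<integral>y. indicator (ball 0 1) y *\<^sub>R g (radial y) \<partial>lborel)"
  proof (rule integral_mono)
    show "integrable lborel (\<lambda>y. c * indicator ?B y)"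
      using emeasure_lborel_ball_finite[of "w0 /\<^sub>R 2" "\<delta> / 8"] by (intro integrable_mult_right integrable_real_indicator) simp_all
    show "integrable lborel (\<lambda>y. indicator (ball 0 1) y *\<^sub>R g (radial y))"
      using integrable_radial[OF g(1)] unfolding integrable_restrict_space[OF b] .
    show "c * indicator ?B y \<le> indicator (ball 0 1) y *\<^sub>R g (radial y)" for y
      using cap[of y] sub g(2)[of "radial y"] by (cases "y \<in> ?B"; cases "y \<in> ball 0 1") auto
  qed
  also have "\<dots> = (\<integral>y. g (radial y) \<partial>unit_ball_measure)" by (subst integral_restrict_space[OF b]) simp
  finally have "c * measure lborel ?B / measure lborel (ball (0::real^'n) 1) \<le> sphere_avg g"
    unfolding sphere_avg_eq[OF g(1)] real_scaleR_def divide_inverse_commute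
    by (rule mult_left_mono) simp
  moreover have "measure lborel ?B = (\<delta> / 8) ^ CARD('n) * measure lborel (ball (0::real^'n) 1)"
    using assms by (simp add: content_ball)
  ultimately show ?thesis using unit_ball_volume_pos[where 'n='n] by simp
qed

lemma continuous_on_suminf:
  fixes f :: "nat \<Rightarrow> 'a::topological_space \<Rightarrow> 'b::banach"
  assumes "\<And>k. continuous_on S (f k)" "\<And>k x. x \<in> S \<Longrightarrow> norm (f k x) \<le> m k" "summable m"
  shows "continuous_on S (\<lambda>x. \<Sum>k. f k x)"
proof (rule uniform_limit_theorem)
  show "uniform_limit S (\<lambda>n x. \<Sum>k<n. f k x) (\<lambda>x. \<Sum>k. f k x) sequentially"
    by (rule Weierstrass_m_test) (use assms in auto)
  show "\<forall>\<^sub>F n in sequentially. continuous_on S (\<lambda>x. \<Sum>k<n. f k x)"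
    by (intro always_eventually allI continuous_on_sum assms)
qed simp

lemma sphere_avg_sums:
  fixes g :: "nat \<Rightarrow> real ^ 'n \<Rightarrow> 'b::euclidean_space"
  assumes g: "\<And>k. continuous_on (sphere 0 1) (g k)" and m: "\<And>k w. w \<in> sphere 0 1 \<Longrightarrow> norm (g k w) \<le> m k" and s: "summable m"
  shows "(\<lambda>k. sphere_avg (g k)) sums sphere_avg (\<lambda>w. \<Sum>k. g k w)"
proof -
  interpret finite_measure "unit_ball_measure :: (real ^ 'n) measure" by (rule finite_unit_ball_measure)
  have c: "continuous_on (sphere 0 1) (\<lambda>w. \<Sum>k. g k w)"
    by (rule continuous_on_suminf[OF g m s])
  have "(\<lambda>k. \<integral>y. g k (radial y) \<partial>unit_ball_measure) sums (\<integral>y. (\<Sum>k. g k (radial y)) \<partial>unit_ball_measure)"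
  proof (rule sums_integral)
    show "integrable unit_ball_measure (\<lambda>y. g k (radial y))" for k by (rule integrable_radial[OF g])
    show "AE y in unit_ball_measure. summable (\<lambda>k. norm (g k (radial y)))"
      by (intro AE_I2 summable_comparison_test'[OF s, of 0]) (simp add: m)
    show "summable (\<lambda>k. \<integral>y. norm (g k (radial y)) \<partial>unit_ball_measure)"
    proof (rule summable_comparison_test'[where N=0])
      show "summable (\<lambda>k. m k * measure (unit_ball_measure :: (real ^ 'n) measure) (space unit_ball_measure))" by (intro summable_mult2 s)
      fix k
      have "(\<integral>y. norm (g k (radial y)) \<partial>unit_ball_measure) \<le> (\<integral>y. m k \<partial>(unit_ball_measure :: (real ^ 'n) measure))"
        by (intro integral_mono integrable_norm integrable_radial g) (auto simp: m)
      then show "norm (\<integral>y. norm (g k (radial y)) \<partial>unit_ball_measure) \<le> m k * measure (unit_ball_measure :: (real ^ 'n) measure) (space unit_ball_measure)"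
        by (simp add: mult.commute)
    qed
  qed
  then show ?thesis unfolding sphere_avg_eq[OF g] sphere_avg_eq[OF c] by (rule sums_scaleR_right)
qed

lemma sphere_avg_has_derivative:
  fixes \<phi> :: "'z::euclidean_space \<Rightarrow> real ^ 'n \<Rightarrow> 'b::euclidean_space"
  assumes cont: "continuous_on (UNIV \<times> sphere 0 1) (\<lambda>p. \<phi> (fst p) (snd p))"
    and der: "\<And>z w. w \<in> sphere 0 1 \<Longrightarrow> ((\<lambda>z. \<phi> z w) has_derivative \<phi>' z w) (at z)"
    and contd: "\<And>v. continuous_on (UNIV \<times> sphere 0 1) (\<lambda>p. \<phi>' (fst p) (snd p) v)"
  shows "((\<lambda>z. sphere_avg (\<phi> z)) has_derivative (\<lambda>v. sphere_avg (\<lambda>w. \<phi>' z0 w v))) (at z0)"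
proof -
  have sl: "continuous_on (sphere 0 1) (f z)" if "continuous_on (UNIV \<times> sphere 0 1) (\<lambda>p. f (fst p) (snd p))"
    for f :: "'z \<Rightarrow> real ^ 'n \<Rightarrow> 'b" and z
  proof -
    have "continuous_on (sphere 0 1) (\<lambda>w. (z, w))" by (intro continuous_intros)
    from continuous_on_compose2[OF that this] show ?thesis by auto
  qed
  have "((\<lambda>z. \<integral>y. \<phi> z (radial y) \<partial>unit_ball_measure) has_derivative (\<lambda>v. \<integral>y. \<phi>' z0 (radial y) v \<partial>unit_ball_measure)) (at z0)"
  proof (rule has_derivative_integral_compact[OF finite_unit_ball_measure radial_measurable' _ compact_sphere[of 0 1]])
    show "continuous_on (cball z0 1 \<times> sphere 0 1) (\<lambda>(z, y). \<phi> z y)"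
      unfolding case_prod_unfold by (rule continuous_on_subset[OF cont]) auto
    show "continuous_on (cball z0 1 \<times> sphere 0 1) (\<lambda>(z, y). \<phi>' z y v)" for v
      unfolding case_prod_unfold by (rule continuous_on_subset[OF contd]) auto
    show "radial y \<in> sphere 0 1" for y :: "real ^ 'n" by simp
    show "((\<lambda>z. \<phi> z w) has_derivative \<phi>' z w) (at z)" if "w \<in> sphere 0 1" for z w using that by (rule der)
  qed
  from has_derivative_scaleR_right[OF this, of "inverse (measure lborel (ball (0::real^'n) 1))"]
  show ?thesis unfolding sphere_avg_eq[OF sl[OF cont]] sphere_avg_eq[OF sl[OF contd]] .
qed

section \<open>Symmetric tensors and homogeneous polynomials\<close>

definition tpoly :: "nat \<Rightarrow> ('n::finite list \<Rightarrow> 'b::euclidean_space) \<Rightarrow> real ^ 'n \<Rightarrow> 'b" where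
  "tpoly k a x = (\<Sum>J | length J = k. mon x J *\<^sub>R a J)"

definition tnorm2 :: "nat \<Rightarrow> ('n::finite list \<Rightarrow> 'b::euclidean_space) \<Rightarrow> real" where
  "tnorm2 k a = (\<Sum>J | length J = k. (norm (a J))\<^sup>2)"

definition tsym :: "('n list \<Rightarrow> 'b) \<Rightarrow> bool" where
  "tsym a \<longleftrightarrow> (\<forall>J J'. mset J = mset J' \<longrightarrow> a J = a J')"

lemma length_0_set: "{J::'n list. length J = 0} = {[]}" by auto

lemma tpoly_0 [simp]: "tpoly 0 a x = a []"
  unfolding tpoly_def length_0_set by simp

lemma tpoly_Suc: "tpoly (Suc k) a x = (\<Sum>j\<in>UNIV. x $ j *\<^sub>R tpoly k (\<lambda>J. a (j # J)) x)"
  unfolding tpoly_def sum_lists_Suc by (simp add: scaleR_sum_right)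

lemma tnorm2_0 [simp]: "tnorm2 0 a = (norm (a []))\<^sup>2"
  unfolding tnorm2_def length_0_set by simp

lemma tnorm2_Suc: "tnorm2 (Suc k) a = (\<Sum>j\<in>UNIV. tnorm2 k (\<lambda>J. a (j # J)))"
  unfolding tnorm2_def sum_lists_Suc by simp

lemma tnorm2_nonneg: "0 \<le> tnorm2 k a"
  by (simp add: tnorm2_def sum_nonneg)

lemma norm_le_tnorm2: "length J = k \<Longrightarrow> (norm (a J))\<^sup>2 \<le> tnorm2 k a"
  unfolding tnorm2_def by (rule member_le_sum) auto

lemma norm_sum_scaleR_le:
  fixes u :: "'n::finite \<Rightarrow> 'b::real_normed_vector"
  shows "(norm (\<Sum>j\<in>UNIV. x $ j *\<^sub>R u j))\<^sup>2 \<le> (norm x)\<^sup>2 * (\<Sum>j\<in>UNIV. (norm (u j))\<^sup>2)"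
proof -
  have "norm (\<Sum>j\<in>UNIV. x $ j *\<^sub>R u j) \<le> (\<Sum>j\<in>UNIV. \<bar>x $ j\<bar> * norm (u j))"
    by (rule sum_norm_le) simp
  then have "(norm (\<Sum>j\<in>UNIV. x $ j *\<^sub>R u j))\<^sup>2 \<le> (\<Sum>j\<in>UNIV. \<bar>x $ j\<bar> * norm (u j))\<^sup>2"
    by (rule power_mono) simp
  also have "\<dots> \<le> (\<Sum>j\<in>UNIV. \<bar>x $ j\<bar>\<^sup>2) * (\<Sum>j\<in>UNIV. (norm (u j))\<^sup>2)"
    by (rule Cauchy_Schwarz_ineq_sum)
  also have "(\<Sum>j\<in>UNIV. \<bar>x $ j\<bar>\<^sup>2) = (norm x)\<^sup>2"
    unfolding power2_norm_eq_inner by (simp add: inner_vec_def power2_eq_square)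
  finally show ?thesis .
qed

text \<open>Cauchy-Schwarz for tensors: the k-th tensor power of \<open>x\<close> has norm
  \<open>|x| ^ k\<close>. That the bound carries no constant is essential in
  \<open>tnorm2_tavg_le\<close>.\<close>

lemma norm_tpoly: "(norm (tpoly k a x))\<^sup>2 \<le> (norm x) ^ (2 * k) * tnorm2 k a"
proof (induction k arbitrary: a)
  case (Suc k)
  have "(norm (tpoly (Suc k) a x))\<^sup>2 \<le> (norm x)\<^sup>2 * (\<Sum>j\<in>UNIV. (norm (tpoly k (\<lambda>J. a (j # J)) x))\<^sup>2)"
    unfolding tpoly_Suc by (rule norm_sum_scaleR_le)
  also have "\<dots> \<le> (norm x)\<^sup>2 * (\<Sum>j\<in>UNIV. (norm x) ^ (2 * k) * tnorm2 k (\<lambda>J. a (j # J)))"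
    by (intro mult_left_mono sum_mono Suc.IH) simp
  also have "\<dots> = (norm x) ^ (2 * Suc k) * tnorm2 (Suc k) a"
    by (simp add: tnorm2_Suc sum_distrib_left power2_eq_square mult.assoc)
  finally show ?case .
qed simp

lemma continuous_on_mon: "continuous_on S (\<lambda>x. mon x J)"
  by (induction J) (auto intro!: continuous_intros)

lemma continuous_on_tpoly: "continuous_on S (tpoly k a)"
  unfolding tpoly_def[abs_def] by (intro continuous_intros continuous_on_mon)

lemma mon_scaleR: "mon (c *\<^sub>R x) J = c ^ length J * mon x J"
  by (induction J) auto

lemma tpoly_scaleR: "tpoly k a (c *\<^sub>R x) = c ^ k *\<^sub>R tpoly k a x"
  unfolding tpoly_def by (simp add: mon_scaleR scaleR_sum_right)

lemma inner_power_eq_mon: "(x \<bullet> w) ^ k = (\<Sum>J | length J = k. mon x J * mon w J)"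
proof (induction k)
  case (Suc k)
  have "(x \<bullet> w) ^ Suc k = (\<Sum>j\<in>UNIV. x $ j * w $ j) * (\<Sum>J | length J = k. mon x J * mon w J)"
    by (simp only: power_Suc Suc.IH) (simp add: inner_vec_def)
  also have "\<dots> = (\<Sum>j\<in>UNIV. \<Sum>J | length J = k. mon x (j # J) * mon w (j # J))"
    by (simp only: sum_product mon_simps mult_ac)
  finally show ?case by (simp only: sum_lists_Suc)
qed (simp add: length_0_set[simplified])

lemma mon_mset: "mset J = mset J' \<Longrightarrow> mon w J = mon w J'"
  unfolding mon_def by (metis mset_map prod_mset_prod_list)

lemma tsym_Cons: "tsym a \<Longrightarrow> tsym (\<lambda>J. a (j # J))"
  by (auto simp: tsym_def)

lemma tsym_swap: "tsym a \<Longrightarrow> a (i # j # J) = a (j # i # J)"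
  by (simp add: tsym_def)

text \<open>Symmetry makes all \<open>k + 1\<close> slots of the tensor equivalent, so the product
  rule gives \<open>k + 1\<close> times the contraction of the first slot.\<close>

lemma tpoly_has_derivative:
  fixes a :: "'n::finite list \<Rightarrow> 'b::euclidean_space"
  assumes "tsym a"
  shows "(tpoly (Suc k) a has_derivative (\<lambda>v. real (Suc k) *\<^sub>R (\<Sum>j\<in>UNIV. v $ j *\<^sub>R tpoly k (\<lambda>J. a (j # J)) x))) (at x)"
  using assms
proof (induction k arbitrary: a)
  case 0
  have nth: "((\<lambda>x. x $ j) has_derivative (\<lambda>v. v $ j)) (at x)" for j
    by (rule bounded_linear.has_derivative[OF bounded_linear_vec_nth has_derivative_ident])
  have "tpoly (Suc 0) a = (\<lambda>x. \<Sum>j\<in>UNIV. x $ j *\<^sub>R a [j])" by (auto simp: tpoly_Suc)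
  moreover have "((\<lambda>x. \<Sum>j\<in>UNIV. x $ j *\<^sub>R a [j]) has_derivative (\<lambda>v. \<Sum>j\<in>UNIV. v $ j *\<^sub>R a [j])) (at x)"
    by (intro has_derivative_sum has_derivative_scaleR_left nth)
  ultimately show ?case by simp
next
  case (Suc k)
  let ?a = "\<lambda>j J. a (j # J)"
  have nth: "((\<lambda>x. x $ j) has_derivative (\<lambda>v. v $ j)) (at x)" for j
    by (rule bounded_linear.has_derivative[OF bounded_linear_vec_nth has_derivative_ident])
  have "((\<lambda>x. \<Sum>j\<in>UNIV. x $ j *\<^sub>R tpoly (Suc k) (?a j) x) has_derivative
     (\<lambda>v. \<Sum>j\<in>UNIV. x $ j *\<^sub>R (real (Suc k) *\<^sub>R (\<Sum>i\<in>UNIV. v $ i *\<^sub>R tpoly k (\<lambda>J. a (j # i # J)) x)) + v $ j *\<^sub>R tpoly (Suc k) (?a j) x)) (at x)"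
    by (intro has_derivative_sum has_derivative_scaleR nth Suc.IH tsym_Cons Suc.prems)
  moreover have "(\<Sum>j\<in>UNIV. x $ j *\<^sub>R (real (Suc k) *\<^sub>R (\<Sum>i\<in>UNIV. v $ i *\<^sub>R tpoly k (\<lambda>J. a (j # i # J)) x)) + v $ j *\<^sub>R tpoly (Suc k) (?a j) x)
      = real (Suc (Suc k)) *\<^sub>R (\<Sum>j\<in>UNIV. v $ j *\<^sub>R tpoly (Suc k) (?a j) x)" for v
  proof -
    have "(\<Sum>j\<in>UNIV. x $ j *\<^sub>R (real (Suc k) *\<^sub>R (\<Sum>i\<in>UNIV. v $ i *\<^sub>R tpoly k (\<lambda>J. a (j # i # J)) x)))
       = (\<Sum>j\<in>UNIV. \<Sum>i\<in>UNIV. real (Suc k) *\<^sub>R v $ i *\<^sub>R x $ j *\<^sub>R tpoly k (\<lambda>J. a (i # j # J)) x)"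
      unfolding tsym_swap[OF Suc.prems] scaleR_sum_right by (intro sum.cong refl) (simp add: mult_ac)
    also have "\<dots> = (\<Sum>i\<in>UNIV. \<Sum>j\<in>UNIV. real (Suc k) *\<^sub>R v $ i *\<^sub>R x $ j *\<^sub>R tpoly k (\<lambda>J. a (i # j # J)) x)"
      by (rule sum.swap)
    also have "\<dots> = real (Suc k) *\<^sub>R (\<Sum>i\<in>UNIV. v $ i *\<^sub>R tpoly (Suc k) (?a i) x)"
      unfolding tpoly_Suc scaleR_sum_right ..
    finally have e: "(\<Sum>j\<in>UNIV. x $ j *\<^sub>R (real (Suc k) *\<^sub>R (\<Sum>i\<in>UNIV. v $ i *\<^sub>R tpoly k (\<lambda>J. a (j # i # J)) x)))
       = real (Suc k) *\<^sub>R (\<Sum>i\<in>UNIV. v $ i *\<^sub>R tpoly (Suc k) (?a i) x)" .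
    have "real (Suc (Suc k)) = real (Suc k) + 1" by simp
    then show ?thesis unfolding sum.distrib e by (simp only: scaleR_add_left scaleR_one)
  qed
  ultimately show ?case unfolding tpoly_Suc[of "Suc k" a, abs_def] by simp
qed

section \<open>Polarisation by finite differences\<close>

fun fdiff :: "'n::finite list \<Rightarrow> (real ^ 'n \<Rightarrow> 'b::real_normed_vector) \<Rightarrow> real ^ 'n \<Rightarrow> 'b" where
  "fdiff [] g x = g x"
| "fdiff (j # J) g x = fdiff J g (x + axis j 1) - fdiff J g x"

lemma fdiff_scaleR: "fdiff J (\<lambda>x. c *\<^sub>R g x) x = c *\<^sub>R fdiff J g x"
  by (induction J arbitrary: x) (auto simp: scaleR_diff_right)

lemma fdiff_has_derivative:
  assumes "\<And>x. (g has_derivative g' x) (at x)"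
  shows "(fdiff J g has_derivative (\<lambda>v. fdiff J (\<lambda>z. g' z v) x)) (at x)"
proof (induction J arbitrary: x)
  case (Cons j J)
  have "((\<lambda>x. x + axis j 1) has_derivative (\<lambda>v. v)) (at x)" by (auto intro!: derivative_eq_intros)
  from has_derivative_diff[OF has_derivative_compose[OF this Cons.IH] Cons.IH]
  have "((\<lambda>x. fdiff J g (x + axis j 1) - fdiff J g x) has_derivative
      (\<lambda>v. fdiff J (\<lambda>z. g' z v) (x + axis j 1) - fdiff J (\<lambda>z. g' z v) x)) (at x)" .
  then show ?case by (simp only: fdiff.simps[abs_def])
next
  case Nil
  have "fdiff [] g = g" by (rule ext) simp
  then show ?case using assms by simp
qed

lemma fdiff_bound:
  assumes "\<And>z. norm z \<le> norm x + real (length J) \<Longrightarrow> norm (g z) \<le> M"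
  shows "norm (fdiff J g x) \<le> 2 ^ length J * M"
  using assms
proof (induction J arbitrary: x)
  case (Cons j J)
  have n: "norm (x + axis j 1) \<le> norm x + 1" using norm_triangle_ineq[of x "axis j 1"] by simp
  have "norm (fdiff J g (x + axis j 1)) \<le> 2 ^ length J * M" "norm (fdiff J g x) \<le> 2 ^ length J * M"
    using n by (intro Cons.IH Cons.prems; simp)+
  then show ?case using norm_triangle_ineq4[of "fdiff J g (x + axis j 1)" "fdiff J g x"] by simp
qed simp

text \<open>Every difference lowers the degree by one, so \<open>k\<close> differences of a form of
  degree \<open>k\<close> leave a constant, its polarisation, whatever the base point
  \<open>x\<close>.\<close>

lemma polarization:
  fixes a :: "'n::finite list \<Rightarrow> 'b::euclidean_space"
  assumes "tsym a" "length J = k"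
  shows "fdiff J (tpoly k a) x = fact k *\<^sub>R a J"
  using assms
proof (induction J arbitrary: k a x)
  case (Cons j J)
  then obtain k' where k: "k = Suc k'" "length J = k'" by auto
  let ?c = "fact (Suc k') *\<^sub>R a (j # J)"
  \<comment> \<open>The first difference is \<open>u 1 - u 0\<close>. The induction hypothesis,
    applied to the derivative of the form in direction \<open>j\<close>, shows that \<open>u\<close>
    has the constant velocity \<open>?c\<close>.\<close>
  define u where "u t = fdiff J (tpoly (Suc k') a) (x + t *\<^sub>R axis j 1)" for t :: real
  have d: "(u has_derivative (\<lambda>s. s *\<^sub>R ?c)) (at t)" for t
  proof -
    let ?y = "x + t *\<^sub>R axis j 1"
    define G where "G = fdiff J (tpoly (Suc k') a)"
    have lin: "linear (\<lambda>v. real (Suc k') *\<^sub>R (\<Sum>i\<in>UNIV. v $ i *\<^sub>R tpoly k' (\<lambda>J. a (i # J)) z))" for z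
      using tpoly_has_derivative[OF Cons.prems(1)] by (rule has_derivative_linear)
    have "(G has_derivative (\<lambda>v. fdiff J (\<lambda>z. real (Suc k') *\<^sub>R (\<Sum>i\<in>UNIV. v $ i *\<^sub>R tpoly k' (\<lambda>J. a (i # J)) z)) ?y)) (at ?y)"
      unfolding G_def by (rule fdiff_has_derivative[OF tpoly_has_derivative[OF Cons.prems(1)]])
    then have "((\<lambda>t. G (x + t *\<^sub>R axis j 1)) has_derivative
        (\<lambda>s. fdiff J (\<lambda>z. real (Suc k') *\<^sub>R (\<Sum>i\<in>UNIV. (s *\<^sub>R axis j 1) $ i *\<^sub>R tpoly k' (\<lambda>J. a (i # J)) z)) ?y)) (at t)"
      by (rule has_derivative_compose[OF has_derivative_line[of x "axis j 1" t]])
    moreover have "(\<Sum>i\<in>UNIV. (s *\<^sub>R axis j 1) $ i *\<^sub>R tpoly k' (\<lambda>J. a (i # J)) z) = s *\<^sub>R tpoly k' (\<lambda>J. a (j # J)) z" for s z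
      by (simp add: axis_def if_distrib[of "\<lambda>c. c *\<^sub>R _"] if_distrib[of "(*) _"] cong: if_cong)
    moreover have "fdiff J (tpoly k' (\<lambda>J. a (j # J))) ?y = fact k' *\<^sub>R a (j # J)"
      by (rule Cons.IH[OF tsym_Cons[OF Cons.prems(1)] k(2)])
    ultimately show ?thesis
      unfolding u_def[abs_def] G_def by (simp add: fdiff_scaleR mult.commute mult.left_commute)
  qed
  have "((\<lambda>t. u t - t *\<^sub>R ?c) has_derivative (\<lambda>s. 0)) (at t)" for t
  proof -
    have "((\<lambda>t. t *\<^sub>R ?c) has_derivative (\<lambda>s. s *\<^sub>R ?c)) (at t)"
      by (rule has_derivative_scaleR_left[OF has_derivative_ident])
    from has_derivative_diff[OF d this] show ?thesis by (simp only: diff_self)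
  qed
  then have "u 1 - 1 *\<^sub>R ?c = u 0 - 0 *\<^sub>R ?c"
    using has_derivative_zero_unique[of UNIV "\<lambda>t. u t - t *\<^sub>R ?c"] convex_UNIV by (metis UNIV_I)
  then show ?case unfolding k u_def by (simp add: algebra_simps)
qed simp

text \<open>Polarisation at 0 evaluates the form at points of norm at most \<open>k\<close>, with
  \<open>2 ^ k\<close> terms. Homogeneity contributes \<open>k ^ k\<close>, and division by
  \<open>fact k\<close> leaves an exponential constant.\<close>

lemma tensor_le_sphere_sup:
  fixes a :: "'n::finite list \<Rightarrow> 'b::euclidean_space"
  assumes a: "tsym a" "length J = k" and M: "\<And>w. w \<in> sphere 0 1 \<Longrightarrow> norm (tpoly k a w) \<le> M"
  shows "norm (a J) \<le> (2 * exp 1) ^ k * M"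
proof -
  have M0: "0 \<le> M" using order_trans[OF norm_ge_zero M[of "axis undefined 1"]] by simp
  have all: "norm (tpoly k a z) \<le> norm z ^ k * M" for z
  proof (cases "z = 0")
    case True
    have "norm (tpoly k a (0 *\<^sub>R axis undefined 1)) \<le> 0 ^ k * M"
      unfolding tpoly_scaleR using M[of "axis undefined 1"] by (cases k) simp_all
    then show ?thesis using True by simp
  next
    case False
    have "norm (tpoly k a (norm z *\<^sub>R (z /\<^sub>R norm z))) = norm z ^ k * norm (tpoly k a (z /\<^sub>R norm z))"
      unfolding tpoly_scaleR by simp
    then show ?thesis using False M[of "z /\<^sub>R norm z"] by (simp add: mult_left_mono)
  qed
  have "norm (fdiff J (tpoly k a) 0) \<le> 2 ^ length J * (real k ^ k * M)"
  proof (rule fdiff_bound)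
    fix z :: "real ^ 'n" assume "norm z \<le> norm (0::real^'n) + real (length J)"
    then have "norm z ^ k * M \<le> real k ^ k * M" using a(2) M0 by (intro mult_right_mono power_mono) auto
    then show "norm (tpoly k a z) \<le> real k ^ k * M" using all order_trans by blast
  qed
  then have "fact k * norm (a J) \<le> 2 ^ k * (real k ^ k * M)"
    unfolding polarization[OF a] using a(2) by simp
  also have "\<dots> \<le> 2 ^ k * ((fact k * exp 1 ^ k) * M)"
    by (intro mult_left_mono mult_right_mono power_self_le_fact M0) simp
  also have "\<dots> = fact k * ((2 * exp 1) ^ k * M)" by (simp add: power_mult_distrib mult_ac)
  finally show ?thesis by (simp add: mult_le_cancel_left)
qed

lemma tnorm2_le: "(\<And>J. length J = k \<Longrightarrow> norm (a J) \<le> \<mu>) \<Longrightarrow> tnorm2 k a \<le> real CARD('n) ^ k * \<mu>\<^sup>2"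
  for a :: "'n::finite list \<Rightarrow> 'b::euclidean_space"
proof -
  assume a: "\<And>J. length J = k \<Longrightarrow> norm (a J) \<le> \<mu>"
  have "tnorm2 k a \<le> (\<Sum>J::'n list | length J = k. \<mu>\<^sup>2)"
    unfolding tnorm2_def by (intro sum_mono power_mono a) auto
  then show ?thesis by (simp add: card_lists_length)
qed

lemma tpoly_lipschitz:
  fixes a :: "'n::finite list \<Rightarrow> 'b::euclidean_space"
  assumes a: "tsym a" and xy: "x \<in> cball 0 1" "y \<in> cball 0 1"
  shows "norm (tpoly (Suc k) a x - tpoly (Suc k) a y) \<le> real (Suc k) * sqrt (tnorm2 (Suc k) a) * norm (x - y)"
proof (rule differentiable_bound[OF convex_cball[of 0 1] _ _ xy])
  fix z :: "real ^ 'n" assume z: "z \<in> cball 0 1"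
  show "(tpoly (Suc k) a has_derivative (\<lambda>v. real (Suc k) *\<^sub>R (\<Sum>j\<in>UNIV. v $ j *\<^sub>R tpoly k (\<lambda>J. a (j # J)) z))) (at z within cball 0 1)"
    by (rule has_derivative_at_withinI[OF tpoly_has_derivative[OF a]])
  show "onorm (\<lambda>v. real (Suc k) *\<^sub>R (\<Sum>j\<in>UNIV. v $ j *\<^sub>R tpoly k (\<lambda>J. a (j # J)) z)) \<le> real (Suc k) * sqrt (tnorm2 (Suc k) a)"
  proof (rule onorm_le)
    fix v :: "real ^ 'n"
    have "(norm (\<Sum>j\<in>UNIV. v $ j *\<^sub>R tpoly k (\<lambda>J. a (j # J)) z))\<^sup>2 \<le> (norm v)\<^sup>2 * (\<Sum>j\<in>UNIV. (norm (tpoly k (\<lambda>J. a (j # J)) z))\<^sup>2)"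
      by (rule norm_sum_scaleR_le)
    also have "\<dots> \<le> (norm v)\<^sup>2 * (\<Sum>j\<in>UNIV. tnorm2 k (\<lambda>J. a (j # J)))"
    proof (intro mult_left_mono sum_mono)
      fix j
      have "(norm (tpoly k (\<lambda>J. a (j # J)) z))\<^sup>2 \<le> norm z ^ (2 * k) * tnorm2 k (\<lambda>J. a (j # J))" by (rule norm_tpoly)
      also have "\<dots> \<le> 1 * tnorm2 k (\<lambda>J. a (j # J))"
        using z by (intro mult_right_mono power_le_one tnorm2_nonneg) auto
      finally show "(norm (tpoly k (\<lambda>J. a (j # J)) z))\<^sup>2 \<le> tnorm2 k (\<lambda>J. a (j # J))" by simp
    qed simp
    also have "\<dots> = (norm v)\<^sup>2 * tnorm2 (Suc k) a" by (simp only: tnorm2_Suc)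
    finally have "norm (\<Sum>j\<in>UNIV. v $ j *\<^sub>R tpoly k (\<lambda>J. a (j # J)) z) \<le> sqrt ((norm v)\<^sup>2 * tnorm2 (Suc k) a)"
      by (rule real_le_rsqrt)
    also have "\<dots> = sqrt (tnorm2 (Suc k) a) * norm v" by (simp add: real_sqrt_mult)
    finally have "real (Suc k) * norm (\<Sum>j\<in>UNIV. v $ j *\<^sub>R tpoly k (\<lambda>J. a (j # J)) z) \<le> real (Suc k) * (sqrt (tnorm2 (Suc k) a) * norm v)"
      by (rule mult_left_mono) simp
    then show "norm (real (Suc k) *\<^sub>R (\<Sum>j\<in>UNIV. v $ j *\<^sub>R tpoly k (\<lambda>J. a (j # J)) z)) \<le> real (Suc k) * sqrt (tnorm2 (Suc k) a) * norm v"
      by (simp add: mult.assoc)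
  qed
qed

text \<open>Let \<open>M\<close> be the maximum of \<open>|P_a|\<close> on the sphere. Polarisation
  bounds \<open>|a|\<close> by \<open>q * M\<close> with \<open>q\<close> exponential in
  \<open>k\<close>, and hence the Lipschitz constant by \<open>k * q * M\<close>. So
  \<open>|P_a| \<ge> M / 2\<close> on a cap of radius \<open>1 / (2 * k * q)\<close>; as the
  dimension is fixed, the share of this cap decays at most exponentially in
  \<open>k\<close>.\<close>

lemma tnorm2_le_sphere_avg:
  "\<exists>C\<ge>1. \<forall>k (a :: 'n::finite list \<Rightarrow> 'b::euclidean_space). tsym a \<longrightarrow> tnorm2 k a \<le> C ^ Suc k * sphere_avg (\<lambda>w. (norm (tpoly k a w))\<^sup>2)"
proof (intro exI conjI allI impI)
  define n where "n = CARD('n)"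
  define Q where "Q = 2 * exp 1 * real n"
  define C where "C = 4 * 16 ^ n * (Q\<^sup>2 * (2 * Q) ^ n)"
  have n1: "1 \<le> real n" by (simp add: n_def Suc_leI)
  have Q1: "1 \<le> Q" unfolding Q_def using n1 mult_mono[of 1 "2 * exp 1 :: real" 1 "real n"] by (simp add: order_trans[OF _ exp_ge_add_one_self[of 1]] mult_ge1_I)
  have C0: "1 \<le> Q\<^sup>2 * (2 * Q) ^ n" using Q1 by (intro mult_ge1_I one_le_power) auto
  have C1: "1 \<le> (4 * 16 ^ n :: real)" by (intro mult_ge1_I one_le_power) auto
  show "1 \<le> C" unfolding C_def using C0 C1 by (rule mult_ge1_I[rotated])
  fix k and a :: "'n list \<Rightarrow> 'b" assume a: "tsym a"
  have cont: "continuous_on S (\<lambda>w. (norm (tpoly k a w))\<^sup>2)" for S by (intro continuous_intros continuous_on_tpoly)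
  show "tnorm2 k a \<le> C ^ Suc k * sphere_avg (\<lambda>w. (norm (tpoly k a w))\<^sup>2)"
  proof (cases k)
    case 0
    then show ?thesis using mult_right_mono[OF \<open>1 \<le> C\<close>, of "(norm (a []))\<^sup>2"] by simp
  next
    case (Suc k')
    have "\<exists>w0\<in>sphere (0::real^'n) 1. \<forall>w\<in>sphere 0 1. norm (tpoly k a w) \<le> norm (tpoly k a w0)"
      by (rule continuous_attains_sup) (auto intro!: continuous_intros continuous_on_tpoly)
    then obtain w0 where w0: "w0 \<in> sphere (0::real^'n) 1" and max: "\<And>w. w \<in> sphere 0 1 \<Longrightarrow> norm (tpoly k a w) \<le> norm (tpoly k a w0)"
      by blast
    define M where "M = norm (tpoly k a w0)"
    have M0: "0 \<le> M" by (simp add: M_def)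
    define q where "q = Q ^ k"
    have q1: "1 \<le> q" using Q1 by (simp add: q_def)
    have "tnorm2 k a \<le> real n ^ k * ((2 * exp 1) ^ k * M)\<^sup>2"
      unfolding n_def using max by (intro tnorm2_le tensor_le_sphere_sup a) (auto simp: M_def)
    \<comment> \<open>Squaring \<open>n ^ k\<close> is wasteful but makes the bound a perfect
      square.\<close>
    also have "\<dots> \<le> (real n ^ k)\<^sup>2 * ((2 * exp 1) ^ k * M)\<^sup>2"
      using n1 by (intro mult_right_mono) (auto simp: power2_eq_square mult_le_cancel_left1)
    also have "\<dots> = (q * M)\<^sup>2" by (simp add: q_def Q_def power_mult_distrib mult_ac)
    finally have tn: "tnorm2 k a \<le> (q * M)\<^sup>2" .
    then have sq: "sqrt (tnorm2 k a) \<le> q * M" using q1 M0 by (intro real_le_lsqrt tnorm2_nonneg) auto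
    \<comment> \<open>The radius at which the Lipschitz bound allows a drop of exactly
      \<open>M / 2\<close>.\<close>
    define \<delta> where "\<delta> = 1 / (2 * real k * q)"
    have kpos: "0 < real k" "1 \<le> real k" using Suc by auto
    have kq: "1 \<le> real k * q" using kpos q1 by (intro mult_ge1_I)
    have \<delta>: "0 < \<delta>" "\<delta> \<le> 1" using kq by (auto simp: \<delta>_def field_simps)
    have "(M / 2)\<^sup>2 * (\<delta> / 8) ^ CARD('n) \<le> sphere_avg (\<lambda>w. (norm (tpoly k a w))\<^sup>2)"
    proof (rule sphere_avg_cap[OF cont _ w0 \<delta>])
      fix w :: "real ^ 'n" assume w: "w \<in> sphere 0 1" "dist w w0 < \<delta>"
      have "norm (tpoly k a w0 - tpoly k a w) \<le> real k * sqrt (tnorm2 k a) * norm (w0 - w)"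
        unfolding Suc using w w0 by (intro tpoly_lipschitz a) auto
      also have "\<dots> \<le> real k * (q * M) * \<delta>"
        using sq w kpos q1 M0 by (intro mult_mono) (auto simp: dist_norm norm_minus_commute tnorm2_nonneg)
      also have "\<dots> = M / 2" using kpos q1 by (simp add: \<delta>_def)
      finally have "norm (tpoly k a w0 - tpoly k a w) \<le> M / 2" .
      then have "M / 2 \<le> norm (tpoly k a w)" using norm_triangle_sub[of "tpoly k a w0" "tpoly k a w"] unfolding M_def by linarith
      then show "(M / 2)\<^sup>2 \<le> (norm (tpoly k a w))\<^sup>2" using M0 by (intro power_mono) auto
    qed auto
    moreover have "(M / 2)\<^sup>2 * (\<delta> / 8) ^ CARD('n) = M\<^sup>2 / (4 * (16 * real k * q) ^ n)"
      by (simp add: \<delta>_def n_def power_divide power2_eq_square power_mult_distrib)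
    ultimately have "M\<^sup>2 / (4 * (16 * real k * q) ^ n) \<le> sphere_avg (\<lambda>w. (norm (tpoly k a w))\<^sup>2)" by simp
    then have M2: "M\<^sup>2 \<le> sphere_avg (\<lambda>w. (norm (tpoly k a w))\<^sup>2) * (4 * (16 * real k * q) ^ n)"
      using kpos q1 by (subst (asm) pos_divide_le_eq) auto
    have avg0: "0 \<le> sphere_avg (\<lambda>w. (norm (tpoly k a w))\<^sup>2)"
      using sphere_avg_mono[OF continuous_on_const[of _ 0] cont] by simp
    have "tnorm2 k a \<le> q\<^sup>2 * M\<^sup>2" using tn by (simp add: power_mult_distrib)
    also have "\<dots> \<le> q\<^sup>2 * (sphere_avg (\<lambda>w. (norm (tpoly k a w))\<^sup>2) * (4 * (16 * real k * q) ^ n))"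
      by (intro mult_left_mono M2) simp
    also have "\<dots> = (q\<^sup>2 * (4 * (16 * real k * q) ^ n)) * sphere_avg (\<lambda>w. (norm (tpoly k a w))\<^sup>2)" by simp
    also have "\<dots> \<le> C ^ Suc k * sphere_avg (\<lambda>w. (norm (tpoly k a w))\<^sup>2)"
    proof (rule mult_right_mono[OF _ avg0])
      \<comment> \<open>Absorbs the polynomial factor into the exponential constant.\<close>
      have "real k \<le> 2 ^ k" using of_nat_less_two_power[of k, where 'a=real] by simp
      then have "q\<^sup>2 * (4 * (16 * real k * q) ^ n) \<le> q\<^sup>2 * (4 * (16 * 2 ^ k * q) ^ n)"
        using q1 kpos by (intro mult_left_mono power_mono mult_right_mono) auto
      also have "\<dots> = (4 * 16 ^ n) * (Q\<^sup>2 * (2 * Q) ^ n) ^ k"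
        by (simp add: q_def power_mult_distrib power_mult[symmetric] mult_ac)
      also have "\<dots> \<le> C * C ^ k"
      proof (rule mult_mono)
        show "4 * 16 ^ n \<le> C" unfolding C_def using C0 C1 by (simp add: mult_le_cancel_left1)
        show "(Q\<^sup>2 * (2 * Q) ^ n) ^ k \<le> C ^ k" unfolding C_def using C0 C1 by (intro power_mono) (simp_all add: mult_le_cancel_right1)
      qed (use \<open>1 \<le> C\<close> C0 in auto)
      finally show "q\<^sup>2 * (4 * (16 * real k * q) ^ n) \<le> C ^ Suc k" by simp
    qed
    finally show ?thesis .
  qed
qed

section \<open>The averaging operator on tensors\<close>

definition tavg :: "nat \<Rightarrow> ('n::finite list \<Rightarrow> 'b::euclidean_space) \<Rightarrow> 'n list \<Rightarrow> 'b" where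
  "tavg k a J = sphere_avg (\<lambda>w. mon w J *\<^sub>R tpoly k a w)"

text \<open>The operator is given by a finite real matrix, the Gram matrix of the monomials in
  quadratic mean on the sphere. It therefore commutes with entrywise convergent series, such as the
  Neumann series in \<open>tavg_inverse\<close>.\<close>

lemma tavg_eq: "tavg k a J = (\<Sum>I | length I = k. sphere_avg (\<lambda>w. mon w J * mon w I) *\<^sub>R a I)"
proof -
  have "tavg k a J = sphere_avg (\<lambda>w. \<Sum>I | length I = k. (mon w J * mon w I) *\<^sub>R a I)"
    unfolding tavg_def tpoly_def by (simp add: scaleR_sum_right)
  also have "\<dots> = (\<Sum>I | length I = k. sphere_avg (\<lambda>w. (mon w J * mon w I) *\<^sub>R a I))"
    by (intro sphere_avg_sum continuous_intros continuous_on_mon)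
  also have "\<dots> = (\<Sum>I | length I = k. sphere_avg (\<lambda>w. mon w J * mon w I) *\<^sub>R a I)"
    by (intro sum.cong refl sphere_avg_bounded_linear[OF bounded_linear_scaleR_left] continuous_intros continuous_on_mon)
  finally show ?thesis .
qed

lemma tsym_tavg: "tsym (tavg k a)"
  unfolding tsym_def
proof (intro allI impI)
  fix J J' :: "'a list" assume "mset J = mset J'"
  then have "mon w J = mon w J'" for w by (rule mon_mset)
  then show "tavg k a J = tavg k a J'" by (simp only: tavg_def)
qed

lemma sphere_avg_inner_power: "sphere_avg (\<lambda>w. (x \<bullet> w) ^ k *\<^sub>R tpoly k a w) = tpoly k (tavg k a) x"
proof -
  have "sphere_avg (\<lambda>w. (x \<bullet> w) ^ k *\<^sub>R tpoly k a w) = sphere_avg (\<lambda>w. \<Sum>J | length J = k. mon x J *\<^sub>R (mon w J *\<^sub>R tpoly k a w))"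
    unfolding inner_power_eq_mon by (simp add: scaleR_sum_left)
  also have "\<dots> = (\<Sum>J | length J = k. sphere_avg (\<lambda>w. mon x J *\<^sub>R (mon w J *\<^sub>R tpoly k a w)))"
    by (intro sphere_avg_sum continuous_intros continuous_on_mon continuous_on_tpoly)
  also have "\<dots> = tpoly k (tavg k a) x"
    unfolding tpoly_def[of k "tavg k a"] tavg_def
    by (intro sum.cong refl sphere_avg_bounded_linear[OF bounded_linear_scaleR_right] continuous_intros continuous_on_mon continuous_on_tpoly)
  finally show ?thesis .
qed

lemma sum_inner_tavg:
  "(\<Sum>J | length J = k. b J \<bullet> tavg k a J) = sphere_avg (\<lambda>w. tpoly k b w \<bullet> tpoly k a w)"
proof -
  have "b J \<bullet> tavg k a J = sphere_avg (\<lambda>w. b J \<bullet> (mon w J *\<^sub>R tpoly k a w))" for J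
    unfolding tavg_def by (intro sphere_avg_bounded_linear[symmetric] bounded_linear_inner_right continuous_intros continuous_on_mon continuous_on_tpoly)
  then have "(\<Sum>J | length J = k. b J \<bullet> tavg k a J) = sphere_avg (\<lambda>w. \<Sum>J | length J = k. b J \<bullet> (mon w J *\<^sub>R tpoly k a w))"
    by (subst sphere_avg_sum) (intro continuous_intros continuous_on_mon continuous_on_tpoly, simp)
  also have "\<dots> = sphere_avg (\<lambda>w. tpoly k b w \<bullet> tpoly k a w)"
    unfolding tpoly_def[of k b] by (simp add: inner_sum_left)
  finally show ?thesis .
qed

text \<open>In operator form \<open>|T a|^2 \<le> <T a, a>\<close>. The left side is the mean of
  \<open>P_(T a) \<bullet> P_a\<close>; on the sphere \<open>|P_(T a)| \<le> |T a|\<close>, and the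
  inequality between arithmetic and geometric means allows half of the left side to be
  absorbed.\<close>

lemma tnorm2_tavg_le: "tnorm2 k (tavg k a) \<le> sphere_avg (\<lambda>w. (norm (tpoly k a w))\<^sup>2)"
proof -
  let ?T = "tavg k a"
  have "tnorm2 k ?T = sphere_avg (\<lambda>w. tpoly k ?T w \<bullet> tpoly k a w)"
    unfolding sum_inner_tavg[symmetric] tnorm2_def by (simp add: power2_norm_eq_inner)
  also have "\<dots> \<le> sphere_avg (\<lambda>w. (1/2) * tnorm2 k ?T + (1/2) * (norm (tpoly k a w))\<^sup>2)"
  proof (rule sphere_avg_mono)
    fix w :: "real ^ 'a" assume "w \<in> sphere 0 1"
    then have T: "(norm (tpoly k ?T w))\<^sup>2 \<le> tnorm2 k ?T" using norm_tpoly[of k ?T w] by simp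
    have "tpoly k ?T w \<bullet> tpoly k a w \<le> norm (tpoly k ?T w) * norm (tpoly k a w)" by (rule norm_cauchy_schwarz)
    also have "\<dots> \<le> (1/2) * (norm (tpoly k ?T w))\<^sup>2 + (1/2) * (norm (tpoly k a w))\<^sup>2"
      using sum_squares_bound[of "norm (tpoly k ?T w)" "norm (tpoly k a w)"] by simp
    finally show "tpoly k ?T w \<bullet> tpoly k a w \<le> (1/2) * tnorm2 k ?T + (1/2) * (norm (tpoly k a w))\<^sup>2" using T by simp
  qed (intro continuous_intros continuous_on_tpoly)+
  also have "\<dots> = (1/2) * tnorm2 k ?T + (1/2) * sphere_avg (\<lambda>w. (norm (tpoly k a w))\<^sup>2)"
  proof (subst sphere_avg_add)
    show "continuous_on (sphere 0 1) (\<lambda>w. 1 / 2 * (norm (tpoly k a w))\<^sup>2)" by (intro continuous_intros continuous_on_tpoly)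
    have "sphere_avg (\<lambda>w. (1/2) * (norm (tpoly k a w))\<^sup>2) = (1/2) * sphere_avg (\<lambda>w. (norm (tpoly k a w))\<^sup>2)"
      by (rule sphere_avg_bounded_linear[OF bounded_linear_mult_right]) (intro continuous_intros continuous_on_tpoly)
    then show "sphere_avg (\<lambda>w. 1 / 2 * tnorm2 k (tavg k a)) + sphere_avg (\<lambda>w. 1 / 2 * (norm (tpoly k a w))\<^sup>2) =
      1 / 2 * tnorm2 k (tavg k a) + 1 / 2 * sphere_avg (\<lambda>w. (norm (tpoly k a w))\<^sup>2)" by (simp only: sphere_avg_const)
  qed (rule continuous_on_const)
  finally show ?thesis by simp
qed

text \<open>A vanishing form has vanishing polarisation, so \<open>T a = 0\<close>; then
  \<open><T a, a> = 0\<close>, and the lower bound gives \<open>a = 0\<close>.\<close>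

lemma tavg_injective:
  fixes a :: "'n::finite list \<Rightarrow> 'b::euclidean_space"
  assumes a: "tsym a" and z: "\<And>x. tpoly k (tavg k a) x = 0" and J: "length J = k"
  shows "a J = 0"
proof -
  have "tavg k a I = 0" if "length I = k" for I
  proof -
    have "norm (tavg k a I) \<le> (2 * exp 1) ^ k * 0"
      by (rule tensor_le_sphere_sup[OF tsym_tavg that]) (simp add: z)
    then show ?thesis by simp
  qed
  then have "(\<Sum>I | length I = k. a I \<bullet> tavg k a I) = 0" by (intro sum.neutral) simp
  then have "sphere_avg (\<lambda>w. (norm (tpoly k a w))\<^sup>2) = 0"
    unfolding sum_inner_tavg power2_norm_eq_inner .
  moreover obtain C :: real where "\<forall>k (a :: 'n list \<Rightarrow> 'b). tsym a \<longrightarrow> tnorm2 k a \<le> C ^ Suc k * sphere_avg (\<lambda>w. (norm (tpoly k a w))\<^sup>2)"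
    using tnorm2_le_sphere_avg[where 'n='n and 'b='b] by (elim exE conjE)
  then have "tnorm2 k a \<le> C ^ Suc k * sphere_avg (\<lambda>w. (norm (tpoly k a w))\<^sup>2)" using a by blast
  ultimately have "tnorm2 k a \<le> 0" by simp
  with norm_le_tnorm2[OF J, of a] have "(norm (a J))\<^sup>2 \<le> 0" by (rule order_trans)
  then show ?thesis by simp
qed

lemma tsymD: "tsym a \<Longrightarrow> mset J = mset J' \<Longrightarrow> a J = a J'"
  unfolding tsym_def by blast

text \<open>The inverse is the sum of all \<open>(1 - T)^m a\<close>. Since
  \<open>T^2 \<le> T\<close>, and \<open>T \<ge> 1 / c\<close> on symmetric tensors, \<open>|(1 - T)
  r|^2 \<le> |r|^2 - <T r, r> \<le> (1 - 1 / c) * |r|^2\<close>. The iterates remain symmetric, so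
  the lower bound is available at each stage.\<close>

lemma tavg_inverse:
  "\<exists>C\<ge>1. \<forall>k (a :: 'n::finite list \<Rightarrow> 'b::euclidean_space) \<mu>. tsym a \<longrightarrow> (\<forall>J. length J = k \<longrightarrow> norm (a J) \<le> \<mu>) \<longrightarrow>
     (\<exists>b. tsym b \<and> (\<forall>J. length J = k \<longrightarrow> tavg k b J = a J) \<and> (\<forall>J. length J = k \<longrightarrow> norm (b J) \<le> C ^ Suc k * \<mu>))"
proof -
  obtain C0 where C0: "C0 \<ge> 1" and low0: "\<forall>k (a :: 'n::finite list \<Rightarrow> 'b). tsym a \<longrightarrow> tnorm2 k a \<le> C0 ^ Suc k * sphere_avg (\<lambda>w. (norm (tpoly k a w))\<^sup>2)"
    using tnorm2_le_sphere_avg[where 'n='n and 'b='b] by (elim exE conjE)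
  have low: "tnorm2 k a \<le> C0 ^ Suc k * sphere_avg (\<lambda>w. (norm (tpoly k a w))\<^sup>2)" if "tsym a" for k and a :: "'n list \<Rightarrow> 'b"
    by (rule low0[rule_format, OF that])
  define n where "n = real CARD('n)"
  have n1: "1 \<le> n" by (simp add: n_def Suc_leI)
  \<comment> \<open>The 2 comes from the sum of the geometric series, \<open>n\<close> from
    estimating the tensor norm by its entries.\<close>
  define C where "C = 2 * C0 * n"
  have C1: "1 \<le> C" using C0 n1 unfolding C_def by (intro mult_ge1_I) auto
  have main: "\<exists>b. tsym b \<and> (\<forall>J. length J = k \<longrightarrow> tavg k b J = a J) \<and> (\<forall>J. length J = k \<longrightarrow> norm (b J) \<le> C ^ Suc k * \<mu>)"
    if a: "tsym a" and \<mu>: "\<And>J. length J = k \<Longrightarrow> norm (a J) \<le> \<mu>" for k \<mu> and a :: "'n list \<Rightarrow> 'b"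
  proof -
    define c where "c = C0 ^ Suc k"
    have c: "1 \<le> c" unfolding c_def using C0 by (rule one_le_power)
    define \<theta> where "\<theta> = 1 - 1 / c"
    have \<theta>: "0 \<le> \<theta>" "\<theta> < 1" using c by (auto simp: \<theta>_def)
    define r where "r m = ((\<lambda>b J. b J - tavg k b J) ^^ m) a" for m
    have r_Suc: "r (Suc m) J = r m J - tavg k (r m) J" for m J by (simp add: r_def)
    have sym: "tsym (r m)" for m
    proof (induction m)
      case (Suc m)
      show ?case
        unfolding tsym_def
      proof (intro allI impI)
        fix J J' :: "'n list" assume J: "mset J = mset J'"
        have "r m J = r m J'" by (rule tsymD[OF Suc J])
        moreover have "tavg k (r m) J = tavg k (r m) J'" by (rule tsymD[OF tsym_tavg J])
        ultimately show "r (Suc m) J = r (Suc m) J'" by (simp only: r_Suc)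
      qed
    qed (simp add: r_def a)
    have tn: "tnorm2 k (r m) \<le> \<theta> ^ m * tnorm2 k a" for m
    proof (induction m)
      case (Suc m)
      let ?A = "sphere_avg (\<lambda>w. (norm (tpoly k (r m) w))\<^sup>2)"
      have "tnorm2 k (r (Suc m)) = (\<Sum>J | length J = k. (norm (r m J))\<^sup>2 - 2 * (r m J \<bullet> tavg k (r m) J) + (norm (tavg k (r m) J))\<^sup>2)"
        unfolding tnorm2_def r_Suc by (intro sum.cong refl) (simp add: power2_norm_eq_inner inner_diff_left inner_diff_right inner_commute)
      also have "\<dots> = tnorm2 k (r m) - 2 * (\<Sum>J | length J = k. r m J \<bullet> tavg k (r m) J) + tnorm2 k (tavg k (r m))"
        by (simp add: tnorm2_def sum.distrib sum_subtractf sum_distrib_left)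
      also have "\<dots> \<le> tnorm2 k (r m) - 2 * ?A + ?A"
        using tnorm2_tavg_le[of k "r m"] unfolding sum_inner_tavg power2_norm_eq_inner by simp
      also have "\<dots> \<le> tnorm2 k (r m) - tnorm2 k (r m) / c"
      proof -
        have "tnorm2 k (r m) \<le> c * ?A" using low[OF sym[of m], of k] by (simp only: c_def)
        then show ?thesis using c by (simp add: field_simps)
      qed
      also have "\<dots> = \<theta> * tnorm2 k (r m)" by (simp add: \<theta>_def algebra_simps)
      also have "\<dots> \<le> \<theta> * (\<theta> ^ m * tnorm2 k a)" by (intro mult_left_mono Suc \<theta>)
      finally show ?case by (simp add: mult.assoc)
    qed (simp add: r_def)
    define s where "s = sqrt \<theta>"
    have s: "0 \<le> s" "s < 1" using \<theta> by (auto simp: s_def)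
    have rn: "norm (r m J) \<le> s ^ m * sqrt (tnorm2 k a)" if "length J = k" for m J
    proof -
      have "(norm (r m J))\<^sup>2 \<le> \<theta> ^ m * tnorm2 k a" by (rule order_trans[OF norm_le_tnorm2[OF that] tn])
      then have "norm (r m J) \<le> sqrt (\<theta> ^ m * tnorm2 k a)" by (rule real_le_rsqrt)
      then show ?thesis by (simp add: s_def real_sqrt_mult real_sqrt_power)
    qed
    have gs: "summable (\<lambda>m. s ^ m * sqrt (tnorm2 k a))" using s by (intro summable_mult2 summable_geometric) simp
    have sm: "summable (\<lambda>m. r m J)" if "length J = k" for J
      by (rule summable_comparison_test'[OF gs, of 0]) (use rn[OF that] in simp)
    define b where "b J = (\<Sum>m. r m J)" for J
    have bsym: "tsym b"
      unfolding tsym_def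
    proof (intro allI impI)
      fix J J' :: "'n list" assume "mset J = mset J'"
      then have "r m J = r m J'" for m by (rule tsymD[OF sym])
      then show "b J = b J'" by (simp only: b_def)
    qed
    have bavg: "tavg k b J = a J" if J: "length J = k" for J
    proof -
      have 1: "(\<lambda>m. tavg k (r m) J) sums tavg k b J"
        unfolding tavg_eq b_def by (intro sums_sum sums_scaleR_right summable_sums sm) simp
      \<comment> \<open>Applied to the Neumann series, \<open>T\<close> gives a telescoping
        sum.\<close>
      have "(\<lambda>m. r m J - r (Suc m) J) sums (r 0 J - 0)"
        by (rule telescope_sums') (rule summable_LIMSEQ_zero[OF sm[OF J]])
      moreover have "r m J - r (Suc m) J = tavg k (r m) J" for m unfolding r_Suc by simp
      ultimately have "(\<lambda>m. tavg k (r m) J) sums (r 0 J - 0)" by (simp only:)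
      with 1 have "tavg k b J = r 0 J - 0" by (rule sums_unique2)
      then show ?thesis by (simp add: r_def)
    qed
    have bnorm: "norm (b J) \<le> C ^ Suc k * \<mu>" if J: "length J = k" for J
    proof -
      have \<mu>0: "0 \<le> \<mu>" using order_trans[OF norm_ge_zero \<mu>[OF J]] .
      have "norm (b J) \<le> (\<Sum>m. s ^ m * sqrt (tnorm2 k a))"
        unfolding b_def by (rule norm_suminf_le[OF rn[OF J] gs])
      also have "\<dots> = sqrt (tnorm2 k a) / (1 - s)"
      proof -
        have "(\<lambda>m. s ^ m * sqrt (tnorm2 k a)) sums (1 / (1 - s) * sqrt (tnorm2 k a))"
          using s by (intro sums_mult2 geometric_sums) simp
        then show ?thesis by (simp add: sums_iff)
      qed
      also have "\<dots> \<le> sqrt (tnorm2 k a) * (2 * c)"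
      proof -
        \<comment> \<open>From \<open>(1 - s) * (1 + s) = 1 / c\<close> and
          \<open>1 + s \<le> 2\<close>: the geometric series costs a factor \<open>2 * c\<close>,
          still exponential in \<open>k\<close>.\<close>
        have "s * s = \<theta>" using \<theta> by (simp add: s_def)
        moreover have "(1 - s) * (1 + s) = 1 - s * s" by (simp add: algebra_simps)
        ultimately have "(1 - s) * (1 + s) = 1 / c" by (simp add: \<theta>_def)
        moreover have "(1 - s) * (1 + s) \<le> (1 - s) * 2" using s by (intro mult_left_mono) auto
        ultimately have "1 / c \<le> (1 - s) * 2" by simp
        then have "1 \<le> (1 - s) * 2 * c" using c by (subst (asm) pos_divide_le_eq) auto
        then have "1 / (1 - s) \<le> 2 * c" using s by (subst pos_divide_le_eq) (auto simp: mult_ac)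
        then have "sqrt (tnorm2 k a) * (1 / (1 - s)) \<le> sqrt (tnorm2 k a) * (2 * c)"
          by (rule mult_left_mono) (simp add: tnorm2_nonneg)
        then show ?thesis by simp
      qed
      finally have b1: "norm (b J) \<le> sqrt (tnorm2 k a) * (2 * c)" .
      have nk: "1 \<le> n ^ k" using n1 by (rule one_le_power)
      have "tnorm2 k a \<le> n ^ k * \<mu>\<^sup>2" unfolding n_def by (rule tnorm2_le[OF \<mu>])
      also have "\<dots> \<le> (n ^ k * n ^ k) * \<mu>\<^sup>2"
      proof (rule mult_right_mono)
        show "n ^ k \<le> n ^ k * n ^ k" using mult_right_mono[OF nk, of "n ^ k"] nk by simp
      qed simp
      also have "\<dots> = (n ^ k * \<mu>)\<^sup>2" by (simp add: power_mult_distrib power2_eq_square)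
      finally have t1: "tnorm2 k a \<le> (n ^ k * \<mu>)\<^sup>2" .
      have n\<mu>: "0 \<le> n ^ k * \<mu>" using nk \<mu>0 by simp
      have "sqrt (tnorm2 k a) \<le> n ^ k * \<mu>" by (rule real_le_lsqrt[OF n\<mu> t1])
      then have "sqrt (tnorm2 k a) * (2 * c) \<le> n ^ k * \<mu> * (2 * c)" by (rule mult_right_mono) (use c in simp)
      with b1 have b2: "norm (b J) \<le> n ^ k * \<mu> * (2 * c)" by (rule order_trans)
      have "2 * n ^ k \<le> 2 ^ Suc k * n ^ Suc k"
      proof (rule mult_mono)
        show "(2::real) \<le> 2 ^ Suc k" by simp
        show "n ^ k \<le> n ^ Suc k" using n1 by (rule power_increasing[rotated]) simp
      qed (use nk in simp_all)
      then have le: "(2 * n ^ k) * (c * \<mu>) \<le> (2 ^ Suc k * n ^ Suc k) * (c * \<mu>)"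
        by (rule mult_right_mono) (use c \<mu>0 in simp)
      have e1: "n ^ k * \<mu> * (2 * c) = (2 * n ^ k) * (c * \<mu>)" by (simp add: algebra_simps)
      have "C ^ Suc k = 2 ^ Suc k * c * n ^ Suc k" unfolding C_def c_def power_mult_distrib by (rule refl)
      then have e2: "C ^ Suc k * \<mu> = (2 ^ Suc k * n ^ Suc k) * (c * \<mu>)" by (simp add: algebra_simps)
      show ?thesis using b2 le unfolding e1 e2 by (rule order_trans)
    qed
    have "\<forall>J. length J = k \<longrightarrow> tavg k b J = a J" using bavg by simp
    moreover have "\<forall>J. length J = k \<longrightarrow> norm (b J) \<le> C ^ Suc k * \<mu>" using bnorm by simp
    ultimately have "tsym b \<and> (\<forall>J. length J = k \<longrightarrow> tavg k b J = a J) \<and> (\<forall>J. length J = k \<longrightarrow> norm (b J) \<le> C ^ Suc k * \<mu>)"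
      using bsym by simp
    then show ?thesis by (rule exI[of _ b])
  qed
  show ?thesis
  proof (intro exI[of _ C] conjI allI impI)
    fix k \<mu> and a :: "'n list \<Rightarrow> 'b"
    assume a: "tsym a" and \<mu>: "\<forall>J. length J = k \<longrightarrow> norm (a J) \<le> \<mu>"
    show "\<exists>b. tsym b \<and> (\<forall>J. length J = k \<longrightarrow> tavg k b J = a J) \<and> (\<forall>J. length J = k \<longrightarrow> norm (b J) \<le> C ^ Suc k * \<mu>)"
      by (rule main[OF a \<mu>[rule_format]])
  qed (rule C1)
qed

section \<open>Rapidly converging series of polynomials\<close>

text \<open>The index \<open>k\<close> bounds the degree, and \<open>M\<close> bounds the sum of the
  norms of the constants in a representation by products of linear forms of norm at most 1. This
  gives growth \<open>M * (1 + |x|) ^ k\<close>, while differentiation costs at most a factor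
  \<open>k * |v|\<close>.\<close>

inductive bpoly :: "nat \<Rightarrow> real \<Rightarrow> ('a::euclidean_space \<Rightarrow> 'b::euclidean_space) \<Rightarrow> bool" where
  bpoly_const: "norm c \<le> M \<Longrightarrow> bpoly k M (\<lambda>x. c)"
| bpoly_lin: "bpoly k M f \<Longrightarrow> norm u \<le> 1 \<Longrightarrow> bpoly (Suc k) M (\<lambda>x. (x \<bullet> u) *\<^sub>R f x)"
| bpoly_add: "bpoly k M f \<Longrightarrow> bpoly k N g \<Longrightarrow> bpoly k (M + N) (\<lambda>x. f x + g x)"

lemma bpoly_nonneg: "bpoly k M f \<Longrightarrow> 0 \<le> M"
  by (induction rule: bpoly.induct) (auto intro: order_trans[OF norm_ge_zero])

lemma bpoly_norm_le: "bpoly k M f \<Longrightarrow> norm (f x) \<le> M * (1 + norm x) ^ k"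
proof (induction rule: bpoly.induct)
  case (bpoly_const c M k)
  have "0 \<le> M" using order_trans[OF norm_ge_zero bpoly_const] .
  then have "M * 1 \<le> M * (1 + norm x) ^ k" by (intro mult_left_mono one_le_power) auto
  then show ?case using bpoly_const by simp
next
  case (bpoly_lin k M f u)
  have "\<bar>x \<bullet> u\<bar> \<le> norm x * norm u" by (rule Cauchy_Schwarz_ineq2)
  also have "\<dots> \<le> norm x * 1" using bpoly_lin by (intro mult_left_mono) auto
  finally have "\<bar>x \<bullet> u\<bar> \<le> 1 + norm x" by simp
  then have "\<bar>x \<bullet> u\<bar> * norm (f x) \<le> (1 + norm x) * (M * (1 + norm x) ^ k)"
    using bpoly_lin.IH by (intro mult_mono) auto
  then show ?case by (simp add: mult.left_commute)
next
  case (bpoly_add k M f N g)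
  then show ?case using norm_triangle_ineq[of "f x" "g x"] by (simp add: distrib_right)
qed

lemma bpoly_mono_Suc: "bpoly k M f \<Longrightarrow> bpoly (Suc k) M f"
proof (induction rule: bpoly.induct)
  case (bpoly_const c M k)
  then show ?case by (rule bpoly.bpoly_const)
next
  case (bpoly_lin k M f u)
  show ?case by (rule bpoly.bpoly_lin[OF bpoly_lin.IH bpoly_lin.hyps(2)])
next
  case (bpoly_add k M f N g)
  show ?case by (rule bpoly.bpoly_add[OF bpoly_add.IH])
qed

lemma bpoly_mono_degree:
  assumes "bpoly k M f" "k \<le> k'"
  shows "bpoly k' M f"
  using assms(2) by (induction rule: dec_induct) (rule assms(1), rule bpoly_mono_Suc)

lemma bpoly_linear_image:
  assumes "bpoly k M f" and L: "bounded_linear L" and C: "\<And>c. norm (L c) \<le> C * norm c" "0 \<le> C"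
  shows "bpoly k (C * M) (\<lambda>x. L (f x))"
  using assms(1)
proof (induction rule: bpoly.induct)
  case (bpoly_const c M k)
  then show ?case using C(1)[of c] mult_left_mono[OF bpoly_const C(2)] by (intro bpoly.bpoly_const) linarith
next
  case (bpoly_lin k M f u)
  show ?case unfolding linear_cmul[OF bounded_linear.linear[OF L]] by (rule bpoly.bpoly_lin[OF bpoly_lin.IH bpoly_lin.hyps(2)])
next
  case (bpoly_add k M f N g)
  show ?case unfolding linear_add[OF bounded_linear.linear[OF L]] distrib_left by (rule bpoly.bpoly_add[OF bpoly_add.IH])
qed

text \<open>Induction with the product rule. The degree index is kept at \<open>k\<close> on
  purpose: the termwise derivative of a series is then a series with the same degrees, and the class
  is closed under differentiation.\<close>

lemma bpoly_derivative:
  "bpoly k M f \<Longrightarrow> \<exists>f'. (\<forall>x. (f has_derivative f' x) (at x)) \<and> (\<forall>v. bpoly k (real k * norm v * M) (\<lambda>x. f' x v))"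
proof (induction rule: bpoly.induct)
  case (bpoly_const c M k)
  have "0 \<le> M" using order_trans[OF norm_ge_zero bpoly_const] .
  then show ?case by (intro exI[of _ "\<lambda>x v. 0"] conjI allI has_derivative_const bpoly.bpoly_const) simp
next
  case (bpoly_lin k M f u)
  then obtain f' where f': "\<And>x. (f has_derivative f' x) (at x)" "\<And>v. bpoly k (real k * norm v * M) (\<lambda>x. f' x v)" by blast
  have "((\<lambda>x. (x \<bullet> u) *\<^sub>R f x) has_derivative (\<lambda>v. (x \<bullet> u) *\<^sub>R f' x v + (v \<bullet> u) *\<^sub>R f x)) (at x)" for x
    by (intro has_derivative_scaleR f' has_derivative_inner_left has_derivative_ident)
  moreover have "bpoly (Suc k) (real (Suc k) * norm v * M) (\<lambda>x. (x \<bullet> u) *\<^sub>R f' x v + (v \<bullet> u) *\<^sub>R f x)" for v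
  proof -
    have vu: "\<bar>v \<bullet> u\<bar> \<le> norm v"
      using Cauchy_Schwarz_ineq2[of v u] mult_left_mono[OF bpoly_lin.hyps(2) norm_ge_zero[of v]] by simp
    have "bpoly k (norm v * M) (\<lambda>x. (v \<bullet> u) *\<^sub>R f x)"
      by (rule bpoly_linear_image[OF bpoly_lin.hyps(1) bounded_linear_scaleR_right])
        (use vu in \<open>simp_all add: mult_right_mono\<close>)
    then have "bpoly (Suc k) (real k * norm v * M + norm v * M) (\<lambda>x. (x \<bullet> u) *\<^sub>R f' x v + (v \<bullet> u) *\<^sub>R f x)"
      by (rule bpoly_add[OF bpoly.bpoly_lin[OF f'(2) bpoly_lin.hyps(2)] bpoly_mono_Suc])
    then show ?thesis by (simp add: algebra_simps)
  qed
  ultimately show ?case by (intro exI[of _ "\<lambda>x v. (x \<bullet> u) *\<^sub>R f' x v + (v \<bullet> u) *\<^sub>R f x"]) simp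
next
  case (bpoly_add k M f N g)
  then obtain f' g' where f': "\<And>x. (f has_derivative f' x) (at x)" "\<And>v. bpoly k (real k * norm v * M) (\<lambda>x. f' x v)"
    and g': "\<And>x. (g has_derivative g' x) (at x)" "\<And>v. bpoly k (real k * norm v * N) (\<lambda>x. g' x v)" by blast
  have "((\<lambda>x. f x + g x) has_derivative (\<lambda>v. f' x v + g' x v)) (at x)" for x
    by (intro has_derivative_add f' g')
  moreover have "bpoly k (real k * norm v * (M + N)) (\<lambda>x. f' x v + g' x v)" for v
    unfolding distrib_left by (rule bpoly.bpoly_add[OF f'(2) g'(2)])
  ultimately show ?case by (intro exI[of _ "\<lambda>x v. f' x v + g' x v"]) simp
qed

lemma bpoly_sum:
  assumes "finite I" "\<And>i. i \<in> I \<Longrightarrow> bpoly k (M i) (f i)"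
  shows "bpoly k (\<Sum>i\<in>I. M i) (\<lambda>x. \<Sum>i\<in>I. f i x)"
  using assms
proof (induction I rule: finite_induct)
  case empty
  show ?case unfolding sum.empty by (rule bpoly_const) simp
next
  case (insert i I)
  have "bpoly k (M i + (\<Sum>i\<in>I. M i)) (\<lambda>x. f i x + (\<Sum>i\<in>I. f i x))"
    by (rule bpoly_add) (use insert in auto)
  then show ?case using insert by simp
qed

text \<open>The degrees \<open>d k\<close> may outgrow the index: the slice monogenic terms of order
  \<open>k\<close> have degree up to \<open>2 * k + 1\<close>.\<close>

definition bpoly_series :: "(nat \<Rightarrow> nat) \<Rightarrow> (nat \<Rightarrow> real) \<Rightarrow> (nat \<Rightarrow> 'a::euclidean_space \<Rightarrow> 'b::euclidean_space) \<Rightarrow> bool" where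
  "bpoly_series d M f \<longleftrightarrow> (\<forall>k. bpoly (d k) (M k) (f k)) \<and> (\<forall>R\<ge>1. summable (\<lambda>k. M k * R ^ d k))"

lemma bpoly_series_norm:
  assumes "bpoly_series d M f"
  shows "norm (f k x) \<le> M k * (1 + norm x) ^ d k" "summable (\<lambda>k. M k * (1 + norm x) ^ d k)" "summable (\<lambda>k. f k x)"
proof -
  show 1: "norm (f k x) \<le> M k * (1 + norm x) ^ d k" for k
    using assms unfolding bpoly_series_def by (intro bpoly_norm_le) simp
  show 2: "summable (\<lambda>k. M k * (1 + norm x) ^ d k)"
    using assms unfolding bpoly_series_def by simp
  show "summable (\<lambda>k. f k x)" by (rule summable_comparison_test'[OF 2, of 0]) (rule 1)
qed

lemma bpoly_series_derivative_series:
  assumes s: "bpoly_series d M f"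
    and f': "\<And>k v. bpoly (d k) (real (d k) * norm v * M k) (\<lambda>x. f' k x v)"
  shows "bpoly_series d (\<lambda>k. real (d k) * norm v * M k) (\<lambda>k x. f' k x v)"
  unfolding bpoly_series_def
proof (intro conjI allI impI f')
  fix R :: real assume R: "1 \<le> R"
  have M0: "0 \<le> M k" for k using s unfolding bpoly_series_def by (intro bpoly_nonneg[of "d k" _ "f k"]) simp
  have "1 \<le> 2 * R" using R by simp
  then have "summable (\<lambda>k. M k * (2 * R) ^ d k)"
    by (rule conjunct2[OF s[unfolded bpoly_series_def], rule_format])
  then have "summable (\<lambda>k. norm v * (M k * (2 * R) ^ d k))" by (rule summable_mult)
  then show "summable (\<lambda>k. real (d k) * norm v * M k * R ^ d k)"
  proof (rule summable_comparison_test'[of _ 0])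
    fix k
    \<comment> \<open>The factor from differentiation is absorbed by passing from \<open>R\<close>
      to \<open>2 * R\<close>.\<close>
    have "real (d k) \<le> 2 ^ d k" using of_nat_less_two_power[of "d k", where 'a=real] by simp
    then have "real (d k) * (norm v * M k * R ^ d k) \<le> 2 ^ d k * (norm v * M k * R ^ d k)"
      using M0 R by (intro mult_right_mono) auto
    then show "norm (real (d k) * norm v * M k * R ^ d k) \<le> norm v * (M k * (2 * R) ^ d k)"
      using M0[of k] R by (simp add: power_mult_distrib mult_ac abs_mult)
  qed
qed

lemma bpoly_series_has_derivative:
  fixes f :: "nat \<Rightarrow> 'a::euclidean_space \<Rightarrow> 'b::euclidean_space"
  assumes s: "bpoly_series d M f"
    and d: "\<And>k x. (f k has_derivative f' k x) (at x)"
    and f': "\<And>k v. bpoly (d k) (real (d k) * norm v * M k) (\<lambda>x. f' k x v)"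
  shows "((\<lambda>x. \<Sum>k. f k x) has_derivative (\<lambda>v. \<Sum>k. f' k x v)) (at x)"
proof -
  define S where "S = ball (0::'a) (norm x + 1)"
  \<comment> \<open>An upper bound for \<open>1 + |y|\<close> on the ball \<open>S\<close>, so that
    one numerical series dominates all derivatives near \<open>x\<close>.\<close>
  define R where "R = norm x + 2"
  have M0: "0 \<le> M k" for k using s unfolding bpoly_series_def by (intro bpoly_nonneg[of "d k" _ "f k"]) simp
  define m where "m k = real (d k) * M k * R ^ d k" for k
  have "0 \<le> norm x" by simp
  then have R: "1 \<le> R" unfolding R_def by linarith
  have m0: "0 \<le> m k" for k using M0 R by (simp add: m_def)
  obtain e1 :: 'a where e1: "norm e1 = 1" using norm_Basis SOME_Basis by blast
  have sm: "summable m"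
    using bpoly_series_derivative_series[OF s f', of e1] R e1 unfolding bpoly_series_def m_def by simp
  have fb: "norm (f' k y h) \<le> m k * norm h" if "y \<in> S" for k y h
  proof -
    have "norm (f' k y h) \<le> real (d k) * norm h * M k * (1 + norm y) ^ d k" by (rule bpoly_norm_le[OF f'])
    also have "\<dots> \<le> real (d k) * norm h * M k * R ^ d k"
      using that M0 by (intro mult_left_mono power_mono) (auto simp: S_def R_def)
    finally show ?thesis by (simp add: m_def mult_ac)
  qed
  have "\<exists>g. \<forall>y\<in>S. (\<lambda>k. f k y) sums g y \<and> (g has_derivative (\<lambda>v. \<Sum>k. f' k y v)) (at y within S)"
  proof (rule has_derivative_series)
    show "convex S" by (simp add: S_def)
    show "(f k has_derivative f' k y) (at y within S)" for k y by (rule has_derivative_at_withinI[OF d])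
    show "x \<in> S" by (simp add: S_def)
    show "(\<lambda>k. f k x) sums (\<Sum>k. f k x)" by (rule summable_sums[OF bpoly_series_norm(3)[OF s]])
    fix e :: real assume e: "0 < e"
    have "(\<lambda>n. \<Sum>k. m (k + n)) \<longlonglongrightarrow> 0" by (rule suminf_exist_split2[OF sm])
    then have "\<forall>\<^sub>F n in sequentially. (\<Sum>k. m (k + n)) < e" using e by (rule order_tendstoD(2))
    then show "\<forall>\<^sub>F n in sequentially. \<forall>y\<in>S. \<forall>h. norm ((\<Sum>i<n. f' i y h) - (\<Sum>k. f' k y h)) \<le> e * norm h"
    proof (rule eventually_mono, intro ballI allI)
      fix n and y h :: 'a assume n: "(\<Sum>k. m (k + n)) < e" and y: "y \<in> S"
      have smh: "summable (\<lambda>k. m k * norm h)" by (intro summable_mult2 sm)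
      have sf: "summable (\<lambda>k. f' k y h)" by (rule summable_comparison_test'[OF smh, of 0]) (rule fb[OF y])
      have "(\<Sum>k. f' k y h) = (\<Sum>k. f' (k + n) y h) + (\<Sum>i<n. f' i y h)" by (rule suminf_split_initial_segment[OF sf])
      then have "norm ((\<Sum>i<n. f' i y h) - (\<Sum>k. f' k y h)) = norm (\<Sum>k. f' (k + n) y h)" by simp
      also have "\<dots> \<le> (\<Sum>k. m (k + n) * norm h)"
        by (rule norm_suminf_le) (rule fb[OF y], rule summable_ignore_initial_segment[OF smh])
      also have "\<dots> = (\<Sum>k. m (k + n)) * norm h"
        by (rule suminf_mult2[symmetric]) (rule summable_ignore_initial_segment[OF sm])
      also have "\<dots> \<le> e * norm h" using n by (intro mult_right_mono) auto
      finally show "norm ((\<Sum>i<n. f' i y h) - (\<Sum>k. f' k y h)) \<le> e * norm h" .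
    qed
  qed
  then obtain g where g: "\<And>y. y \<in> S \<Longrightarrow> (\<lambda>k. f k y) sums g y" "\<And>y. y \<in> S \<Longrightarrow> (g has_derivative (\<lambda>v. \<Sum>k. f' k y v)) (at y within S)" by blast
  have xS: "x \<in> S" "open S" by (simp_all add: S_def)
  have "(g has_derivative (\<lambda>v. \<Sum>k. f' k x v)) (at x)" using g(2)[OF xS(1)] at_within_open[OF xS] by simp
  then show ?thesis
  proof (rule has_derivative_transform_within_open[OF _ xS(2) xS(1)])
    show "g y = (\<Sum>k. f k y)" if "y \<in> S" for y using g(1)[OF that] by (rule sums_unique)
  qed
qed

lemma bpoly_series_derivative:
  assumes "bpoly_series d M f"
  obtains f' where "\<And>k x. (f k has_derivative f' k x) (at x)"
    "\<And>x. ((\<lambda>x. \<Sum>k. f k x) has_derivative (\<lambda>v. \<Sum>k. f' k x v)) (at x)"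
    "\<And>v. bpoly_series d (\<lambda>k. real (d k) * norm v * M k) (\<lambda>k x. f' k x v)"
proof -
  have "\<forall>k. \<exists>f'. (\<forall>x. (f k has_derivative f' x) (at x)) \<and> (\<forall>v. bpoly (d k) (real (d k) * norm v * M k) (\<lambda>x. f' x v))"
    using assms unfolding bpoly_series_def by (intro allI bpoly_derivative) simp
  from choice[OF this] obtain f' where f': "\<forall>k. (\<forall>x. (f k has_derivative f' k x) (at x)) \<and> (\<forall>v. bpoly (d k) (real (d k) * norm v * M k) (\<lambda>x. f' k x v))" ..
  show thesis
  proof (rule that[of f'])
    have b: "bpoly (d k) (real (d k) * norm v * M k) (\<lambda>x. f' k x v)" for k v using f' by simp
    show dd: "(f k has_derivative f' k x) (at x)" for k x using f' by simp
    show "((\<lambda>x. \<Sum>k. f k x) has_derivative (\<lambda>v. \<Sum>k. f' k x v)) (at x)" for x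
      by (rule bpoly_series_has_derivative[OF assms dd b])
    show "bpoly_series d (\<lambda>k. real (d k) * norm v * M k) (\<lambda>k x. f' k x v)" for v
      by (rule bpoly_series_derivative_series[OF assms b])
  qed
qed

text \<open>The induction runs over all series at once, since the derivative of a series is another
  one with a larger majorant.\<close>

lemma bpoly_series_Ck: "bpoly_series d M f \<Longrightarrow> Ck n (\<lambda>x. \<Sum>k. f k x)"
proof (induction n arbitrary: M f)
  case 0
  show ?case
  proof (rule bpoly_series_derivative[OF 0])
    fix f' assume "\<And>x. ((\<lambda>x. \<Sum>k. f k x) has_derivative (\<lambda>v. \<Sum>k. f' k x v)) (at x)"
    then have "continuous_on UNIV (\<lambda>x. \<Sum>k. f k x)" by (rule has_derivative_continuous_on[OF has_derivative_at_withinI])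
    then show ?thesis by simp
  qed
next
  case (Suc n)
  show ?case
  proof (rule bpoly_series_derivative[OF Suc.prems])
    fix f' assume f': "\<And>x. ((\<lambda>x. \<Sum>k. f k x) has_derivative (\<lambda>v. \<Sum>k. f' k x v)) (at x)"
      "\<And>v. bpoly_series d (\<lambda>k. real (d k) * norm v * M k) (\<lambda>k x. f' k x v)"
    have "frechet_derivative (\<lambda>x. \<Sum>k. f k x) (at x) = (\<lambda>v. \<Sum>k. f' k x v)" for x
      using frechet_derivative_at[OF f'(1)[of x]] by (rule sym)
    moreover have "(\<lambda>x. \<Sum>k. f k x) differentiable (at x)" for x
      using f'(1)[of x] by (rule differentiableI)
    ultimately show ?thesis using Suc.IH[OF f'(2)] by simp
  qed
qed

lemma bpoly_series_smooth: "bpoly_series d M f \<Longrightarrow> smooth (\<lambda>x. \<Sum>k. f k x)"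
  by (simp add: smooth_def bpoly_series_Ck)

section \<open>Monogenic and slice monogenic systems\<close>

text \<open>Identity theorem with vector coefficients: once the lower coefficients vanish, division
  by \<open>t ^ k\<close> leaves \<open>c k\<close> plus terms of order \<open>t\<close>.\<close>

lemma power_series_zero:
  fixes c :: "nat \<Rightarrow> 'b::banach"
  assumes z: "\<And>t::real. (\<lambda>k. t ^ k *\<^sub>R c k) sums 0"
  shows "c k = 0"
proof (induction k rule: less_induct)
  case (less k)
  have "summable c" using z[of 1] by (simp add: sums_iff)
  then have "bounded (range c)" using summable_LIMSEQ_zero convergent_imp_bounded by blast
  then obtain B where "B > 0" and B: "\<And>i. norm (c i) \<le> B" by (auto simp: bounded_pos)
  have est: "norm (c k) \<le> 2 * B * t" if t: "0 < t" "t \<le> 1/2" for t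
  proof -
    have "(\<lambda>i. t ^ (i + k) *\<^sub>R c (i + k)) sums 0"
      using sums_iff_shift[of "\<lambda>k. t ^ k *\<^sub>R c k" k 0] z[of t] less by simp
    from sums_scaleR_right[OF this, of "inverse (t ^ k)"]
    have "(\<lambda>i. (inverse (t ^ k) * t ^ (i + k)) *\<^sub>R c (i + k)) sums 0" by simp
    moreover have "inverse (t ^ k) * t ^ (i + k) = t ^ i" for i using t by (simp add: power_add)
    ultimately have "(\<lambda>i. t ^ i *\<^sub>R c (i + k)) sums 0" by (simp only:)
    then have s: "(\<lambda>i. t ^ Suc i *\<^sub>R c (Suc i + k)) sums (0 - c k)"
      using sums_Suc_iff[of "\<lambda>i. t ^ i *\<^sub>R c (i + k)" "0 - c k"] by simp
    have g: "(\<lambda>i. t ^ i * (t * B)) sums (1 / (1 - t) * (t * B))"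
      using t by (intro sums_mult2 geometric_sums) simp
    have "norm (\<Sum>i. t ^ Suc i *\<^sub>R c (Suc i + k)) \<le> (\<Sum>i. t ^ i * (t * B))"
    proof (rule norm_suminf_le)
      fix i
      have "t ^ Suc i * norm (c (Suc i + k)) \<le> t ^ Suc i * B" using t by (intro mult_left_mono B) simp
      then show "norm (t ^ Suc i *\<^sub>R c (Suc i + k)) \<le> t ^ i * (t * B)" using t by (simp add: mult_ac)
    qed (rule sums_summable[OF g])
    then have "norm (c k) \<le> 1 / (1 - t) * (t * B)"
      unfolding sums_unique[OF g, symmetric] sums_unique[OF s, symmetric] by simp
    also have "\<dots> \<le> 2 * (t * B)"
      using t \<open>B > 0\<close> by (intro mult_right_mono) (auto simp: field_simps)
    finally show ?thesis by (simp add: mult_ac)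
  qed
  show ?case
  proof (rule ccontr)
    assume "c k \<noteq> 0"
    then have c: "0 < norm (c k)" by simp
    define t where "t = min (1/2) (norm (c k) / (4 * B))"
    have "0 < t" "t \<le> 1/2" using c \<open>B > 0\<close> by (auto simp: t_def)
    from est[OF this] have "norm (c k) \<le> 2 * B * t" .
    also have "\<dots> \<le> 2 * B * (norm (c k) / (4 * B))" using \<open>B > 0\<close> by (intro mult_left_mono) (auto simp: t_def)
    also have "\<dots> = norm (c k) / 2" using \<open>B > 0\<close> by simp
    finally show False using c by simp
  qed
qed

lemma Ck_add: "Ck n f \<Longrightarrow> Ck n g \<Longrightarrow> Ck n (\<lambda>x. f x + g x)"
proof (induction n arbitrary: f g)
  case 0
  then show ?case by (simp add: continuous_on_add)
next
  case (Suc n)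
  have "frechet_derivative (\<lambda>x. f x + g x) (at z) = (\<lambda>v. frechet_derivative f (at z) v + frechet_derivative g (at z) v)" for z
    by (rule frechet_derivative_at[symmetric], rule has_derivative_add)
      (use Suc.prems in \<open>simp_all add: frechet_derivative_works[symmetric]\<close>)
  then show ?case using Suc.prems Suc.IH by simp
qed

lemma Ck_bounded_linear: "bounded_linear L \<Longrightarrow> Ck n f \<Longrightarrow> Ck n (\<lambda>x. L (f x))"
proof (induction n arbitrary: f)
  case 0
  then show ?case by (simp add: bounded_linear.continuous_on)
next
  case (Suc n)
  have d: "((\<lambda>x. L (f x)) has_derivative (\<lambda>v. L (frechet_derivative f (at z) v))) (at z)" for z
    by (rule bounded_linear.has_derivative[OF Suc.prems(1)])
      (use Suc.prems in \<open>simp add: frechet_derivative_works[symmetric]\<close>)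
  have "frechet_derivative (\<lambda>x. L (f x)) (at z) = (\<lambda>v. L (frechet_derivative f (at z) v))" for z
    by (rule frechet_derivative_at[symmetric, OF d])
  then show ?case using Suc.prems Suc.IH d by (auto simp: differentiable_def)
qed

lemma smooth_derivative:
  assumes "smooth F"
  shows "(F has_derivative frechet_derivative F (at z)) (at z)" "continuous_on UNIV (\<lambda>z. frechet_derivative F (at z) v)"
proof -
  have "Ck (Suc 0) F" using assms by (simp add: smooth_def del: Ck.simps)
  then show "(F has_derivative frechet_derivative F (at z)) (at z)" "continuous_on UNIV (\<lambda>z. frechet_derivative F (at z) v)"
    by (simp_all add: frechet_derivative_works[symmetric])
qed

text \<open>Both the monogenic and the slice monogenic equation are governed by a Clifford multiplication
  \<open>c\<close> with \<open>c(x)\<^sup>2 = - |x|\<^sup>2\<close>; the conjugate operator supplies the factorisation of the Laplacian.\<close>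

lemma elliptic_systemI:
  fixes c :: "'x::euclidean_space \<Rightarrow> 'c::euclidean_space \<Rightarrow> 'c"
  assumes c: "bounded_bilinear c" and sq: "\<And>x u. c x (c x u) = - ((norm x)\<^sup>2 *\<^sub>R u)"
  shows "elliptic_system (\<lambda>b u. fst b *\<^sub>R u + c (snd b) u) (\<lambda>b u. fst b *\<^sub>R u - c (snd b) u)"
proof (rule elliptic_system.intro)
  interpret c: bounded_bilinear c by (rule c)
  fix b b' :: "real \<times> 'x" and u
  show "bounded_linear (\<lambda>u. fst b *\<^sub>R u + c (snd b) u)"
    by (intro bounded_linear_add bounded_linear_scaleR_right c.bounded_linear_right)
  show "bounded_linear (\<lambda>u. fst b *\<^sub>R u - c (snd b) u)"
    by (intro bounded_linear_sub bounded_linear_scaleR_right c.bounded_linear_right)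
  assume b: "b \<in> Basis" "b' \<in> Basis"
  let ?x = "snd b" and ?y = "snd b'"
  have "c (?x + ?y) (c (?x + ?y) u) = - ((norm (?x + ?y))\<^sup>2 *\<^sub>R u)" by (rule sq)
  then have "c ?x (c ?y u) + c ?y (c ?x u) = - ((norm (?x + ?y))\<^sup>2 *\<^sub>R u) + (norm ?x)\<^sup>2 *\<^sub>R u + (norm ?y)\<^sup>2 *\<^sub>R u"
    by (simp add: c.add_left c.add_right sq algebra_simps)
  also have "\<dots> = - ((2 * (?x \<bullet> ?y)) *\<^sub>R u)"
    unfolding power2_norm_eq_inner
    by (simp add: inner_add_left inner_add_right inner_commute algebra_simps flip: scaleR_add_left)
  finally have ac: "c ?x (c ?y u) + c ?y (c ?x u) = - ((2 * (?x \<bullet> ?y)) *\<^sub>R u)" .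
  have "fst b *\<^sub>R (fst b' *\<^sub>R u + c ?y u) - c ?x (fst b' *\<^sub>R u + c ?y u) + (fst b' *\<^sub>R (fst b *\<^sub>R u + c ?x u) - c ?y (fst b *\<^sub>R u + c ?x u))
     = (2 * (fst b * fst b')) *\<^sub>R u - (c ?x (c ?y u) + c ?y (c ?x u))"
    by (simp add: c.add_right c.scaleR_right algebra_simps) (simp flip: scaleR_add_left)
  also have "\<dots> = (2 * (b \<bullet> b')) *\<^sub>R u" unfolding ac by (simp add: inner_prod_def algebra_simps)
  finally show "fst b *\<^sub>R (fst b' *\<^sub>R u + c ?y u) - c ?x (fst b' *\<^sub>R u + c ?y u) + (fst b' *\<^sub>R (fst b *\<^sub>R u + c ?x u) - c ?y (fst b *\<^sub>R u + c ?x u))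
     = (if b = b' then 2 *\<^sub>R u else 0)" using b by (simp add: inner_Basis)
qed

interpretation monogenic_system:
  elliptic_system "\<lambda>(b :: real \<times> (real ^ 'n::{finite,linorder})) u. fst b *\<^sub>R u + vec_cl (snd b) \<odot> u"
    "\<lambda>(b :: real \<times> (real ^ 'n::{finite,linorder})) u. fst b *\<^sub>R u - vec_cl (snd b) \<odot> u"
proof (rule elliptic_systemI)
  have "linear (vec_cl :: (real, 'n) vec \<Rightarrow> 'n clif)"
    by (rule linearI) (simp_all add: vec_cl_def scaleR_add_left sum.distrib scaleR_sum_right)
  then have "bounded_linear (vec_cl :: (real, 'n) vec \<Rightarrow> 'n clif)" by (simp add: linear_conv_bounded_linear)
  from bounded_bilinear.comp1[OF bounded_bilinear_clmul this]
  show "bounded_bilinear (\<lambda>(x :: (real, 'n) vec) u. vec_cl x \<odot> u)" .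
qed (rule vec_cl_twice)

text \<open>On a slice, multiplication by the unit vector \<omega> plays the part of the imaginary
  unit.\<close>

lemma slice_elliptic_system:
  assumes "w \<in> sphere (0 :: real ^ 'n::{finite,linorder}) 1"
  shows "elliptic_system (\<lambda>(b :: real \<times> real) u. fst b *\<^sub>R u + snd b *\<^sub>R (vec_cl w \<odot> u)) (\<lambda>b u. fst b *\<^sub>R u - snd b *\<^sub>R (vec_cl w \<odot> u))"
proof (rule elliptic_systemI)
  show "bounded_bilinear (\<lambda>(s::real) u. s *\<^sub>R (vec_cl w \<odot> u))"
    by (rule bounded_bilinear.comp[OF bounded_bilinear_scaleR bounded_linear_ident clmul.bounded_linear_right])
  show "s *\<^sub>R (vec_cl w \<odot> (s *\<^sub>R (vec_cl w \<odot> u))) = - ((norm s)\<^sup>2 *\<^sub>R u)" for s :: real and u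
    using assms by (simp add: clmul.scaleR_right vec_cl_twice power2_eq_square)
qed

lemma sum_Basis_real_prod:
  fixes f :: "real \<times> 'x::euclidean_space \<Rightarrow> 'c::comm_monoid_add"
  shows "(\<Sum>b\<in>Basis. f b) = f (1, 0) + (\<Sum>b\<in>Basis. f (0, b))"
proof -
  have eq: "(Basis :: (real \<times> 'x) set) = insert (1, 0) ((\<lambda>b. (0, b)) ` Basis)"
    by (auto simp: Basis_prod_def)
  have "(1, 0) \<notin> (\<lambda>b::'x. (0::real, b)) ` Basis" by auto
  then show ?thesis unfolding eq by (simp add: sum.reindex inj_on_def)
qed

lemma sum_Basis_vec:
  fixes f :: "real ^ 'n \<Rightarrow> 'c::comm_monoid_add"
  shows "(\<Sum>b\<in>Basis. f b) = (\<Sum>j\<in>UNIV. f (axis j 1))"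
proof -
  have eq: "(Basis :: (real ^ 'n) set) = range (\<lambda>j. axis j 1)" by (auto simp: Basis_vec_def)
  have "inj (\<lambda>j::'n. axis j (1::real))" by (auto simp: inj_on_def axis_eq_axis)
  then show ?thesis unfolding eq by (simp add: sum.reindex)
qed

lemma vec_cl_axis: "vec_cl (axis j 1) = gen (j :: 'n::{finite,linorder})"
  by (simp add: vec_cl_def axis_def if_distrib[of "\<lambda>c. c *\<^sub>R _"] cong: if_cong)

lemma vector_derivative_line:
  assumes "(f has_derivative f') (at (z + t *\<^sub>R v))"
  shows "vector_derivative (\<lambda>s. f (z + s *\<^sub>R v)) (at t) = f' v"
proof (rule vector_derivative_at)
  have "((\<lambda>s. f (z + s *\<^sub>R v)) has_derivative (\<lambda>s. f' (s *\<^sub>R v))) (at t)"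
    by (rule has_derivative_compose[OF has_derivative_line[of z v t] assms])
  then show "((\<lambda>s. f (z + s *\<^sub>R v)) has_vector_derivative f' v) (at t)"
    unfolding has_vector_derivative_def linear_cmul[OF has_derivative_linear[OF assms]] .
qed

lemma partial_derivatives:
  fixes f :: "real \<times> 'x::euclidean_space \<Rightarrow> 'c::euclidean_space"
  assumes "(f has_derivative f') (at (x0, x))"
  shows "vector_derivative (\<lambda>t. f (t, x)) (at x0) = f' (1, 0)"
    "vector_derivative (\<lambda>t. f (x0, x + t *\<^sub>R v)) (at 0) = f' (0, v)"
  using vector_derivative_line[of f f' "(0, x)" x0 "(1, 0)"] vector_derivative_line[of f f' "(x0, x)" 0 "(0, v)"] assms
  by (simp_all)

lemma monogenic_iff_sol:
  fixes f :: "real \<times> (real ^ 'n::{finite,linorder}) \<Rightarrow> 'n clif"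
  shows "monogenic f \<longleftrightarrow> monogenic_system.sol f"
proof -
  have *: "vector_derivative (\<lambda>t. f (t, x)) (at x0) + (\<Sum>j\<in>UNIV. gen j \<odot> vector_derivative (\<lambda>t. f (x0, x + t *\<^sub>R axis j 1)) (at 0))
      = (\<Sum>b\<in>Basis. fst b *\<^sub>R frechet_derivative f (at (x0, x)) b + vec_cl (snd b) \<odot> frechet_derivative f (at (x0, x)) b)"
    if "f differentiable (at (x0, x))" for x0 x
  proof -
    have d: "(f has_derivative frechet_derivative f (at (x0, x))) (at (x0, x))"
      using that by (simp add: frechet_derivative_works[symmetric])
    have v0: "vec_cl (0 :: (real, 'n) vec) = 0" by (simp add: vec_cl_def)
    show ?thesis unfolding sum_Basis_real_prod sum_Basis_vec partial_derivatives[OF d]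
      by (simp add: vec_cl_axis v0 clmul.zero_left)
  qed
  show ?thesis unfolding monogenic_def monogenic_system.sol_def split_paired_All by (simp add: * cong: conj_cong)
qed

lemma M0_zero_unique:
  assumes "F \<in> M0" "\<And>x. F (0, x) = 0"
  shows "F = (\<lambda>z. 0 :: 'n::{finite,linorder} clif)"
proof
  fix z
  have F: "monogenic_system.sol F" using assms(1) by (simp add: M0_def monogenic_iff_sol)
  have b: "(1, 0) \<in> (Basis :: (real \<times> ((real, 'n) vec)) set)" by (simp add: Basis_prod_def)
  have v0: "vec_cl (0 :: (real, 'n) vec) = 0" by (simp add: vec_cl_def)
  show "F z = 0"
  proof (rule monogenic_system.sol_zero_on_hyperplane[OF F b])
    show "fst (1::real, 0::(real, 'n) vec) *\<^sub>R u + vec_cl (snd (1::real, 0::(real, 'n) vec)) \<odot> u = u" for u by (simp add: v0 clmul.zero_left)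
    fix y :: "real \<times> ((real, 'n) vec)" assume "y \<bullet> (1, 0) = 0"
    then have "y = (0, snd y)" by (simp add: prod_eq_iff inner_prod_def inner_real_def)
    then show "F y = 0" using assms(2)[of "snd y"] by simp
  qed
qed

section \<open>Taylor coefficients of entire solutions\<close>

context elliptic_system
begin

lemma foldr_D_move: "sol F \<Longrightarrow> foldr D (P @ v # Q) F = D v (foldr D (P @ Q) F)"
proof (induction P)
  case (Cons p P)
  have "D p (D v (foldr D (P @ Q) F)) = D v (D p (foldr D (P @ Q) F))"
    by (rule D_commute[OF sol_foldr_D[OF Cons.prems]])
  then show ?case using Cons by simp
qed simp

text \<open>Derivatives commute; this is what makes the tensor of Taylor coefficients
  symmetric.\<close>

lemma foldr_D_mset:
  assumes F: "sol F"
  shows "mset us = mset vs \<Longrightarrow> foldr D us F = foldr D vs F"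
proof (induction us arbitrary: vs)
  case Nil
  then show ?case by simp
next
  case (Cons u us)
  have "u \<in> set vs" using mset_eq_setD[OF Cons.prems] by auto
  then obtain P Q where vs: "vs = P @ u # Q" using split_list by metis
  then have "mset us = mset (P @ Q)" using Cons.prems by simp
  then have "foldr D us F = foldr D (P @ Q) F" by (rule Cons.IH)
  then show ?case unfolding vs foldr_D_move[OF F] by simp
qed

text \<open>The order of the quantifiers matters: \<open>L\<close> is fixed before \<open>Q\<close>,
  so enlarging \<open>Q\<close> gives decay faster than any geometric sequence.\<close>

lemma sol_derivatives_bound:
  assumes F: "sol F"
  shows "\<exists>L>0. \<forall>Q>0. \<exists>C\<ge>0. \<forall>vs. (\<forall>v\<in>set vs. norm v \<le> 1) \<longrightarrow> norm (foldr D vs F 0) / fact (length vs) \<le> (L / Q) ^ length vs * C"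
proof (rule exI[of _ "K * exp 1"], intro conjI allI impI)
  show "0 < K * exp 1" using K_pos by simp
  fix Q :: real assume Q: "0 < Q"
  have "bounded (F ` cball 0 Q)"
    by (intro compact_imp_bounded compact_continuous_image continuous_on_subset[OF sol_continuous[OF F]]) auto
  then obtain C where "\<forall>u\<in>F ` cball 0 Q. norm u \<le> C" unfolding bounded_iff by blast
  then have C: "norm (F z) \<le> C" if "norm z \<le> Q" for z using that by simp
  have C0: "0 \<le> C" using order_trans[OF norm_ge_zero C[of 0]] Q by simp
  show "\<exists>C\<ge>0. \<forall>vs. (\<forall>v\<in>set vs. norm v \<le> 1) \<longrightarrow> norm (foldr D vs F 0) / fact (length vs) \<le> (K * exp 1 / Q) ^ length vs * C"
  proof (rule exI[of _ C], intro conjI allI impI C0)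
    fix vs :: "'a list" assume vs: "\<forall>v\<in>set vs. norm v \<le> 1"
    define k where "k = length vs"
    show "norm (foldr D vs F 0) / fact (length vs) \<le> (K * exp 1 / Q) ^ length vs * C"
    proof (cases "vs = []")
      case True
      then show ?thesis using C[of 0] Q by simp
    next
      case False
      then have k: "0 < real k" by (simp add: k_def)
      have r: "0 < Q / real k" using Q k by simp
      have "norm (foldr D vs F 0) \<le> (K * 1 / (Q / real k)) ^ length vs * C"
      proof (rule foldr_D_bound[OF F r])
        fix y :: 'a assume "norm y \<le> real (length vs) * (Q / real k)"
        then have "norm y \<le> Q" using k by (simp add: k_def)
        then show "norm (F (0 + y)) \<le> C" using C by simp
      qed (use vs in simp)
      also have "(K * 1 / (Q / real k)) ^ length vs = (K / Q) ^ k * real k ^ k"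
        by (simp add: k_def[symmetric] power_divide power_mult_distrib)
      also have "(K / Q) ^ k * real k ^ k * C \<le> (K / Q) ^ k * (fact k * exp 1 ^ k) * C"
        using C0 K_pos Q by (intro mult_right_mono mult_left_mono power_self_le_fact) auto
      also have "\<dots> = fact k * ((K * exp 1 / Q) ^ k * C)" by (simp add: power_divide power_mult_distrib)
      finally show ?thesis by (simp add: k_def pos_divide_le_eq mult.commute)
    qed
  qed
qed

end

text \<open>The coefficient condition for an entire series. Summability against every geometric
  weight survives any loss that is exponential in the degree, in particular the inversion of
  \<open>tavg\<close>.\<close>

definition rapid :: "('n::finite list \<Rightarrow> 'b::euclidean_space) \<Rightarrow> bool" where
  "rapid a \<longleftrightarrow> (\<forall>R\<ge>1. summable (\<lambda>k. (\<Sum>J | length J = k. norm (a J)) * R ^ k))"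

lemma rapid_le:
  fixes a b :: "'n::finite list \<Rightarrow> 'b::euclidean_space"
  assumes a: "rapid a" and C: "1 \<le> C" and b: "\<And>J. norm (b J) \<le> C ^ Suc (length J) * (\<Sum>I | length I = length J. norm (a I))"
  shows "rapid b"
  unfolding rapid_def
proof (intro allI impI)
  fix R :: real assume R: "1 \<le> R"
  define n where "n = real CARD('n)"
  have n: "1 \<le> n" by (simp add: n_def Suc_leI)
  \<comment> \<open>This weight absorbs \<open>C ^ k\<close> together with the number
    \<open>n ^ k\<close> of tuples.\<close>
  have "1 \<le> n * C * R" using n C R by (intro mult_ge1_I)
  then have "summable (\<lambda>k. (\<Sum>J | length J = k. norm (a J)) * (n * C * R) ^ k)"
    by (rule a[unfolded rapid_def, rule_format])
  then have "summable (\<lambda>k. C * ((\<Sum>J | length J = k. norm (a J)) * (n * C * R) ^ k))" by (rule summable_mult)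
  then show "summable (\<lambda>k. (\<Sum>J | length J = k. norm (b J)) * R ^ k)"
  proof (rule summable_comparison_test'[of _ 0])
    fix k
    let ?s = "\<Sum>I::'n list | length I = k. norm (a I)"
    have "(\<Sum>J | length J = k. norm (b J)) \<le> (\<Sum>J::'n list | length J = k. C ^ Suc k * ?s)"
      by (rule sum_mono) (use b in auto)
    also have "\<dots> = n ^ k * (C ^ Suc k * ?s)" by (simp add: card_lists_length n_def)
    finally have "(\<Sum>J | length J = k. norm (b J)) * R ^ k \<le> n ^ k * (C ^ Suc k * ?s) * R ^ k"
      using R by (intro mult_right_mono) auto
    also have "\<dots> = C * (?s * (n * C * R) ^ k)" by (simp add: power_mult_distrib)
    finally show "norm ((\<Sum>J | length J = k. norm (b J)) * R ^ k) \<le> C * (?s * (n * C * R) ^ k)"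
      using R by (simp add: sum_nonneg)
  qed
qed

lemma tpoly_cong:
  assumes "\<And>J. length J = k \<Longrightarrow> a J = b J"
  shows "tpoly k a = tpoly k b"
  unfolding tpoly_def[abs_def] by (intro ext sum.cong refl) (simp add: assms)

lemma rapid_tavg_inverse:
  fixes a :: "'n::finite list \<Rightarrow> 'b::euclidean_space"
  assumes a: "tsym a" "rapid a"
  shows "\<exists>b. tsym b \<and> rapid b \<and> (\<forall>k J. length J = k \<longrightarrow> tavg k b J = a J)"
proof -
  obtain C where C: "C \<ge> 1" and inv: "\<forall>k (a :: 'n::finite list \<Rightarrow> 'b) \<mu>. tsym a \<longrightarrow> (\<forall>J. length J = k \<longrightarrow> norm (a J) \<le> \<mu>) \<longrightarrow>
     (\<exists>b. tsym b \<and> (\<forall>J. length J = k \<longrightarrow> tavg k b J = a J) \<and> (\<forall>J. length J = k \<longrightarrow> norm (b J) \<le> C ^ Suc k * \<mu>))"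
    using tavg_inverse[where 'n='n and 'b='b] by (elim exE conjE)
  have le: "\<forall>J. length J = k \<longrightarrow> norm (a J) \<le> (\<Sum>I | length I = k. norm (a I))" for k
    by (auto intro!: member_le_sum)
  have "\<exists>b. tsym b \<and> (\<forall>J. length J = k \<longrightarrow> tavg k b J = a J) \<and> (\<forall>J. length J = k \<longrightarrow> norm (b J) \<le> C ^ Suc k * (\<Sum>I | length I = k. norm (a I)))" for k
    by (rule inv[rule_format, OF a(1) le[rule_format]])
  then have "\<forall>k. \<exists>b. tsym b \<and> (\<forall>J. length J = k \<longrightarrow> tavg k b J = a J) \<and> (\<forall>J. length J = k \<longrightarrow> norm (b J) \<le> C ^ Suc k * (\<Sum>I | length I = k. norm (a I)))"
    by (rule allI)
  from choice[OF this] obtain b where b: "\<forall>k. tsym (b k) \<and> (\<forall>J. length J = k \<longrightarrow> tavg k (b k) J = a J) \<and>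
     (\<forall>J. length J = k \<longrightarrow> norm (b k J) \<le> C ^ Suc k * (\<Sum>I | length I = k. norm (a I)))" ..
  \<comment> \<open>The inverses for the separate degrees are glued into one tensor by the length of
    the list.\<close>
  define c where "c J = b (length J) J" for J
  have "tsym c"
    unfolding tsym_def
  proof (intro allI impI)
    fix J J' :: "'n list" assume m: "mset J = mset J'"
    have "length J = length J'" using arg_cong[OF m, of size] by (simp only: size_mset)
    moreover have "b (length J) J = b (length J) J'" by (rule tsymD[OF conjunct1[OF b[rule_format]] m])
    ultimately show "c J = c J'" by (simp only: c_def)
  qed
  moreover have "rapid c"
    by (rule rapid_le[OF a(2) C]) (use b in \<open>simp add: c_def\<close>)
  moreover have "tavg k c J = a J" if "length J = k" for k J
  proof -
    have "tpoly k c = tpoly k (b k)" by (rule tpoly_cong) (simp add: c_def)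
    then have "tavg k c J = tavg k (b k) J" by (simp only: tavg_def)
    then show ?thesis using b that by simp
  qed
  ultimately have "tsym c \<and> rapid c \<and> (\<forall>k J. length J = k \<longrightarrow> tavg k c J = a J)" by simp
  then show ?thesis by (rule exI[of _ c])
qed

lemma abs_mon_le_1: "norm w \<le> 1 \<Longrightarrow> \<bar>mon w J\<bar> \<le> 1"
proof (induction J)
  case (Cons j J)
  have "\<bar>w $ j\<bar> \<le> 1" using component_le_norm_cart[of w j] Cons.prems by linarith
  then have "\<bar>w $ j\<bar> * \<bar>mon w J\<bar> \<le> 1 * 1" using Cons by (intro mult_mono) auto
  then show ?case by (simp add: abs_mult)
qed simp

lemma norm_tpoly_le_sum:
  assumes "norm w \<le> 1"
  shows "norm (tpoly k a w) \<le> (\<Sum>J | length J = k. norm (a J))"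
  unfolding tpoly_def
proof (rule sum_norm_le)
  fix J
  have "\<bar>mon w J\<bar> * norm (a J) \<le> 1 * norm (a J)" by (intro mult_right_mono abs_mon_le_1 assms) simp
  then show "norm (mon w J *\<^sub>R a J) \<le> norm (a J)" by simp
qed

lemma norm_tpoly_le_sum': "norm (tpoly k a (t *\<^sub>R w)) \<le> (\<Sum>J | length J = k. norm (a J)) * (1 + \<bar>t\<bar>) ^ k" if "norm w \<le> 1"
proof -
  have "norm (tpoly k a (t *\<^sub>R w)) = \<bar>t\<bar> ^ k * norm (tpoly k a w)" by (simp add: tpoly_scaleR power_abs)
  also have "\<dots> \<le> (1 + \<bar>t\<bar>) ^ k * (\<Sum>J | length J = k. norm (a J))"
    by (intro mult_mono power_mono norm_tpoly_le_sum that) (auto simp: sum_nonneg)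
  finally show ?thesis by (simp only: mult.commute)
qed

lemma rapid_summable: "rapid a \<Longrightarrow> summable (\<lambda>k. (\<Sum>J | length J = k. norm (a J)) * (1 + \<bar>t\<bar>) ^ k)"
  unfolding rapid_def by simp

lemma sphere_avg_series:
  fixes x :: "real ^ 'n"
  assumes a: "rapid a"
  shows "(\<lambda>k. tpoly k (tavg k a) x) sums sphere_avg (\<lambda>w. \<Sum>k. tpoly k a ((x \<bullet> w) *\<^sub>R w))"
proof -
  have "(\<lambda>k. sphere_avg (\<lambda>w. (x \<bullet> w) ^ k *\<^sub>R tpoly k a w)) sums sphere_avg (\<lambda>w. \<Sum>k. (x \<bullet> w) ^ k *\<^sub>R tpoly k a w)"
  proof (rule sphere_avg_sums[OF _ _ rapid_summable[OF a, of "norm x"]])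
    show "continuous_on (sphere 0 1) (\<lambda>w. (x \<bullet> w) ^ k *\<^sub>R tpoly k a w)" for k
      by (intro continuous_intros continuous_on_tpoly)
    fix k and w :: "real ^ 'n" assume w: "w \<in> sphere 0 1"
    then have "\<bar>x \<bullet> w\<bar> \<le> norm x" using Cauchy_Schwarz_ineq2[of x w] by simp
    then have "(1 + \<bar>x \<bullet> w\<bar>) ^ k \<le> (1 + \<bar>norm x\<bar>) ^ k" by (intro power_mono) auto
    moreover have "norm (tpoly k a ((x \<bullet> w) *\<^sub>R w)) \<le> (\<Sum>J | length J = k. norm (a J)) * (1 + \<bar>x \<bullet> w\<bar>) ^ k"
      using w by (intro norm_tpoly_le_sum') simp
    ultimately show "norm ((x \<bullet> w) ^ k *\<^sub>R tpoly k a w) \<le> (\<Sum>J | length J = k. norm (a J)) * (1 + \<bar>norm x\<bar>) ^ k"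
      unfolding tpoly_scaleR[symmetric] by (meson mult_left_mono order_trans norm_ge_zero sum_nonneg)
  qed
  then show ?thesis unfolding sphere_avg_inner_power tpoly_scaleR .
qed

text \<open>The tensor consists of the derivatives at 0 in the directions of the hyperplane, divided
  by \<open>fact k\<close>. Its decay comes from Cauchy estimates with a radius adapted to the
  weight \<open>R\<close>.\<close>

lemma M0_expansion:
  fixes F :: "real \<times> (real ^ ('n::{finite,linorder})) \<Rightarrow> 'n clif"
  assumes "F \<in> M0"
  shows "\<exists>a. tsym a \<and> rapid a \<and> (\<forall>x. (\<lambda>k. tpoly k a x) sums F (0, x))"
proof -
  let ?D = "monogenic_system.D"
  have F: "monogenic_system.sol F" using assms by (simp add: M0_def monogenic_iff_sol)
  define e :: "'n \<Rightarrow> real \<times> ((real, 'n) vec)" where "e j = (0, axis j 1)" for j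
  have ne: "norm (e j) = 1" for j by (simp add: e_def norm_Pair)
  define a where "a J = foldr ?D (map e J) F 0 /\<^sub>R fact (length J)" for J
  have sym: "tsym a"
    unfolding tsym_def
  proof (intro allI impI)
    fix J J' :: "'n list" assume m: "mset J = mset J'"
    have "length J = length J'" using arg_cong[OF m, of size] by (simp only: size_mset)
    moreover have "foldr ?D (map e J) F = foldr ?D (map e J') F"
      by (rule monogenic_system.foldr_D_mset[OF F]) (simp add: m)
    ultimately show "a J = a J'" by (simp only: a_def)
  qed
  have sums: "(\<lambda>k. tpoly k a x) sums F (0, x)" for x
  proof -
    have "(\<Sum>j\<in>UNIV. x $ j *\<^sub>R e j) = (0, x)"
      using basis_expansion[of x] by (simp add: e_def prod_eq_iff fst_sum snd_sum scalar_mult_eq_scaleR)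
    then have "(?D (0, x) ^^ k) F 0 /\<^sub>R fact k = tpoly k a x" for k
      using monogenic_system.funpow_D_expand[where e=e and x=x and k=k, OF F]
      by (simp add: tpoly_def a_def scaleR_sum_right mult.commute)
    then show ?thesis using monogenic_system.sol_taylor[OF F, of "(0, x)" 0] by simp
  qed
  have "rapid a"
    unfolding rapid_def
  proof (intro allI impI)
    fix R :: real assume R: "1 \<le> R"
    define n where "n = real CARD('n)"
    have n: "1 \<le> n" by (simp add: n_def Suc_leI)
    obtain L where L: "0 < L" and bnd: "\<forall>Q>0. \<exists>C\<ge>0. \<forall>vs. (\<forall>v\<in>set vs. norm v \<le> 1) \<longrightarrow>
        norm (foldr ?D vs F 0) / fact (length vs) \<le> (L / Q) ^ length vs * C"
      using monogenic_system.sol_derivatives_bound[OF F] by (elim exE conjE)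
    \<comment> \<open>Makes the product of \<open>L / Q\<close>, the weight \<open>R\<close> and the
      number \<open>n\<close> of directions equal to 1/2, so that a geometric series
      dominates.\<close>
    define Q where "Q = 2 * n * L * R"
    have Q: "0 < Q" using n L R by (simp add: Q_def)
    obtain C where C: "0 \<le> C" and bC: "\<forall>vs. (\<forall>v\<in>set vs. norm v \<le> 1) \<longrightarrow> norm (foldr ?D vs F 0) / fact (length vs) \<le> (L / Q) ^ length vs * C"
      using bnd[rule_format, OF Q] by (elim exE conjE)
    have "summable (\<lambda>k. C * (1/2::real) ^ k)" by (intro summable_mult summable_geometric) simp
    then show "summable (\<lambda>k. (\<Sum>J | length J = k. norm (a J)) * R ^ k)"
    proof (rule summable_comparison_test'[of _ 0])
      fix k
      have aJ: "norm (a J) \<le> (L / Q) ^ k * C" if "length J = k" for J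
      proof -
        have "norm (foldr ?D (map e J) F 0) / fact (length (map e J)) \<le> (L / Q) ^ length (map e J) * C"
          using ne by (intro bC[rule_format]) auto
        then show ?thesis using that by (simp add: a_def divide_inverse_commute)
      qed
      have "(\<Sum>J | length J = k. norm (a J)) \<le> (\<Sum>J::'n list | length J = k. (L / Q) ^ k * C)"
        by (rule sum_mono) (simp add: aJ)
      also have "\<dots> = n ^ k * ((L / Q) ^ k * C)" by (simp add: card_lists_length n_def)
      finally have "(\<Sum>J | length J = k. norm (a J)) * R ^ k \<le> n ^ k * ((L / Q) ^ k * C) * R ^ k"
        using R by (intro mult_right_mono) auto
      also have "\<dots> = C * (n * L * R / Q) ^ k" by (simp add: power_divide power_mult_distrib)
      also have "n * L * R / Q = 1 / 2" using n L R by (simp add: Q_def)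
      finally show "norm ((\<Sum>J | length J = k. norm (a J)) * R ^ k) \<le> C * (1/2) ^ k"
        using R by (simp add: sum_nonneg)
    qed
  qed
  with sym sums have "tsym a \<and> rapid a \<and> (\<forall>x. (\<lambda>k. tpoly k a x) sums F (0, x))" by simp
  then show ?thesis by (rule exI[of _ a])
qed

section \<open>Slice monogenic extensions\<close>

definition cpow :: "nat \<Rightarrow> real \<times> real \<times> 'x \<Rightarrow> complex" where
  "cpow k z = Complex (fst (snd z)) (- fst z) ^ k"

lemma cpow_Suc:
  "Re (cpow (Suc k) z) = fst (snd z) * Re (cpow k z) + fst z * Im (cpow k z)"
  "Im (cpow (Suc k) z) = fst (snd z) * Im (cpow k z) - fst z * Re (cpow k z)"
  by (simp_all add: cpow_def)

text \<open>\<open>slice_term a k\<close> is \<open>(p - \<omega> x\<^sub>0)^k P\<^sub>k(\<omega>)\<close>, the slice monogenic extension of \<open>p^k P\<^sub>k(\<omega>)\<close>,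
  with the powers of \<open>p - \<omega> x\<^sub>0\<close> computed in the complex plane spanned by 1 and \<open>\<omega>\<close>.\<close>

definition slice_term :: "('n::{finite,linorder} list \<Rightarrow> 'n clif) \<Rightarrow> nat \<Rightarrow> 'n slicefun" where
  "slice_term a k z = Re (cpow k z) *\<^sub>R tpoly k a (snd (snd z)) + Im (cpow k z) *\<^sub>R (vec_cl (snd (snd z)) \<odot> tpoly k a (snd (snd z)))"

lemma bpoly_tpoly:
  fixes a :: "'n::finite list \<Rightarrow> 'b::euclidean_space"
  shows "bpoly k (\<Sum>J | length J = k. norm (a J)) (\<lambda>z :: real \<times> real \<times> (real ^ 'n). tpoly k a (snd (snd z)))"
proof (induction k arbitrary: a)
  case 0
  show ?case unfolding tpoly_0 length_0_set by (rule bpoly_const) simp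
next
  case (Suc k)
  have "bpoly (Suc k) (\<Sum>j\<in>UNIV. \<Sum>J | length J = k. norm (a (j # J)))
     (\<lambda>z :: real \<times> real \<times> (real ^ 'n). \<Sum>j\<in>UNIV. (z \<bullet> (0, 0, axis j 1)) *\<^sub>R tpoly k (\<lambda>J. a (j # J)) (snd (snd z)))"
    by (intro bpoly_sum bpoly_lin Suc) (simp_all add: norm_Pair)
  moreover have "z \<bullet> (0, 0, axis j 1) = snd (snd z) $ j" for z :: "real \<times> real \<times> (real ^ 'n)" and j
    by (simp add: inner_prod_def inner_axis)
  ultimately show ?case unfolding tpoly_Suc sum_lists_Suc by simp
qed

text \<open>Each further factor \<open>p - i x0\<close> replaces a real or imaginary part by two
  terms, which doubles the bound and raises the degree by one.\<close>

lemma bpoly_cpow: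
  fixes f :: "real \<times> real \<times> 'x::euclidean_space \<Rightarrow> 'b::euclidean_space"
  assumes f: "bpoly l M f"
  shows "bpoly (k + l) (2 ^ k * M) (\<lambda>z. Re (cpow k z) *\<^sub>R f z) \<and> bpoly (k + l) (2 ^ k * M) (\<lambda>z. Im (cpow k z) *\<^sub>R f z)"
proof (induction k)
  case 0
  have "bpoly l M (\<lambda>z :: real \<times> real \<times> 'x. 0 :: 'b)" using bpoly_nonneg[OF f] by (intro bpoly_const) simp
  then show ?case using f by (simp add: cpow_def)
next
  case (Suc k)
  let ?p = "(0, 1, 0) :: real \<times> real \<times> 'x" and ?x = "(1, 0, 0) :: real \<times> real \<times> 'x"
  have n: "norm ?p \<le> 1" "norm ?x \<le> 1" "norm (- ?x) \<le> 1" by (simp_all add: norm_Pair)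
  have "bpoly (Suc (k + l)) (2 ^ k * M + 2 ^ k * M) (\<lambda>z. (z \<bullet> ?p) *\<^sub>R (Re (cpow k z) *\<^sub>R f z) + (z \<bullet> ?x) *\<^sub>R (Im (cpow k z) *\<^sub>R f z))"
    by (rule bpoly_add[OF bpoly_lin[OF conjunct1[OF Suc] n(1)] bpoly_lin[OF conjunct2[OF Suc] n(2)]])
  moreover have "bpoly (Suc (k + l)) (2 ^ k * M + 2 ^ k * M) (\<lambda>z. (z \<bullet> ?p) *\<^sub>R (Im (cpow k z) *\<^sub>R f z) + (z \<bullet> - ?x) *\<^sub>R (Re (cpow k z) *\<^sub>R f z))"
    by (rule bpoly_add[OF bpoly_lin[OF conjunct2[OF Suc] n(1)] bpoly_lin[OF conjunct1[OF Suc] n(3)]])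
  ultimately show ?case
    unfolding cpow_Suc by (simp add: inner_prod_def algebra_simps)
qed

lemma slice_term_series:
  assumes "rapid a"
  shows "\<exists>M. bpoly_series (\<lambda>k. 2 * k + 1) M (slice_term a)"
proof -
  obtain L where L: "0 < L" "\<And>x y :: 'a clif. norm (x \<odot> y) \<le> norm x * norm y * L" using clmul.pos_bounded by blast
  define n where "n = real CARD('a)"
  have n: "1 \<le> n" by (simp add: n_def Suc_leI)
  define \<mu> where "\<mu> k = (\<Sum>J | length J = k. norm (a J))" for k
  have \<mu>0: "0 \<le> \<mu> k" for k by (simp add: \<mu>_def sum_nonneg)
  have P: "bpoly k (\<mu> k) (\<lambda>z :: real \<times> real \<times> ((real, 'a) vec). tpoly k a (snd (snd z)))" for k
    unfolding \<mu>_def by (rule bpoly_tpoly)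
  have "bpoly (Suc k) (\<Sum>j\<in>(UNIV :: 'a set). L * \<mu> k)
      (\<lambda>z :: real \<times> real \<times> ((real, 'a) vec). \<Sum>j\<in>UNIV. (z \<bullet> (0, 0, axis j 1)) *\<^sub>R (gen j \<odot> tpoly k a (snd (snd z))))" for k
  proof (intro bpoly_sum bpoly_lin)
    show "bpoly k (L * \<mu> k) (\<lambda>z :: real \<times> real \<times> ((real, 'a) vec). gen j \<odot> tpoly k a (snd (snd z)))" for j
    proof (rule bpoly_linear_image[OF P clmul.bounded_linear_right])
      show "norm (gen j \<odot> c) \<le> L * norm c" for c using L(2)[of "gen j" c] by (simp add: gen_eq_blade mult.commute)
    qed (use L in simp)
  qed (simp_all add: norm_Pair)
  moreover have "z \<bullet> (0, 0, axis j 1) = snd (snd z) $ j" for z :: "real \<times> real \<times> ((real, 'a) vec)" and j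
    by (simp add: inner_prod_def inner_axis)
  ultimately have V: "bpoly (Suc k) (n * (L * \<mu> k)) (\<lambda>z :: real \<times> real \<times> ((real, 'a) vec). vec_cl (snd (snd z)) \<odot> tpoly k a (snd (snd z)))" for k
    by (simp add: vec_cl_clmul n_def)
  define M where "M k = 2 ^ k * \<mu> k + 2 ^ k * (n * (L * \<mu> k))" for k
  have "bpoly (2 * k + 1) (M k) (slice_term a k)" for k
  proof -
    have "bpoly (2 * k + 1) (2 ^ k * \<mu> k) (\<lambda>z. Re (cpow k z) *\<^sub>R tpoly k a (snd (snd z)))"
      by (rule bpoly_mono_degree[OF conjunct1[OF bpoly_cpow[OF P]]]) simp
    moreover have "bpoly (2 * k + 1) (2 ^ k * (n * (L * \<mu> k))) (\<lambda>z. Im (cpow k z) *\<^sub>R (vec_cl (snd (snd z)) \<odot> tpoly k a (snd (snd z))))"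
      by (rule bpoly_mono_degree[OF conjunct2[OF bpoly_cpow[OF V]]]) simp
    ultimately show ?thesis unfolding M_def slice_term_def[abs_def] by (rule bpoly_add)
  qed
  moreover have "summable (\<lambda>k. M k * R ^ (2 * k + 1))" if R: "1 \<le> R" for R
  proof -
    have "1 \<le> R * R" using R by (intro mult_ge1_I)
    then have "1 \<le> 2 * (R * R)" by simp
    then have "summable (\<lambda>k. \<mu> k * (2 * (R * R)) ^ k)" 
      unfolding \<mu>_def by (rule assms[unfolded rapid_def, rule_format])
    then have "summable (\<lambda>k. (R * (1 + n * L)) * (\<mu> k * (2 * (R * R)) ^ k))" by (rule summable_mult)
    moreover have "M k * R ^ (2 * k + 1) = (R * (1 + n * L)) * (\<mu> k * (2 * (R * R)) ^ k)" for k
      by (simp add: M_def power_mult_distrib power_add power_mult power2_eq_square algebra_simps)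
    ultimately show ?thesis by (simp only:)
  qed
  ultimately have "bpoly_series (\<lambda>k. 2 * k + 1) M (slice_term a)" unfolding bpoly_series_def by simp
  then show ?thesis by (rule exI[of _ M])
qed

text \<open>\<open>\<zeta>\<close> is the complex derivative of the power. Differentiation in
  \<open>x0\<close> brings an extra factor \<open>-i\<close>, which becomes
  \<open>-\<omega>\<close>, and so the two partial derivatives satisfy the slice equation on the
  sphere.\<close>

lemma slice_term_partial:
  fixes a :: "'n::{finite,linorder} list \<Rightarrow> 'n clif"
  defines "\<zeta> \<equiv> \<lambda>k x0 p. of_nat k * Complex p (- x0) ^ (k - 1)"
  shows "((\<lambda>t. slice_term a k (t, p, w)) has_vector_derivative
      (Im (\<zeta> k x0 p) *\<^sub>R tpoly k a w - Re (\<zeta> k x0 p) *\<^sub>R (vec_cl w \<odot> tpoly k a w))) (at x0)"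
    "((\<lambda>t. slice_term a k (x0, t, w)) has_vector_derivative
      (Re (\<zeta> k x0 p) *\<^sub>R tpoly k a w + Im (\<zeta> k x0 p) *\<^sub>R (vec_cl w \<odot> tpoly k a w))) (at p)"
proof -
  have pow: "((\<lambda>z::complex. z ^ k) has_field_derivative of_nat k * z ^ (k - 1)) (at z)" for z
  proof -
    have "((\<lambda>z::complex. z ^ k) has_field_derivative of_nat k * (1 * z ^ (k - Suc 0))) (at z)"
      by (rule DERIV_power[OF DERIV_ident])
    then show ?thesis by simp
  qed
  have tm: "((\<lambda>t. Re (g t) *\<^sub>R P + Im (g t) *\<^sub>R Q) has_vector_derivative (Re g' *\<^sub>R P + Im g' *\<^sub>R Q)) (at s)"
    if "(g has_vector_derivative g') (at s)" for g :: "real \<Rightarrow> complex" and g' s and P Q :: "'n clif"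
    by (intro has_vector_derivative_add bounded_linear.has_vector_derivative[OF bounded_linear_scaleR_left]
      bounded_linear.has_vector_derivative[OF bounded_linear_Re] bounded_linear.has_vector_derivative[OF bounded_linear_Im] that)
  have "((\<lambda>t. of_real p - t *\<^sub>R \<i>) has_vector_derivative - \<i>) (at x0)"
    unfolding has_vector_derivative_def by (auto intro!: derivative_eq_intros)
  moreover have "of_real p - t *\<^sub>R \<i> = Complex p (- t)" for t by (simp add: complex_eq_iff)
  ultimately have "((\<lambda>t. Complex p (- t)) has_vector_derivative - \<i>) (at x0)" by simp
  from field_vector_diff_chain_at[OF this pow]
  have 1: "((\<lambda>t. cpow k (t, p, w)) has_vector_derivative - \<i> * \<zeta> k x0 p) (at x0)"
    by (simp add: cpow_def o_def \<zeta>_def)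
  have "((\<lambda>t. t *\<^sub>R 1 - \<i> * of_real x0) has_vector_derivative 1) (at p)"
    unfolding has_vector_derivative_def by (auto intro!: derivative_eq_intros)
  moreover have "t *\<^sub>R 1 - \<i> * of_real x0 = Complex t (- x0)" for t by (simp add: complex_eq_iff)
  ultimately have "((\<lambda>t. Complex t (- x0)) has_vector_derivative 1) (at p)" by simp
  from field_vector_diff_chain_at[OF this pow]
  have 2: "((\<lambda>t. cpow k (x0, t, w)) has_vector_derivative \<zeta> k x0 p) (at p)"
    by (simp add: cpow_def o_def \<zeta>_def)
  show "((\<lambda>t. slice_term a k (t, p, w)) has_vector_derivative
      (Im (\<zeta> k x0 p) *\<^sub>R tpoly k a w - Re (\<zeta> k x0 p) *\<^sub>R (vec_cl w \<odot> tpoly k a w))) (at x0)"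
    using tm[OF 1, of "tpoly k a w" "vec_cl w \<odot> tpoly k a w"] by (simp add: slice_term_def)
  show "((\<lambda>t. slice_term a k (x0, t, w)) has_vector_derivative
      (Re (\<zeta> k x0 p) *\<^sub>R tpoly k a w + Im (\<zeta> k x0 p) *\<^sub>R (vec_cl w \<odot> tpoly k a w))) (at p)"
    using tm[OF 2, of "tpoly k a w" "vec_cl w \<odot> tpoly k a w"] by (simp add: slice_term_def)
qed

lemma slice_partial_derivatives:
  fixes F :: "'n::{finite,linorder} slicefun"
  assumes "(F has_derivative F') (at (x0, p, w))"
  shows "vector_derivative (\<lambda>t. F (t, p, w)) (at x0) = F' (1, 0, 0)"
    "vector_derivative (\<lambda>t. F (x0, t, w)) (at p) = F' (0, 1, 0)"
  using vector_derivative_line[of F F' "(0, p, w)" x0 "(1, 0, 0)"] vector_derivative_line[of F F' "(x0, 0, w)" p "(0, 1, 0)"] assms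
  by simp_all

definition slice_fun :: "('n::{finite,linorder} list \<Rightarrow> 'n clif) \<Rightarrow> 'n slicefun" where
  "slice_fun a z = (if snd (snd z) \<in> sphere 0 1 then \<Sum>k. slice_term a k z else 0)"

text \<open>Changing the sign of \<open>p\<close> sends \<open>p - i x0\<close> to minus its
  conjugate. The sign \<open>(-1) ^ k\<close> cancels against that of the polynomial, and the
  conjugation against the sign of \<omega> in the second term.\<close>

lemma slice_term_even: "slice_term a k (x0, - p, - w) = slice_term a k (x0, p, w)"
proof -
  have "Complex (- p) (- x0) = - cnj (Complex p (- x0))" by (simp add: complex_eq_iff)
  then have "cpow k (x0, - p, - w) = (- 1) ^ k * cnj (cpow k (x0, p, w))"
    by (simp add: cpow_def power_minus[of "cnj _"])
  moreover have "(- 1 :: complex) ^ k = of_real ((- 1) ^ k)" by simp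
  ultimately have c: "Re (cpow k (x0, - p, - w)) = (- 1) ^ k * Re (cpow k (x0, p, w))"
    "Im (cpow k (x0, - p, - w)) = - ((- 1) ^ k * Im (cpow k (x0, p, w)))" by (simp_all del: of_real_power)
  have t: "tpoly k a (- w) = (- 1) ^ k *\<^sub>R tpoly k a w" using tpoly_scaleR[of k a "- 1" w] by simp
  have s: "(- 1 :: real) ^ k * (- 1) ^ k = 1" by (simp flip: power_add)
  show ?thesis
    unfolding slice_term_def snd_conv c t vec_cl_uminus
    by (simp add: clmul.minus_left clmul.scaleR_right mult.commute mult.left_commute s)
qed

text \<open>The series makes sense for all \<open>w\<close> and is the smooth extension off the
  sphere; the equation holds term by term on the sphere, where \<omega> squares to -1.\<close>

lemma slice_fun_S0:
  fixes a :: "'n::{finite,linorder} list \<Rightarrow> 'n clif"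
  assumes a: "rapid a"
  shows "slice_fun a \<in> S0"
proof -
  define F where "F z = (\<Sum>k. slice_term a k z)" for z
  obtain M where M: "bpoly_series (\<lambda>k. 2 * k + 1) M (slice_term a)" using slice_term_series[OF a] ..
  have sm: "smooth F" unfolding F_def[abs_def] by (rule bpoly_series_smooth[OF M])
  have eq: "slice_fun a (x0, p, w) = F (x0, p, w)" if "w \<in> sphere 0 1" for x0 p w
    using that by (simp add: slice_fun_def F_def)
  have "smooth_slice (slice_fun a)"
    unfolding smooth_slice_def using sm eq by (auto simp: slice_fun_def)
  moreover have "vector_derivative (\<lambda>t. slice_fun a (t, p, w)) (at x0)
           + vec_cl w \<odot> vector_derivative (\<lambda>t. slice_fun a (x0, t, w)) (at p) = 0" if w: "w \<in> sphere 0 1" for w x0 p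
  proof (rule bpoly_series_derivative[OF M])
    fix f' assume d: "\<And>k z. (slice_term a k has_derivative f' k z) (at z)"
      and dF: "\<And>z. ((\<lambda>z. \<Sum>k. slice_term a k z) has_derivative (\<lambda>v. \<Sum>k. f' k z v)) (at z)"
      and s: "\<And>v. bpoly_series (\<lambda>k. 2 * k + 1) (\<lambda>k. real (2 * k + 1) * norm v * M k) (\<lambda>k z. f' k z v)"
    let ?z = "(x0, p, w)"
    have sm: "summable (\<lambda>k. f' k ?z v)" for v by (rule bpoly_series_norm(3)[OF s])
    have tm: "f' k ?z (1, 0, 0) + vec_cl w \<odot> f' k ?z (0, 1, 0) = 0" for k
    proof -
      have tw: "vec_cl w \<odot> (vec_cl w \<odot> u) = - u" for u using w by (simp add: vec_cl_twice)
      show ?thesis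
        unfolding slice_partial_derivatives[OF d, symmetric] vector_derivative_at[OF slice_term_partial(1)] vector_derivative_at[OF slice_term_partial(2)]
        by (simp add: clmul.add_right clmul.scaleR_right tw)
    qed
    have "vector_derivative (\<lambda>t. slice_fun a (t, p, w)) (at x0) = (\<Sum>k. f' k ?z (1, 0, 0))"
      unfolding eq[OF w] F_def by (rule slice_partial_derivatives(1)[OF dF])
    moreover have "vector_derivative (\<lambda>t. slice_fun a (x0, t, w)) (at p) = (\<Sum>k. f' k ?z (0, 1, 0))"
      unfolding eq[OF w] F_def by (rule slice_partial_derivatives(2)[OF dF])
    moreover have "(\<Sum>k. f' k ?z (1, 0, 0)) + vec_cl w \<odot> (\<Sum>k. f' k ?z (0, 1, 0)) = (\<Sum>k. f' k ?z (1, 0, 0) + vec_cl w \<odot> f' k ?z (0, 1, 0))"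
      unfolding bounded_linear.suminf[OF clmul.bounded_linear_right sm]
      by (rule suminf_add[OF sm bounded_linear.summable[OF clmul.bounded_linear_right sm]])
    ultimately show ?thesis by (simp add: tm)
  qed
  moreover have "even_slice (slice_fun a)"
    unfolding even_slice_def slice_fun_def by (simp add: slice_term_even)
  ultimately show ?thesis by (simp add: S0_def slice_monogenic_def)
qed

lemma slice_fun_0:
  assumes "w \<in> sphere 0 1"
  shows "slice_fun a (0, p, w) = (\<Sum>k. tpoly k a (p *\<^sub>R w))"
proof -
  have "cpow k (0, p, w) = of_real (p ^ k)" for k by (simp add: cpow_def complex_of_real_def[symmetric] Complex_eq)
  then have "slice_term a k (0, p, w) = tpoly k a (p *\<^sub>R w)" for k
    by (simp add: slice_term_def tpoly_scaleR del: of_real_power)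
  then show ?thesis using assms by (simp add: slice_fun_def)
qed

lemma dualRadon_slice_fun:
  assumes "rapid a"
  shows "(\<lambda>k. tpoly k (tavg k a) x) sums dualRadon (slice_fun a) (0, x)"
proof -
  have "dualRadon (slice_fun a) (0, x) = sphere_avg (\<lambda>w. \<Sum>k. tpoly k a ((x \<bullet> w) *\<^sub>R w))"
    unfolding dualRadon_def prod.case by (rule sphere_avg_cong) (rule slice_fun_0)
  then show ?thesis using sphere_avg_series[OF assms, of x] by simp
qed

text \<open>The equation differentiates only in \<open>x0\<close> and \<open>p\<close>, directions
  in which the extension agrees with \<open>f\<close>. It therefore passes to the Frechet derivative
  of the extension, with which later computations are done.\<close>

lemma S0_extension:
  assumes "f \<in> S0"
  obtains F where "smooth F" "\<And>x0 p w. w \<in> sphere 0 1 \<Longrightarrow> F (x0, p, w) = f (x0, p, w)"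
    "\<And>x0 p w. w \<in> sphere 0 1 \<Longrightarrow> frechet_derivative F (at (x0, p, w)) (1, 0, 0) + vec_cl w \<odot> frechet_derivative F (at (x0, p, w)) (0, 1, 0) = 0"
proof -
  have f: "smooth_slice f" "\<And>w x0 p. w \<in> sphere 0 1 \<Longrightarrow> vector_derivative (\<lambda>t. f (t, p, w)) (at x0)
           + vec_cl w \<odot> vector_derivative (\<lambda>t. f (x0, t, w)) (at p) = 0"
    using assms by (auto simp: S0_def slice_monogenic_def)
  obtain F where F: "smooth F" and eq: "\<And>x0 p w. w \<in> sphere 0 1 \<Longrightarrow> F (x0, p, w) = f (x0, p, w)"
    using f(1) unfolding smooth_slice_def by blast
  have "frechet_derivative F (at (x0, p, w)) (1, 0, 0) + vec_cl w \<odot> frechet_derivative F (at (x0, p, w)) (0, 1, 0) = 0"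
    if w: "w \<in> sphere 0 1" for x0 p w
    using f(2)[OF w, of p x0] unfolding eq[OF w, symmetric] slice_partial_derivatives[OF smooth_derivative(1)[OF F]] .
  then show thesis using that F eq by blast
qed

lemma S0_I:
  assumes "smooth F" "\<And>x0 p w. w \<in> sphere 0 1 \<Longrightarrow> F (x0, p, w) = f (x0, p, w)"
    "\<And>x0 p w. w \<in> sphere 0 1 \<Longrightarrow> frechet_derivative F (at (x0, p, w)) (1, 0, 0) + vec_cl w \<odot> frechet_derivative F (at (x0, p, w)) (0, 1, 0) = 0"
    "\<And>x0 p w. w \<notin> sphere 0 1 \<Longrightarrow> f (x0, p, w) = 0" "\<And>x0 p w. w \<in> sphere 0 1 \<Longrightarrow> f (x0, - p, - w) = f (x0, p, w)"
  shows "f \<in> S0"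
proof -
  have "vector_derivative (\<lambda>t. f (t, p, w)) (at x0) + vec_cl w \<odot> vector_derivative (\<lambda>t. f (x0, t, w)) (at p) = 0"
    if w: "w \<in> sphere 0 1" for w x0 p
    unfolding assms(2)[OF w, symmetric] slice_partial_derivatives[OF smooth_derivative(1)[OF assms(1)]] by (rule assms(3)[OF w])
  moreover have "smooth_slice f" unfolding smooth_slice_def using assms(1,2,4) by blast
  moreover have "even_slice f" unfolding even_slice_def using assms(5) by blast
  ultimately show ?thesis by (simp add: S0_def slice_monogenic_def)
qed

lemma S0_outside: "f \<in> S0 \<Longrightarrow> w \<notin> sphere 0 1 \<Longrightarrow> f (x0, p, w) = 0"
  by (simp add: S0_def slice_monogenic_def smooth_slice_def)

lemma S0_even: "f \<in> S0 \<Longrightarrow> w \<in> sphere 0 1 \<Longrightarrow> f (x0, - p, - w) = f (x0, p, w)"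
  by (simp add: S0_def even_slice_def)

lemma S0_add:
  assumes f: "f \<in> S0" and g: "g \<in> S0"
  shows "(\<lambda>z. f z + g z) \<in> S0"
proof (rule S0_extension[OF f], rule S0_extension[OF g])
  fix F G assume F: "smooth F" "\<And>x0 p w. w \<in> sphere 0 1 \<Longrightarrow> F (x0, p, w) = f (x0, p, w)"
    "\<And>x0 p w. w \<in> sphere 0 1 \<Longrightarrow> frechet_derivative F (at (x0, p, w)) (1, 0, 0) + vec_cl w \<odot> frechet_derivative F (at (x0, p, w)) (0, 1, 0) = 0"
    and G: "smooth G" "\<And>x0 p w. w \<in> sphere 0 1 \<Longrightarrow> G (x0, p, w) = g (x0, p, w)"
    "\<And>x0 p w. w \<in> sphere 0 1 \<Longrightarrow> frechet_derivative G (at (x0, p, w)) (1, 0, 0) + vec_cl w \<odot> frechet_derivative G (at (x0, p, w)) (0, 1, 0) = 0"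
  have d: "frechet_derivative (\<lambda>z. F z + G z) (at z) = (\<lambda>v. frechet_derivative F (at z) v + frechet_derivative G (at z) v)" for z
    by (rule frechet_derivative_at[symmetric]) (intro has_derivative_add smooth_derivative F G)
  show ?thesis
  proof (rule S0_I[of "\<lambda>z. F z + G z"])
    show "smooth (\<lambda>z. F z + G z)" using F(1) G(1) by (simp add: smooth_def Ck_add)
    show "frechet_derivative (\<lambda>z. F z + G z) (at (x0, p, w)) (1, 0, 0) + vec_cl w \<odot> frechet_derivative (\<lambda>z. F z + G z) (at (x0, p, w)) (0, 1, 0) = 0"
      if w: "w \<in> sphere 0 1" for x0 p w
      using arg_cong2[OF F(3)[OF w, of x0 p] G(3)[OF w, of x0 p], of "(+)"] by (simp add: d clmul.add_right algebra_simps)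
  qed (simp_all add: F(2) G(2) S0_outside[OF f] S0_outside[OF g] S0_even[OF f] S0_even[OF g])
qed

text \<open>Maps that commute with left multiplication preserve the equation. Right multiplication
  by a Clifford number and the change of sign are both of this kind.\<close>

lemma S0_linear_image:
  fixes f :: "'n::{finite,linorder} slicefun"
  assumes f: "f \<in> S0" and L: "bounded_linear L" "\<And>u v. L (u \<odot> v) = u \<odot> L v"
  shows "(\<lambda>z. L (f z)) \<in> S0"
proof (rule S0_extension[OF f])
  fix F assume F: "smooth F" "\<And>x0 p w. w \<in> sphere 0 1 \<Longrightarrow> F (x0, p, w) = f (x0, p, w)"
    "\<And>x0 p w. w \<in> sphere 0 1 \<Longrightarrow> frechet_derivative F (at (x0, p, w)) (1, 0, 0) + vec_cl w \<odot> frechet_derivative F (at (x0, p, w)) (0, 1, 0) = 0"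
  note lin = bounded_linear.linear[OF L(1)]
  have d: "frechet_derivative (\<lambda>z. L (F z)) (at z) = (\<lambda>v. L (frechet_derivative F (at z) v))" for z
    by (rule frechet_derivative_at[symmetric]) (intro bounded_linear.has_derivative[OF L(1)] smooth_derivative F)
  show ?thesis
  proof (rule S0_I[of "\<lambda>z. L (F z)"])
    show "smooth (\<lambda>z. L (F z))" using F(1) by (simp add: smooth_def Ck_bounded_linear[OF L(1)])
    show "frechet_derivative (\<lambda>z. L (F z)) (at (x0, p, w)) (1, 0, 0) + vec_cl w \<odot> frechet_derivative (\<lambda>z. L (F z)) (at (x0, p, w)) (0, 1, 0) = 0"
      if w: "w \<in> sphere 0 1" for x0 p w
      unfolding d L(2)[symmetric] linear_add[OF lin, symmetric] F(3)[OF w] by (rule linear_0[OF lin])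
  qed (simp_all add: F(2) S0_outside[OF f] S0_even[OF f] linear_0[OF lin])
qed

section \<open>The dual Radon transform\<close>

lemma S0_continuous:
  fixes f :: "'n::{finite,linorder} slicefun"
  assumes "f \<in> S0"
  shows "continuous_on (sphere 0 1) (\<lambda>w. f (x0, x \<bullet> w, w))"
proof (rule S0_extension[OF assms])
  fix F assume F: "smooth F" "\<And>x0 p w. w \<in> sphere 0 1 \<Longrightarrow> F (x0, p, w) = f (x0, p, w)"
  have "continuous_on UNIV F" using smooth_derivative(1)[OF F(1)] by (intro has_derivative_continuous_on) auto
  then have "continuous_on (sphere 0 1) (\<lambda>w. F (x0, x \<bullet> w, w))"
    by (rule continuous_on_compose2) (auto intro!: continuous_intros)
  then show ?thesis by (rule continuous_on_eq) (rule F(2))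
qed

lemma dualRadon_add:
  assumes "f \<in> S0" "g \<in> S0"
  shows "dualRadon (\<lambda>z. f z + g z) = (\<lambda>y. dualRadon f y + dualRadon g y)"
  unfolding dualRadon_def by (intro ext) (simp add: case_prod_beta sphere_avg_add S0_continuous assms)

lemma dualRadon_linear_image:
  assumes "f \<in> S0" "bounded_linear L"
  shows "dualRadon (\<lambda>z. L (f z)) = (\<lambda>y. L (dualRadon f y))"
  unfolding dualRadon_def by (intro ext) (simp add: case_prod_beta sphere_avg_bounded_linear[OF assms(2)] S0_continuous assms(1))

text \<open>Under the integral a derivative in the j-th coordinate brings a factor
  \<open>w $ j\<close>, and the sum of the \<open>gen j\<close> with these factors is \<omega>. The
  Cauchy-Riemann operator of the transform is thus the average of
  \<open>P z w + vec_cl w \<odot> Q z w\<close>, which vanishes.\<close>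

lemma dualRadon_M0:
  fixes f :: "'n::{finite,linorder} slicefun"
  assumes "f \<in> S0"
  shows "dualRadon f \<in> M0"
proof (rule S0_extension[OF assms])
  fix F assume F: "smooth F" "\<And>x0 p w. w \<in> sphere 0 1 \<Longrightarrow> F (x0, p, w) = f (x0, p, w)"
    and eq: "\<And>x0 p w. w \<in> sphere 0 1 \<Longrightarrow> frechet_derivative F (at (x0, p, w)) (1, 0, 0) + vec_cl w \<odot> frechet_derivative F (at (x0, p, w)) (0, 1, 0) = 0"
  define \<phi> :: "real \<times> ((real, 'n) vec) \<Rightarrow> (real, 'n) vec \<Rightarrow> real \<times> real \<times> ((real, 'n) vec)"
    where "\<phi> z w = (fst z, snd z \<bullet> w, w)" for z w
  define P where "P z w = frechet_derivative F (at (\<phi> z w)) (1, 0, 0)" for z w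
  define Q where "Q z w = frechet_derivative F (at (\<phi> z w)) (0, 1, 0)" for z w
  have PQ: "P z w + vec_cl w \<odot> Q z w = 0" if "w \<in> sphere 0 1" for z w
    using eq[OF that] by (simp add: P_def Q_def \<phi>_def)
  have G: "dualRadon f = (\<lambda>z. sphere_avg (\<lambda>w. F (\<phi> z w)))"
    unfolding dualRadon_def case_prod_unfold \<phi>_def by (intro ext sphere_avg_cong) (simp add: F(2))
  have c\<phi>: "continuous_on S (\<lambda>p. \<phi> (fst p) (snd p))" for S unfolding \<phi>_def by (intro continuous_intros)
  have cF: "continuous_on UNIV F" using smooth_derivative(1)[OF F(1)] by (intro has_derivative_continuous_on) auto
  have cP: "continuous_on S (\<lambda>p. P (fst p) (snd p))" and cQ: "continuous_on S (\<lambda>p. Q (fst p) (snd p))" for S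
    unfolding P_def Q_def by (rule continuous_on_compose2[OF smooth_derivative(2)[OF F(1)] c\<phi> subset_UNIV])+
  have cP1: "continuous_on (sphere 0 1) (P z)" and cQ1: "continuous_on (sphere 0 1) (Q z)" for z
  proof -
    have "continuous_on (sphere 0 1) (\<lambda>w. (z, w))" by (intro continuous_intros)
    from continuous_on_compose2[OF cP this subset_UNIV] continuous_on_compose2[OF cQ this subset_UNIV]
    show "continuous_on (sphere 0 1) (P z)" "continuous_on (sphere 0 1) (Q z)" by simp_all
  qed
  have dG: "(dualRadon f has_derivative (\<lambda>v. sphere_avg (\<lambda>w. fst v *\<^sub>R P z w + (snd v \<bullet> w) *\<^sub>R Q z w))) (at z)" for z
    unfolding G
  proof (rule sphere_avg_has_derivative)
    show "continuous_on (UNIV \<times> sphere 0 1) (\<lambda>p. F (\<phi> (fst p) (snd p)))"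
      by (rule continuous_on_compose2[OF cF c\<phi> subset_UNIV])
    show "continuous_on (UNIV \<times> sphere 0 1) (\<lambda>p. fst v *\<^sub>R P (fst p) (snd p) + (snd v \<bullet> snd p) *\<^sub>R Q (fst p) (snd p))" for v
      by (intro continuous_intros cP cQ)
    fix z w
    note dF = smooth_derivative(1)[OF F(1)]
    note lin = has_derivative_linear[OF dF]
    have "((\<lambda>z. \<phi> z w) has_derivative (\<lambda>v. (fst v, snd v \<bullet> w, 0))) (at z)"
      unfolding \<phi>_def by (intro has_derivative_Pair has_derivative_fst has_derivative_snd has_derivative_inner_left has_derivative_ident has_derivative_const)
    from has_derivative_compose[OF this dF]
    have "((\<lambda>z. F (\<phi> z w)) has_derivative (\<lambda>v. frechet_derivative F (at (\<phi> z w)) (fst v, snd v \<bullet> w, 0))) (at z)" .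
    moreover have "frechet_derivative F (at (\<phi> z w)) (fst v, snd v \<bullet> w, 0) = fst v *\<^sub>R P z w + (snd v \<bullet> w) *\<^sub>R Q z w" for v
    proof -
      have "(fst v, snd v \<bullet> w, 0 :: (real, 'n) vec) = fst v *\<^sub>R (1, 0, 0) + (snd v \<bullet> w) *\<^sub>R (0, 1, 0)" by simp
      then show ?thesis unfolding P_def Q_def linear_cmul[OF lin, symmetric] linear_add[OF lin, symmetric] by (rule arg_cong)
    qed
    ultimately show "((\<lambda>z. F (\<phi> z w)) has_derivative (\<lambda>v. fst v *\<^sub>R P z w + (snd v \<bullet> w) *\<^sub>R Q z w)) (at z)"
      by (simp only:)
  qed
  have "monogenic_system.sol (dualRadon f)"
  proof (rule monogenic_system.solI[OF dG])
    fix z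
    have v0: "vec_cl (0 :: (real, 'n) vec) = 0" by (simp add: vec_cl_def)
    have c1: "continuous_on (sphere 0 1) (\<lambda>w. w $ j *\<^sub>R Q z w)" for j by (intro continuous_intros cQ1)
    have "(\<Sum>b\<in>Basis. fst b *\<^sub>R sphere_avg (\<lambda>w. fst b *\<^sub>R P z w + (snd b \<bullet> w) *\<^sub>R Q z w) + vec_cl (snd b) \<odot> sphere_avg (\<lambda>w. fst b *\<^sub>R P z w + (snd b \<bullet> w) *\<^sub>R Q z w))
       = sphere_avg (P z) + (\<Sum>j\<in>UNIV. gen j \<odot> sphere_avg (\<lambda>w. w $ j *\<^sub>R Q z w))"
      unfolding sum_Basis_real_prod sum_Basis_vec by (simp add: vec_cl_axis v0 clmul.zero_left inner_axis')
    also have "\<dots> = sphere_avg (P z) + (\<Sum>j\<in>UNIV. sphere_avg (\<lambda>w. gen j \<odot> (w $ j *\<^sub>R Q z w)))"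
      by (simp only: sphere_avg_bounded_linear[OF clmul.bounded_linear_right c1])
    also have "\<dots> = sphere_avg (P z) + sphere_avg (\<lambda>w. \<Sum>j\<in>UNIV. gen j \<odot> (w $ j *\<^sub>R Q z w))"
      by (subst sphere_avg_sum) (auto intro!: bounded_linear.continuous_on[OF clmul.bounded_linear_right c1])
    also have "\<dots> = sphere_avg (\<lambda>w. P z w + (\<Sum>j\<in>UNIV. gen j \<odot> (w $ j *\<^sub>R Q z w)))"
      by (subst sphere_avg_add) (auto intro!: cP1 continuous_on_sum bounded_linear.continuous_on[OF clmul.bounded_linear_right c1])
    also have "\<dots> = sphere_avg (\<lambda>w::(real, 'n) vec. 0 :: 'n clif)"
      by (rule sphere_avg_cong) (simp add: PQ vec_cl_clmul[symmetric] clmul.scaleR_right)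
    finally show "(\<Sum>b\<in>Basis. fst b *\<^sub>R sphere_avg (\<lambda>w. fst b *\<^sub>R P z w + (snd b \<bullet> w) *\<^sub>R Q z w) + vec_cl (snd b) \<odot> sphere_avg (\<lambda>w. fst b *\<^sub>R P z w + (snd b \<bullet> w) *\<^sub>R Q z w)) = 0"
      by simp
  qed
  then show ?thesis by (simp add: M0_def monogenic_iff_sol)
qed

lemma M0_add: "f \<in> M0 \<Longrightarrow> g \<in> M0 \<Longrightarrow> (\<lambda>z. f z + g z) \<in> M0"
proof -
  assume "f \<in> M0" "g \<in> M0"
  then have f: "monogenic_system.sol f" and g: "monogenic_system.sol g" by (simp_all add: M0_def monogenic_iff_sol)
  have "monogenic_system.sol (\<lambda>z. f z + g z)"
  proof (rule monogenic_system.solI[OF has_derivative_add[OF monogenic_system.sol_derivative[OF f] monogenic_system.sol_derivative[OF g]]])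
    fix z
    have "(\<Sum>b\<in>Basis. fst b *\<^sub>R (frechet_derivative f (at z) b + frechet_derivative g (at z) b) + vec_cl (snd b) \<odot> (frechet_derivative f (at z) b + frechet_derivative g (at z) b))
      = (\<Sum>b\<in>Basis. fst b *\<^sub>R frechet_derivative f (at z) b + vec_cl (snd b) \<odot> frechet_derivative f (at z) b)
        + (\<Sum>b\<in>Basis. fst b *\<^sub>R frechet_derivative g (at z) b + vec_cl (snd b) \<odot> frechet_derivative g (at z) b)"
      unfolding sum.distrib[symmetric] by (intro sum.cong refl) (simp add: scaleR_add_right clmul.add_right)
    then show "(\<Sum>b\<in>Basis. fst b *\<^sub>R (frechet_derivative f (at z) b + frechet_derivative g (at z) b) + vec_cl (snd b) \<odot> (frechet_derivative f (at z) b + frechet_derivative g (at z) b)) = 0"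
      unfolding monogenic_system.sol_eq[OF f] monogenic_system.sol_eq[OF g] by simp
  qed
  then show ?thesis by (simp add: M0_def monogenic_iff_sol)
qed

lemma M0_linear_image:
  fixes f :: "'n::{finite,linorder} monofun"
  assumes "f \<in> M0" and L: "bounded_linear L" "\<And>u v. L (u \<odot> v) = u \<odot> L v"
  shows "(\<lambda>z. L (f z)) \<in> M0"
proof -
  have f: "monogenic_system.sol f" using assms(1) by (simp add: M0_def monogenic_iff_sol)
  note lin = bounded_linear.linear[OF L(1)]
  have "monogenic_system.sol (\<lambda>z. L (f z))"
  proof (rule monogenic_system.solI[OF bounded_linear.has_derivative[OF L(1) monogenic_system.sol_derivative[OF f]]])
    fix z
    show "(\<Sum>b\<in>Basis. fst b *\<^sub>R L (frechet_derivative f (at z) b) + vec_cl (snd b) \<odot> L (frechet_derivative f (at z) b)) = 0"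
      unfolding L(2)[symmetric] linear_cmul[OF lin, symmetric] linear_add[OF lin, symmetric] linear_sum[OF lin, symmetric]
        monogenic_system.sol_eq[OF f] by (rule linear_0[OF lin])
  qed
  then show ?thesis by (simp add: M0_def monogenic_iff_sol)
qed

text \<open>For each fixed \<omega> the function of \<open>x0\<close> and \<open>p\<close> solves an
  elliptic system in the plane, so \<open>sol_zero_on_hyperplane\<close> applies slice by
  slice.\<close>

lemma S0_zero_unique:
  fixes f :: "'n::{finite,linorder} slicefun"
  assumes f: "f \<in> S0" and z: "\<And>p w. w \<in> sphere 0 1 \<Longrightarrow> f (0, p, w) = 0"
  shows "f = (\<lambda>z. 0)"
proof (rule S0_extension[OF f])
  fix F assume F: "smooth F" "\<And>x0 p w. w \<in> sphere 0 1 \<Longrightarrow> F (x0, p, w) = f (x0, p, w)"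
    and eq: "\<And>x0 p w. w \<in> sphere 0 1 \<Longrightarrow> frechet_derivative F (at (x0, p, w)) (1, 0, 0) + vec_cl w \<odot> frechet_derivative F (at (x0, p, w)) (0, 1, 0) = 0"
  have "f (x0, p, w) = 0" if w: "w \<in> sphere 0 1" for x0 p w
  proof -
    interpret slice: elliptic_system "\<lambda>(b :: real \<times> real) u. fst b *\<^sub>R u + snd b *\<^sub>R (vec_cl w \<odot> u)" "\<lambda>b u. fst b *\<^sub>R u - snd b *\<^sub>R (vec_cl w \<odot> u)"
      by (rule slice_elliptic_system[OF w])
    define G where "G z = F (fst z, snd z, w)" for z
    have dG: "(G has_derivative (\<lambda>v. frechet_derivative F (at (fst z, snd z, w)) (fst v, snd v, 0))) (at z)" for z
    proof -
      have "((\<lambda>z. (fst z, snd z, w)) has_derivative (\<lambda>v. (fst v, snd v, 0))) (at z)"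
        by (intro has_derivative_Pair has_derivative_fst has_derivative_snd has_derivative_ident has_derivative_const)
      from has_derivative_compose[OF this smooth_derivative(1)[OF F(1)]] show ?thesis by (simp add: G_def[abs_def])
    qed
    have G: "slice.sol G"
    proof (rule slice.solI[OF dG])
      show "(\<Sum>b\<in>Basis. fst b *\<^sub>R frechet_derivative F (at (fst z, snd z, w)) (fst b, snd b, 0) + snd b *\<^sub>R (vec_cl w \<odot> frechet_derivative F (at (fst z, snd z, w)) (fst b, snd b, 0))) = 0" for z
        using eq[OF w, of "fst z" "snd z"] unfolding sum_Basis_real_prod by simp
    qed
    have "G (x0, p) = 0"
    proof (rule slice.sol_zero_on_hyperplane[OF G, of "(1, 0)"])
      show "(1, 0) \<in> (Basis :: (real \<times> real) set)" by (simp add: Basis_prod_def)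
      fix y :: "real \<times> real" assume "y \<bullet> (1, 0) = 0"
      then have "fst y = 0" by (simp add: inner_prod_def inner_real_def)
      then show "G y = 0" using z[OF w] F(2)[OF w] by (simp add: G_def)
    qed simp
    then show ?thesis using F(2)[OF w] by (simp add: G_def)
  qed
  then have "f (x0, p, w) = 0" for x0 p w using S0_outside[OF f] by (cases "w \<in> sphere 0 1") auto
  then show ?thesis by (intro ext) (simp add: split_paired_all)
qed

section \<open>The submodule \<open>SM0\<close> and the dual Radon transform on it\<close>

lemma SM0_I:
  assumes "f \<in> S0" "F \<in> M0" "\<And>p w. w \<in> sphere 0 1 \<Longrightarrow> f (0, p, w) = F (0, p *\<^sub>R w)"
  shows "f \<in> SM0"
proof -
  have "\<exists>f0\<in>M0_restr. \<forall>p. \<forall>w\<in>sphere 0 1. f (0, p, w) = f0 (p *\<^sub>R w)"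
  proof (rule bexI[of _ "\<lambda>x. F (0, x)"])
    show "(\<lambda>x. F (0, x)) \<in> M0_restr" unfolding M0_restr_def mem_Collect_eq by (rule bexI[OF _ assms(2)]) simp
    show "\<forall>p. \<forall>w\<in>sphere 0 1. f (0, p, w) = F (0, p *\<^sub>R w)" by (intro allI ballI assms(3))
  qed
  then show ?thesis using assms(1) by (simp add: SM0_def)
qed

lemma SM0_D:
  assumes "f \<in> SM0"
  shows "\<exists>F. f \<in> S0 \<and> F \<in> M0 \<and> (\<forall>p. \<forall>w\<in>sphere 0 1. f (0, p, w) = F (0, p *\<^sub>R w))"
proof -
  obtain f0 where f: "f \<in> S0" "f0 \<in> M0_restr" and e: "\<forall>p. \<forall>w\<in>sphere 0 1. f (0, p, w) = f0 (p *\<^sub>R w)"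
    using assms unfolding SM0_def by blast
  obtain F where F: "F \<in> M0" and e': "\<forall>x. f0 x = F (0, x)" using f(2) unfolding M0_restr_def by blast
  have "f \<in> S0 \<and> F \<in> M0 \<and> (\<forall>p. \<forall>w\<in>sphere 0 1. f (0, p, w) = F (0, p *\<^sub>R w))" using f(1) F e e' by simp
  then show ?thesis by (rule exI[of _ F])
qed

text \<open>At \<open>x0 = 0\<close> the series of the transform vanishes. Along each ray it is a
  power series in the scaling parameter, which separates the degrees, and each degree is settled by
  \<open>tavg_injective\<close>.\<close>

lemma SM0_kernel_trivial:
  fixes h :: "'n::{finite,linorder} slicefun"
  assumes h: "h \<in> SM0" and k: "dualRadon h = (\<lambda>y. 0)"
  shows "h = (\<lambda>z. 0)"
proof -
  obtain F where hS: "h \<in> S0" and F: "F \<in> M0" and hF: "\<forall>p. \<forall>w\<in>sphere 0 1. h (0, p, w) = F (0, p *\<^sub>R w)"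
    using SM0_D[OF h] by (elim exE conjE)
  obtain a where a: "tsym a" "rapid a" and sums: "\<forall>x. (\<lambda>k. tpoly k a x) sums F (0, x)"
    using M0_expansion[OF F] by (elim exE conjE)
  have Fx: "F (0, x) = (\<Sum>k. tpoly k a x)" for x using sums by (simp add: sums_iff)
  have "(\<lambda>k. tpoly k (tavg k a) x) sums 0" for x
  proof -
    have "dualRadon h (0, x) = sphere_avg (\<lambda>w. \<Sum>k. tpoly k a ((x \<bullet> w) *\<^sub>R w))"
      unfolding dualRadon_def prod.case by (rule sphere_avg_cong) (simp add: hF Fx)
    then show ?thesis using sphere_avg_series[OF a(2), of x] k by simp
  qed
  then have "(\<lambda>k. t ^ k *\<^sub>R tpoly k (tavg k a) x) sums 0" for t x
    unfolding tpoly_scaleR[symmetric] .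
  then have "tpoly k (tavg k a) x = 0" for k x by (rule power_series_zero)
  then have "a J = 0" for J by (rule tavg_injective[OF a(1) _ refl])
  then have "F (0, x) = 0" for x unfolding Fx by (simp add: tpoly_def)
  then show ?thesis using hF by (intro S0_zero_unique[OF hS]) simp
qed

lemma SM0_onto:
  fixes F :: "'n::{finite,linorder} monofun"
  assumes F: "F \<in> M0"
  shows "\<exists>h\<in>SM0. dualRadon h = F"
proof -
  obtain a where a: "tsym a" "rapid a" and sums: "\<forall>x. (\<lambda>k. tpoly k a x) sums F (0, x)"
    using M0_expansion[OF F] by (elim exE conjE)
  obtain b where b: "tsym b" "rapid b" and ba: "\<forall>k J. length J = k \<longrightarrow> tavg k b J = a J"
    using rapid_tavg_inverse[OF a] by (elim exE conjE)
  obtain c where c: "tsym c" "rapid c" and cb: "\<forall>k J. length J = k \<longrightarrow> tavg k c J = b J"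
    using rapid_tavg_inverse[OF b] by (elim exE conjE)
  have pb: "tpoly k (tavg k b) = tpoly k a" for k by (rule tpoly_cong) (rule ba[rule_format])
  have pc: "tpoly k (tavg k c) = tpoly k b" for k by (rule tpoly_cong) (rule cb[rule_format])
  have R: "(\<lambda>k. tpoly k b x) sums dualRadon (slice_fun c) (0, x)" for x
    using dualRadon_slice_fun[OF c(2), of x] unfolding pc .
  have bS: "slice_fun b \<in> SM0"
  proof (rule SM0_I[OF slice_fun_S0[OF b(2)] dualRadon_M0[OF slice_fun_S0[OF c(2)]]])
    show "slice_fun b (0, p, w) = dualRadon (slice_fun c) (0, p *\<^sub>R w)" if "w \<in> sphere 0 1" for p w
      unfolding slice_fun_0[OF that] by (rule sums_unique[OF R, symmetric])
  qed
  have D: "dualRadon (slice_fun b) \<in> M0" by (rule dualRadon_M0[OF slice_fun_S0[OF b(2)]])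
  have bl: "bounded_linear (\<lambda>u::'n clif. - u)" by (intro bounded_linear_minus bounded_linear_ident)
  \<comment> \<open>Both functions are monogenic and agree for \<open>x0 = 0\<close>, hence
    everywhere.\<close>
  have "(\<lambda>z. dualRadon (slice_fun b) z + - F z) = (\<lambda>z. 0)"
  proof (rule M0_zero_unique[OF M0_add[OF D M0_linear_image[OF F bl]]])
    show "- (u \<odot> v) = u \<odot> - v" for u v :: "'n clif" by (simp add: clmul.minus_right)
    fix x
    have "dualRadon (slice_fun b) (0, x) = F (0, x)"
      by (rule sums_unique2[OF dualRadon_slice_fun[OF b(2), of x, unfolded pb] sums[rule_format]])
    then show "dualRadon (slice_fun b) (0, x) + - F (0, x) = 0" by simp
  qed
  then have "dualRadon (slice_fun b) z + - F z = 0" for z by (rule fun_cong)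
  then have "dualRadon (slice_fun b) = F" by (intro ext) simp
  then show ?thesis using bS by (rule bexI)
qed

lemma SM0_add:
  fixes f g :: "'n::{finite,linorder} slicefun"
  assumes "f \<in> SM0" "g \<in> SM0"
  shows "(\<lambda>z. f z + g z) \<in> SM0"
proof -
  obtain F where f: "f \<in> S0" and F: "F \<in> M0" "\<forall>p. \<forall>w\<in>sphere 0 1. f (0, p, w) = F (0, p *\<^sub>R w)"
    using SM0_D[OF assms(1)] by (elim exE conjE)
  obtain G where g: "g \<in> S0" and G: "G \<in> M0" "\<forall>p. \<forall>w\<in>sphere 0 1. g (0, p, w) = G (0, p *\<^sub>R w)"
    using SM0_D[OF assms(2)] by (elim exE conjE)
  show ?thesis by (rule SM0_I[OF S0_add[OF f g] M0_add[OF F(1) G(1)]]) (simp add: F(2) G(2))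
qed

lemma SM0_linear_image:
  fixes f :: "'n::{finite,linorder} slicefun"
  assumes "f \<in> SM0" and L: "bounded_linear L" "\<And>u v. L (u \<odot> v) = u \<odot> L v"
  shows "(\<lambda>z. L (f z)) \<in> SM0"
proof -
  obtain F where f: "f \<in> S0" and F: "F \<in> M0" "\<forall>p. \<forall>w\<in>sphere 0 1. f (0, p, w) = F (0, p *\<^sub>R w)"
    using SM0_D[OF assms(1)] by (elim exE conjE)
  show ?thesis by (rule SM0_I[OF S0_linear_image[OF f L] M0_linear_image[OF F(1) L]]) (simp add: F(2))
qed

lemma linear_cl_right: "bounded_linear (\<lambda>u. u \<odot> a)" "(u \<odot> v) \<odot> a = u \<odot> (v \<odot> a)"
  by (rule clmul.bounded_linear_left, rule clmul_assoc)

lemma linear_cl_uminus: "bounded_linear (\<lambda>u::'n::{finite,linorder} clif. - u)" "- (u \<odot> v) = u \<odot> - (v :: 'n clif)"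
  by (intro bounded_linear_minus bounded_linear_ident) (simp add: clmul.minus_right)

theorem theoremA:
  shows
    \<comment> \<open>the dual Radon transform S is right R_n-linear on S_0\<close>
    "(\<forall>f\<in>(S0 :: ('n::{finite,linorder}) slicefun set). \<forall>g\<in>S0.
         dualRadon (\<lambda>z. f z + g z) = (\<lambda>y. dualRadon f y + dualRadon g y))
     \<and> (\<forall>f\<in>(S0 :: 'n slicefun set). \<forall>a. dualRadon (\<lambda>z. f z \<odot> a) = (\<lambda>y. dualRadon f y \<odot> a))
     \<comment> \<open>S maps S_0 onto M_0\<close>
     \<and> dualRadon ` (S0 :: 'n slicefun set) = (M0 :: 'n monofun set)
     \<comment> \<open>SM_0 is a submodule of S_0 (SM0 is a subset of S0 by definition)\<close>
     \<and> (\<lambda>z. 0) \<in> (SM0 :: 'n slicefun set)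
     \<and> (\<forall>f\<in>(SM0 :: 'n slicefun set). \<forall>g\<in>SM0. (\<lambda>z. f z + g z) \<in> SM0)
     \<and> (\<forall>f\<in>(SM0 :: 'n slicefun set). \<forall>a. (\<lambda>z. f z \<odot> a) \<in> SM0)
     \<comment> \<open>S_0 = ker S (+) SM_0 (direct sum)\<close>
     \<and> (\<forall>f\<in>(S0 :: 'n slicefun set). \<exists>!gh.
            fst gh \<in> {k\<in>S0. dualRadon k = (\<lambda>y. 0)} \<and> snd gh \<in> SM0
            \<and> f = (\<lambda>z. fst gh z + snd gh z))
     \<comment> \<open>S restricted to SM_0 is a bijection (being linear, an isomorphism) onto M_0\<close>
     \<and> bij_betw dualRadon (SM0 :: 'n slicefun set) (M0 :: 'n monofun set)"
proof -
  have SM0_S0: "f \<in> S0" if "f \<in> SM0" for f :: "'n slicefun" using that by (simp add: SM0_def)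
  have diff: "(\<lambda>z. f z + - g z) \<in> SM0" if "f \<in> SM0" "g \<in> SM0" for f g :: "'n slicefun"
    by (rule SM0_add[OF that(1) SM0_linear_image[OF that(2) linear_cl_uminus]])
  have Rdiff: "dualRadon (\<lambda>z. f z + - g z) = (\<lambda>y. dualRadon f y + - dualRadon g y)" if "f \<in> S0" "g \<in> S0" for f g :: "'n slicefun"
    using dualRadon_add[OF that(1) S0_linear_image[OF that(2) linear_cl_uminus]] dualRadon_linear_image[OF that(2) linear_cl_uminus(1)]
    by (simp only:)
  have inj: "f = g" if "f \<in> SM0" "g \<in> SM0" "dualRadon f = dualRadon g" for f g :: "'n slicefun"
  proof -
    have "dualRadon (\<lambda>z. f z + - g z) = (\<lambda>y. 0)"
      unfolding Rdiff[OF SM0_S0[OF that(1)] SM0_S0[OF that(2)]] that(3) by simp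
    from SM0_kernel_trivial[OF diff[OF that(1,2)] this] have "(\<lambda>z. f z + - g z) = (\<lambda>z. 0)" .
    then have "f z + - g z = 0" for z by (rule fun_cong)
    then show ?thesis by (intro ext) simp
  qed
  have bij: "bij_betw dualRadon (SM0 :: 'n slicefun set) (M0 :: 'n monofun set)"
  proof (rule bij_betw_imageI)
    show "inj_on dualRadon (SM0 :: 'n slicefun set)" by (rule inj_onI) (rule inj)
    show "dualRadon ` (SM0 :: 'n slicefun set) = M0"
    proof
      show "dualRadon ` (SM0 :: 'n slicefun set) \<subseteq> M0" using dualRadon_M0 SM0_S0 by blast
      show "M0 \<subseteq> dualRadon ` (SM0 :: 'n slicefun set)" using SM0_onto by blast
    qed
  qed
  have onto: "dualRadon ` (S0 :: 'n slicefun set) = (M0 :: 'n monofun set)"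
  proof
    show "dualRadon ` (S0 :: 'n slicefun set) \<subseteq> M0" using dualRadon_M0 by blast
    show "M0 \<subseteq> dualRadon ` (S0 :: 'n slicefun set)" using SM0_onto SM0_S0 by blast
  qed
  have zero: "(\<lambda>z. 0) \<in> (SM0 :: 'n slicefun set)"
  proof -
    \<comment> \<open>Surjectivity, applied to some transform, provides an element \<open>h\<close>
      of \<open>SM0\<close>; the zero function is then \<open>h - h\<close>.\<close>
    obtain h :: "'n slicefun" where h: "h \<in> SM0"
      using SM0_onto[OF dualRadon_M0[OF slice_fun_S0[of "\<lambda>J. 0 :: 'n clif"]]] by (auto simp: rapid_def)
    show ?thesis using diff[OF h h] by simp
  qed
  have decomp: "\<exists>!gh. fst gh \<in> {k\<in>S0. dualRadon k = (\<lambda>y. 0)} \<and> snd gh \<in> SM0 \<and> f = (\<lambda>z. fst gh z + snd gh z)"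
    if f: "f \<in> S0" for f :: "'n slicefun"
  proof -
    \<comment> \<open>The component in \<open>SM0\<close> is forced: it is the preimage in
      \<open>SM0\<close> of the transform of \<open>f\<close>.\<close>
    obtain h where h: "h \<in> SM0" "dualRadon h = dualRadon f" using SM0_onto[OF dualRadon_M0[OF f]] by blast
    define g where "g z = f z + - h z" for z
    have "g \<in> S0" unfolding g_def[abs_def]
      by (rule S0_add[OF f S0_linear_image[OF SM0_S0[OF h(1)] linear_cl_uminus]])
    moreover have "dualRadon g = (\<lambda>y. 0)" unfolding g_def[abs_def] Rdiff[OF f SM0_S0[OF h(1)]] h(2) by simp
    ultimately have ex: "g \<in> {k\<in>S0. dualRadon k = (\<lambda>y. 0)}" by simp
    have fgh: "f = (\<lambda>z. g z + h z)" by (simp add: g_def)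
    show ?thesis
    proof (rule ex1I[of _ "(g, h)"])
      show "fst (g, h) \<in> {k\<in>S0. dualRadon k = (\<lambda>y. 0)} \<and> snd (g, h) \<in> SM0 \<and> f = (\<lambda>z. fst (g, h) z + snd (g, h) z)"
        using ex h(1) fgh by simp
      fix gh assume gh: "fst gh \<in> {k\<in>S0. dualRadon k = (\<lambda>y. 0)} \<and> snd gh \<in> SM0 \<and> f = (\<lambda>z. fst gh z + snd gh z)"
      then have f2: "f = (\<lambda>z. fst gh z + snd gh z)" and k: "fst gh \<in> S0" "dualRadon (fst gh) = (\<lambda>y. 0)" and s: "snd gh \<in> SM0" by simp_all
      have "dualRadon f = dualRadon (snd gh)"
        using dualRadon_add[OF k(1) SM0_S0[OF s]] unfolding f2[symmetric] k(2) by simp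
      then have sh: "snd gh = h" by (intro inj s h(1)) (simp add: h(2))
      have "fst gh z = g z" for z using fun_cong[OF f2, of z] by (simp add: g_def sh)
      then show "gh = (g, h)" using sh by (intro prod_eqI) auto
    qed
  qed
  have mult: "dualRadon (\<lambda>z. f z \<odot> a) = (\<lambda>y. dualRadon f y \<odot> a)" if "f \<in> S0" for f :: "'n slicefun" and a
    by (rule dualRadon_linear_image[OF that linear_cl_right(1)])
  have smult: "(\<lambda>z. f z \<odot> a) \<in> SM0" if "f \<in> SM0" for f :: "'n slicefun" and a
    by (rule SM0_linear_image[OF that linear_cl_right])
  show ?thesis
    using dualRadon_add mult onto zero SM0_add smult decomp bij by (intro conjI ballI allI) blast+
qed

end
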